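(* Let $T$ be the $(d_0,d_1)$-semiregular tree with $d_0,d_1\geq 6$. Let $H\in\mathcal{H}_T^+$ be such that $\underline{H}(x)\cong F_0\geq\mathrm{Alt}(d_0)$ for each $x\in V_0(T)$ and $\underline{H}(y)\cong F_1\geq\mathrm{Alt}(d_1)$ for each $y\in V_1(T)$. Then there exists a legal coloring $i$ of $T$ such that $H\supseteq\mathrm{Alt}_{(i)}(T)^+$.
   Context: The $(d_0,d_1)$-semiregular tree $T$ is the tree whose vertex set has a bipartition $V(T)=V_0(T)\sqcup V_1(T)$ such that every edge joins $V_0(T)$ to $V_1(T)$ and each vertex of type $t$ (i.e. in $V_t(T)$) is incident to exactly $d_t$ edges. $\mathrm{Aut}(T)$ carries the topology of pointwise convergence on vertices; $\mathrm{Aut}(T)^+$ is the subgroup of automorphisms preserving $V_0(T)$ and $V_1(T)$. $\partial T$ is the set of ends of $T$. $\mathcal{H}_T^+$ is the set of closed subgroups of $\mathrm{Aut}(T)$ that are contained in $\mathrm{Aut}(T)^+$ and $2$-transitive on $\partial T$. For $v\in V(T)$, $\underline{H}(v)\leq\mathrm{Sym}(E(v))$ is the permutation group induced by the stabilizer $H(v)$ of $v$ on the set $E(v)$ of edges incident to $v$; $\cong$ between finite permutation groups means permutation isomorphic, with $F_t\leq\mathrm{Sym}(d_t)$. $S(v,r)$ is the set of vertices at distance exactly $r$ from $v$. A legal coloring $i$ of $T$ is a map on $V(T)$ given by $i_0\colon V_0(T)\to\{1,\dots,d_1\}$ and $i_1\colon V_1(T)\to\{1,\dots,d_0\}$ such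 that for each $v\in V_1(T)$ the restriction $i_0|_{S(v,1)}$ is a bijection onto $\{1,\dots,d_1\}$, and for each $v\in V_0(T)$ the restriction $i_1|_{S(v,1)}$ is a bijection onto $\{1,\dots,d_0\}$. For $g\in\mathrm{Aut}(T)$ and $v\in V(T)$ put $\sigma_{(i)}(g,v)=i|_{S(g(v),1)}\circ g\circ i|_{S(v,1)}^{-1}$, a permutation in $\mathrm{Sym}(d_t)$ where $t$ is the type of $v$. Then $\mathrm{Alt}_{(i)}(T)^+:=\{g\in\mathrm{Aut}(T)^+ : \sigma_{(i)}(g,v)\text{ is even for each }v\in V(T)\}$. *)

theory Defs
  imports "HOL-Algebra.Sym_Groups" "HOL-Analysis.Function_Topology"
begin

section \<open>Graphs with a bipartition\<close>

record 'a bigraph =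
  part0 :: "'a set"
  part1 :: "'a set"
  edges :: "'a set set"

definition verts :: "'a bigraph \<Rightarrow> 'a set" where
  "verts T = part0 T \<union> part1 T"

definition edges_at :: "'a bigraph \<Rightarrow> 'a \<Rightarrow> 'a set set" where
  "edges_at T v = {e \<in> edges T. v \<in> e}"

definition walk :: "'a bigraph \<Rightarrow> 'a list \<Rightarrow> bool" where
  "walk T p \<longleftrightarrow> p \<noteq> [] \<and> set p \<subseteq> verts T \<and> successively (\<lambda>u v. {u, v} \<in> edges T) p"

definition graph_dist :: "'a bigraph \<Rightarrow> 'a \<Rightarrow> 'a \<Rightarrow> nat" where
  "graph_dist T u v = (LEAST n. \<exists>p. walk T p \<and> hd p = u \<and> last p = v \<and> length p = Suc n)"

definition vertex_sphere :: "'a bigraph \<Rightarrow> 'a \<Rightarrow> nat \<Rightarrow> 'a set" where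
  "vertex_sphere T v r = {u \<in> verts T. graph_dist T v u = r}"

definition graph_connected :: "'a bigraph \<Rightarrow> bool" where
  "graph_connected T \<longleftrightarrow>
     (\<forall>u \<in> verts T. \<forall>v \<in> verts T. \<exists>p. walk T p \<and> hd p = u \<and> last p = v)"

definition graph_acyclic :: "'a bigraph \<Rightarrow> bool" where
  "graph_acyclic T \<longleftrightarrow>
     \<not> (\<exists>p. walk T p \<and> distinct p \<and> length p \<ge> 3 \<and> {last p, hd p} \<in> edges T)"

definition semiregular_tree :: "nat \<Rightarrow> nat \<Rightarrow> 'a bigraph \<Rightarrow> bool" where
  "semiregular_tree d0 d1 T \<longleftrightarrow>
     verts T \<noteq> {} \<and>
     part0 T \<inter> part1 T = {} \<and>
     (\<forall>e \<in> edges T. \<exists>x \<in> part0 T. \<exists>y \<in> part1 T. e = {x, y}) \<and>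
     graph_connected T \<and> graph_acyclic T \<and>
     (\<forall>x \<in> part0 T. finite (edges_at T x) \<and> card (edges_at T x) = d0) \<and>
     (\<forall>y \<in> part1 T. finite (edges_at T y) \<and> card (edges_at T y) = d1)"


section \<open>Automorphisms and their topology\<close>

text \<open>As for \<^const>\<open>sym_group\<close>, automorphisms are the identity outside the vertex set.
  They may interchange the two parts.\<close>

definition aut_group :: "'a bigraph \<Rightarrow> ('a \<Rightarrow> 'a) monoid" where
  "aut_group T =
     \<lparr>carrier = {g. g permutes verts T \<and>
        (\<forall>u \<in> verts T. \<forall>v \<in> verts T. {g u, g v} \<in> edges T \<longleftrightarrow> {u, v} \<in> edges T)},
      mult = (\<circ>), one = id\<rparr>"

definition aut_plus :: "'a bigraph \<Rightarrow> ('a \<Rightarrow> 'a) set" where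
  "aut_plus T = {g \<in> carrier (aut_group T). g ` part0 T = part0 T \<and> g ` part1 T = part1 T}"

definition aut_topology :: "'a bigraph \<Rightarrow> ('a \<Rightarrow> 'a) topology" where
  "aut_topology T =
     pullback_topology (carrier (aut_group T)) (\<lambda>g. restrict g (verts T))
       (product_topology (\<lambda>_. discrete_topology (verts T)) (verts T))"


section \<open>Ends\<close>

definition rays :: "'a bigraph \<Rightarrow> (nat \<Rightarrow> 'a) set" where
  "rays T = {r. inj r \<and> range r \<subseteq> verts T \<and> (\<forall>n. {r n, r (Suc n)} \<in> edges T)}"

text \<open>In a tree, two rays are equivalent iff they eventually coincide up to a shift of the
  parameter.\<close>

definition ray_equiv :: "'a bigraph \<Rightarrow> ((nat \<Rightarrow> 'a) \<times> (nat \<Rightarrow> 'a)) set" where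
  "ray_equiv T = {(r, s). r \<in> rays T \<and> s \<in> rays T \<and> (\<exists>m n. \<forall>k. r (m + k) = s (n + k))}"

definition ends :: "'a bigraph \<Rightarrow> (nat \<Rightarrow> 'a) set set" where
  "ends T = rays T // ray_equiv T"

definition act_end :: "('a \<Rightarrow> 'a) \<Rightarrow> (nat \<Rightarrow> 'a) set \<Rightarrow> (nat \<Rightarrow> 'a) set" where
  "act_end g \<xi> = (\<lambda>r. g \<circ> r) ` \<xi>"

definition two_transitive :: "'g set \<Rightarrow> ('g \<Rightarrow> 'x \<Rightarrow> 'x) \<Rightarrow> 'x set \<Rightarrow> bool" where
  "two_transitive H act X \<longleftrightarrow>
     (\<forall>x \<in> X. \<forall>x' \<in> X. \<forall>y \<in> X. \<forall>y' \<in> X. x \<noteq> x' \<longrightarrow> y \<noteq> y' \<longrightarrow>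
        (\<exists>h \<in> H. act h x = y \<and> act h x' = y'))"

definition closed_two_transitive_groups :: "'a bigraph \<Rightarrow> ('a \<Rightarrow> 'a) set set" where
  "closed_two_transitive_groups T =
     {H. subgroup H (aut_group T) \<and> closedin (aut_topology T) H \<and> H \<subseteq> aut_plus T \<and>
         two_transitive H act_end (ends T)}"


section \<open>Local actions\<close>

definition local_action :: "'a bigraph \<Rightarrow> ('a \<Rightarrow> 'a) set \<Rightarrow> 'a \<Rightarrow> ('a set \<Rightarrow> 'a set) set" where
  "local_action T H v = {restrict_id ((`) h) (edges_at T v) | h. h \<in> H \<and> h v = v}"

definition perm_isomorphic ::
    "'x set \<Rightarrow> ('x \<Rightarrow> 'x) set \<Rightarrow> 'y set \<Rightarrow> ('y \<Rightarrow> 'y) set \<Rightarrow> bool" where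
  "perm_isomorphic X P Y F \<longleftrightarrow> (\<exists>b. bij_betw b X Y \<and> map_permutation X b ` P = F)"


section \<open>Legal colorings\<close>

definition legal_coloring :: "nat \<Rightarrow> nat \<Rightarrow> 'a bigraph \<Rightarrow> ('a \<Rightarrow> nat) \<Rightarrow> bool" where
  "legal_coloring d0 d1 T i \<longleftrightarrow>
     i ` part0 T \<subseteq> {1..d1} \<and> i ` part1 T \<subseteq> {1..d0} \<and>
     (\<forall>v \<in> part1 T. bij_betw i (vertex_sphere T v 1) {1..d1}) \<and>
     (\<forall>v \<in> part0 T. bij_betw i (vertex_sphere T v 1) {1..d0})"

text \<open>For a legal coloring, the image of the sphere around \<open>v\<close> is \<open>{1..d}\<close> where \<open>d\<close> is the
  degree of \<open>v\<close>; the local permutation is extended by the identity outside this set.\<close>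

definition sigma :: "'a bigraph \<Rightarrow> ('a \<Rightarrow> nat) \<Rightarrow> ('a \<Rightarrow> 'a) \<Rightarrow> 'a \<Rightarrow> nat \<Rightarrow> nat" where
  "sigma T i g v =
     restrict_id (i \<circ> g \<circ> inv_into (vertex_sphere T v 1) i) (i ` vertex_sphere T v 1)"

definition alt_plus :: "'a bigraph \<Rightarrow> ('a \<Rightarrow> nat) \<Rightarrow> ('a \<Rightarrow> 'a) set" where
  "alt_plus T i = {g \<in> aut_plus T. \<forall>v \<in> verts T. evenperm (sigma T i g v)}"

end

theory Submission
  imports Defs
begin

text \<open>Two-transitivity on the ends makes \<open>H\<close> transitive on pairs of vertices of given types at a given
  distance. Since the alternating group on at least five points is simple, the pointwise stabilizer of a
  ball of radius \<open>r \<ge> 1\<close> induces, independently at the different vertices of the bounding sphere, all even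
  permutations of the neighbours outside the ball: commutators of elements fixing large balls around
  different centres separate the factors. As \<open>H\<close> is closed, it therefore contains elements of order three
  that permute three branches at a vertex cyclically and fix all other branches pointwise. With these,
  the branches at \<open>x\<close> can be identified with each other in such a way that a subgroup of \<open>H\<close> permutes them
  through the alternating group of \<open>N x\<close> alone. Do this at both ends of an edge. Transporting
  colours along the identifications gives a legal coloring \<open>i\<close> for which both subgroups lie in
  the group of \<open>i\<close>-even automorphisms, and together they generate a dense subgroup of it.\<close>

section \<open>Even permutations of finite sets\<close>

text \<open>The obstacle is that no hypothesis directly provides an element of \<open>H\<close>
  fixing a half tree: a priori the local groups at different vertices could determine one another.
  Two facts break such links. A commutator is trivial wherever one factor is trivial and the other
  preserves the set, and one nontrivial element of a normalized group yields all even permutations.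
  The second fact is applied to the neighbours of a vertex that point away from a centre; there are
  at least 6 - 1 = 5 of them, which is where the degree bound enters. Commutators are also even, so
  they can be corrected even if \<open>H\<close> acts locally by odd permutations. Order three is
  needed because the 3-cycle is the smallest even permutation and because one full turn through
  three branches must return by the identity; otherwise the identifications of branches would
  contradict each other. The colouring is thus read off from \<open>H\<close>. One vertex does not
  suffice, since the subgroup built at \<open>x\<close> fixes \<open>x\<close>; the subgroups at the
  two ends of an edge together move every vertex of the tree to that edge.\<close>

definition perm_group :: "('b \<Rightarrow> 'b) set \<Rightarrow> bool" where
  "perm_group K \<longleftrightarrow> id \<in> K \<and> (\<forall>g\<in>K. bij g \<and> inv' g \<in> K) \<and> (\<forall>g\<in>K. \<forall>h\<in>K. g \<circ> h \<in> K)"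

lemma perm_groupD:
  assumes "perm_group K"
  shows "id \<in> K" "g \<in> K \<Longrightarrow> bij g" "g \<in> K \<Longrightarrow> inv' g \<in> K"
    "g \<in> K \<Longrightarrow> h \<in> K \<Longrightarrow> g \<circ> h \<in> K"
  using assms unfolding perm_group_def by auto

lemma perm_groupI:
  assumes "id \<in> K" "\<And>g. g \<in> K \<Longrightarrow> bij g" "\<And>g. g \<in> K \<Longrightarrow> inv' g \<in> K"
    "\<And>g h. g \<in> K \<Longrightarrow> h \<in> K \<Longrightarrow> g \<circ> h \<in> K"
  shows "perm_group K"
  using assms unfolding perm_group_def by auto

lemma bij_inv_apply [simp]:
  assumes "bij g"
  shows "inv' g (g u) = u" "g (inv' g v) = v"
  using assms by (auto simp: bij_is_inj bij_is_surj surj_f_inv_f)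

lemma bij_inv_eqI: "bij g \<Longrightarrow> g v = u \<Longrightarrow> inv' g u = v"
  by auto

lemma bij_eq_iff: "bij g \<Longrightarrow> g u = g v \<longleftrightarrow> u = v"
  by (simp add: bij_is_inj inj_eq)

lemma inv_image_mem: "bij (k :: 'b \<Rightarrow> 'b) \<Longrightarrow> k ` X = X \<Longrightarrow> u \<in> X \<Longrightarrow> inv' k u \<in> X"
  by (metis bij_inv_apply(1) imageE)

text \<open>\<open>K\<close> induces at least the alternating group on \<open>X\<close>. Nothing is
  asked of its elements outside \<open>X\<close>: whatever they must fix there is built into
  \<open>K\<close>.\<close>

definition rich :: "('b \<Rightarrow> 'b) set \<Rightarrow> 'b set \<Rightarrow> bool" where
  "rich K X \<longleftrightarrow> (\<forall>\<pi>. \<pi> permutes X \<and> evenperm \<pi> \<longrightarrow> (\<exists>h\<in>K. \<forall>u\<in>X. h u = \<pi> u))"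

lemma richD:
  assumes "rich K X" "\<pi> permutes X" "evenperm \<pi>"
  obtains h where "h \<in> K" "\<And>u. u \<in> X \<Longrightarrow> h u = \<pi> u"
  using assms unfolding rich_def by blast

lemma rich_mono: "rich K X \<Longrightarrow> K \<subseteq> L \<Longrightarrow> rich L X"
  unfolding rich_def by blast

section \<open>Commutators and 3-cycles\<close>

abbreviation cmt :: "('b \<Rightarrow> 'b) \<Rightarrow> ('b \<Rightarrow> 'b) \<Rightarrow> 'b \<Rightarrow> 'b" where
  "cmt g h \<equiv> g \<circ> h \<circ> inv' g \<circ> inv' h"

lemma perm_group_cmt:
  assumes "perm_group K" "g \<in> K" "h \<in> K"
  shows "cmt g h \<in> K"
  using assms by (intro perm_groupD(3,4)) auto

lemma cmt_normal:
  assumes "perm_group K" "h \<in> K" "g \<circ> h \<circ> inv' g \<in> K"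
  shows "cmt g h \<in> K"
  using perm_groupD(4)[OF assms(1,3) perm_groupD(3)[OF assms(1,2)]] by (simp add: o_assoc)

lemma cmt_moves:
  assumes "bij g" "bij h" "g (h z) \<noteq> h (g z)"
  shows "cmt g h (h (g z)) \<noteq> h (g z)"
  using assms by simp

text \<open>On a set that \<open>g\<close> fixes pointwise and \<open>h\<close> preserves,
  \<open>g\<close> drops out and \<open>h\<close> cancels against its inverse. Together with the
  mirror image \<open>cmt_fix'\<close>, this makes the fixing properties of both factors accumulate
  in a commutator.\<close>

lemma cmt_fix:
  assumes "bij g" "bij h" "h ` X = X" "\<And>u. u \<in> X \<Longrightarrow> g u = u" "u \<in> X"
  shows "cmt g h u = u"
proof -
  have 1: "inv' h u \<in> X"
    using assms(2,3,5) by (rule inv_image_mem)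
  hence "inv' g (inv' h u) = inv' h u"
    using assms(1,4) by (intro bij_inv_eqI) auto
  thus ?thesis using assms by simp
qed

lemma cmt_fix':
  assumes "bij g" "bij h" "g ` X = X" "\<And>u. u \<in> X \<Longrightarrow> h u = u" "u \<in> X"
  shows "cmt g h u = u"
proof -
  have "inv' h u = u"
    using assms(2,4,5) by (intro bij_inv_eqI) auto
  moreover have "inv' g u \<in> X"
    using assms(1,3,5) by (rule inv_image_mem)
  hence "h (inv' g u) = inv' g u"
    using assms(4) by blast
  ultimately show ?thesis using assms(1) by simp
qed

definition cyc3 :: "'b \<Rightarrow> 'b \<Rightarrow> 'b \<Rightarrow> 'b \<Rightarrow> 'b" where
  "cyc3 a b c = transpose a b \<circ> transpose b c"

lemma cyc3_apply:
  assumes "a \<noteq> b" "b \<noteq> c" "a \<noteq> c"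
  shows "cyc3 a b c u = (if u = a then b else if u = b then c else if u = c then a else u)"
  using assms by (auto simp: cyc3_def transpose_def)

lemma cyc3_permutes: "a \<in> X \<Longrightarrow> b \<in> X \<Longrightarrow> c \<in> X \<Longrightarrow> cyc3 a b c permutes X"
  unfolding cyc3_def by (intro permutes_compose permutes_swap_id)

lemma evenperm_cyc3:
  assumes "a \<noteq> b" "b \<noteq> c" shows "evenperm (cyc3 a b c)"
  using assms unfolding cyc3_def
  by (subst evenperm_comp) (auto simp: evenperm_swap permutation_swap_id)

lemma inv_cyc3:
  assumes "a \<noteq> b" "b \<noteq> c" "a \<noteq> c"
  shows "inv' (cyc3 a b c) = cyc3 c b a"
  using assms by (intro inv_equality) (auto simp: cyc3_apply)

lemma cyc3_conj:
  assumes "bij n" "a \<noteq> b" "b \<noteq> c" "a \<noteq> c"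
  shows "n \<circ> cyc3 a b c \<circ> inv' n = cyc3 (n a) (n b) (n c)"
proof -
  have i: "n u = n v \<longleftrightarrow> u = v" for u v
    using assms(1) by (rule bij_eq_iff)
  have c: "(n \<circ> cyc3 a b c) u = (cyc3 (n a) (n b) (n c) \<circ> n) u" for u
    using assms(2-) by (simp add: cyc3_apply i)
  hence "(n \<circ> cyc3 a b c \<circ> inv' n) u = cyc3 (n a) (n b) (n c) u" for u
  proof -
    have "(n \<circ> cyc3 a b c) (inv' n u) = (cyc3 (n a) (n b) (n c) \<circ> n) (inv' n u)" by (rule c)
    thus ?thesis using assms(1) by simp
  qed
  thus ?thesis by blast
qed

text \<open>The group contains, for every transposition \<open>(a b)\<close>, the product \<open>(p q) (a b)\<close>.\<close>

lemma even_permutes_generated: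
  assumes "perm_group G" "finite X" "p \<in> X" "q \<in> X" "p \<noteq> q"
    and cyc: "\<And>d. d \<in> X - {p, q} \<Longrightarrow> cyc3 p q d \<in> G"
    and "\<pi> permutes X" "evenperm \<pi>"
  shows "\<pi> \<in> G"
proof -
  define G0 where "G0 = {g \<in> G. g permutes X \<and> evenperm g}"
  define w where "w = transpose p q"
  have perm: "permutation g" if "g permutes X" for g
    using that assms(2) permutation_permutes by blast
  have G0: "perm_group G0"
  proof (rule perm_groupI)
    show "id \<in> G0" using perm_groupD(1)[OF assms(1)] by (simp add: G0_def permutes_id)
    show "bij g" if "g \<in> G0" for g
      using that by (auto simp: G0_def permutes_bij)
    show "inv' g \<in> G0" if "g \<in> G0" for g
      using that perm perm_groupD(3)[OF assms(1)] by (auto simp: G0_def permutes_inv evenperm_inv)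
    show "g \<circ> h \<in> G0" if "g \<in> G0" "h \<in> G0" for g h
      using that perm perm_groupD(4)[OF assms(1)] by (auto simp: G0_def permutes_compose evenperm_comp)
  qed
  have ww: "w \<circ> w = id" by (simp add: w_def)
  have invt: "inv' (w \<circ> transpose a b) = transpose a b \<circ> w" for a b
    by (rule inv_unique_comp) (simp_all add: w_def fun_eq_iff)
  have c0: "cyc3 p q d \<in> G0" if "d \<in> X - {p, q}" for d
    using that cyc[OF that] assms(3-5) by (auto simp: G0_def cyc3_permutes intro!: evenperm_cyc3)
  have wp: "w \<circ> transpose p d \<in> G0" if "d \<in> X - {p, q}" for d
  proof -
    have "inv' (cyc3 p q d) \<in> G0" using perm_groupD(3)[OF G0 c0[OF that]] .
    moreover have "inv' (cyc3 p q d) = w \<circ> transpose p d"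
      using that assms(5) by (subst inv_cyc3) (auto simp: w_def fun_eq_iff cyc3_apply transpose_def)
    ultimately show ?thesis by simp
  qed
  have wt: "w \<circ> transpose a b \<in> G0" if "a \<in> X" "b \<in> X" "a \<noteq> b" for a b
  proof -
    have wq: "w \<circ> transpose q d \<in> G0" if "d \<in> X - {p, q}" for d
      using c0[OF that] by (simp add: w_def cyc3_def)
    have wo: "w \<circ> transpose a b \<in> G0" if "a \<in> X - {p, q}" "b \<in> X - {p, q}" "a \<noteq> b" for a b
    proof -
      \<comment> \<open>\<open>(p a)(p b)(p a) = (a b)\<close>; the inverse in the middle brings two
        factors \<open>w\<close> together, which cancel.\<close>
      have "(w \<circ> transpose p a) \<circ> (inv' (w \<circ> transpose p b) \<circ> (w \<circ> transpose p a)) \<in> G0"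
        by (rule perm_groupD(4)[OF G0 wp perm_groupD(4)[OF G0 perm_groupD(3)[OF G0 wp] wp]])
          (use that in auto)
      moreover have "(w \<circ> transpose p a) \<circ> (inv' (w \<circ> transpose p b) \<circ> (w \<circ> transpose p a)) = w \<circ> transpose a b"
        unfolding invt using that by (auto simp: fun_eq_iff w_def transpose_def)
      ultimately show ?thesis by simp
    qed
    have id0: "w \<circ> transpose p q \<in> G0" using perm_groupD(1)[OF G0] by (simp add: w_def)
    consider "a = p" "b = q" | "a = q" "b = p" | "a = p" "b \<noteq> q" | "b = p" "a \<noteq> q"
      | "a = q" "b \<noteq> p" | "b = q" "a \<noteq> p" | "a \<in> X - {p,q}" "b \<in> X - {p,q}"
      using \<open>a \<in> X\<close> \<open>b \<in> X\<close> by blast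
    thus ?thesis
    proof cases
      case 1 thus ?thesis using id0 by simp
    next
      case 2 thus ?thesis using id0 by (simp add: transpose_commute)
    next
      case 3 thus ?thesis using wp that by auto
    next
      case 4 thus ?thesis using wp[of a] that by (auto simp: transpose_commute)
    next
      case 5 thus ?thesis using wq that by auto
    next
      case 6 thus ?thesis using wq[of a] that by (auto simp: transpose_commute)
    next
      case 7 thus ?thesis using wo that by blast
    qed
  qed
  \<comment> \<open>Parity alternates while a permutation is built from transpositions, so the
    induction keeps membership only up to a factor \<open>w\<close>; for even \<open>\<pi>\<close>
    the second alternative is excluded afterwards.\<close>
  have "\<pi> \<in> G0 \<or> w \<circ> \<pi> \<in> G0"
    using assms(7,2)
  proof (induction rule: permutes_induct)
    case id
    show ?case using perm_groupD(1)[OF G0] by blast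
  next
    case (swap a b p')
    have t: "w \<circ> transpose a b \<in> G0" using wt swap by blast
    from \<open>p' \<in> G0 \<or> w \<circ> p' \<in> G0\<close> show ?case
    proof
      assume "p' \<in> G0"
      hence "(w \<circ> transpose a b) \<circ> p' \<in> G0" using perm_groupD(4)[OF G0 t] by blast
      thus ?thesis by (metis o_assoc)
    next
      assume a: "w \<circ> p' \<in> G0"
      have "inv' (w \<circ> transpose a b) \<circ> (w \<circ> p') \<in> G0"
        using perm_groupD(4)[OF G0 perm_groupD(3)[OF G0 t] a] .
      moreover have "inv' (w \<circ> transpose a b) \<circ> (w \<circ> p') = transpose a b \<circ> p'"
        unfolding invt by (simp add: w_def fun_eq_iff)
      ultimately show ?thesis by metis
    qed
  qed
  moreover have "w \<circ> \<pi> \<notin> G0"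
  proof
    assume "w \<circ> \<pi> \<in> G0"
    hence "evenperm (w \<circ> \<pi>)" by (simp add: G0_def)
    thus False using assms(5,8) perm[OF assms(7)]
      by (simp add: w_def evenperm_comp permutation_swap_id evenperm_swap)
  qed
  ultimately show ?thesis unfolding G0_def by blast
qed

section \<open>Normal subgroups of alternating groups\<close>

lemma obtain_not_in:
  assumes "length xs < card X"
  obtains e where "e \<in> X" "e \<notin> set xs"
proof -
  have "\<not> X \<subseteq> set xs"
    using assms card_mono[of "set xs" X] card_length[of xs] by auto
  thus thesis using that by blast
qed

text \<open>Three transpositions bring the points into place one after the other. If the result is
  odd, a transposition of two points outside the target triple repairs it; this takes five
  points.\<close>

lemma even_permutation_moving_triple:
  assumes "finite X" "card X \<ge> 5"
    and "a \<in> X" "b \<in> X" "c \<in> X" "a \<noteq> b" "b \<noteq> c" "a \<noteq> c"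
    and "x \<in> X" "y \<in> X" "z \<in> X" "x \<noteq> y" "y \<noteq> z" "x \<noteq> z"
  obtains \<pi> where "\<pi> permutes X" "evenperm \<pi>" "\<pi> a = x" "\<pi> b = y" "\<pi> c = z"
proof -
  define s1 where "s1 = transpose a x"
  define s2 where "s2 = transpose (s1 b) y"
  define s3 where "s3 = transpose (s2 (s1 c)) z"
  have m1: "s1 u \<in> X" if "u \<in> X" for u using that assms by (auto simp: s1_def transpose_def)
  have m2: "s2 u \<in> X" if "u \<in> X" for u using that assms m1 by (auto simp: s2_def transpose_def)
  define \<sigma> where "\<sigma> = s3 \<circ> (s2 \<circ> s1)"
  have p: "\<sigma> permutes X" unfolding \<sigma>_def s1_def s2_def s3_def
    using assms m1 m2 by (intro permutes_compose permutes_swap_id) (auto simp: s1_def s2_def)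
  have b1: "s1 b \<noteq> x" "s1 c \<noteq> x" "s1 b \<noteq> s1 c" "s1 a = x"
    using assms by (auto simp: s1_def transpose_def)
  have c2: "s2 (s1 c) \<noteq> x" "s2 (s1 c) \<noteq> y" "s2 x = x" "s2 (s1 b) = y"
    using assms b1 by (auto simp: s2_def transpose_def)
  have v: "\<sigma> a = x" "\<sigma> b = y" "\<sigma> c = z"
    using assms b1 c2 by (auto simp: \<sigma>_def s3_def transpose_def)
  obtain e where e: "e \<in> X" "e \<notin> {x, y, z}"
    using obtain_not_in[of "[x, y, z]" X] assms by auto
  obtain f where f: "f \<in> X" "f \<notin> {x, y, z, e}"
    using obtain_not_in[of "[x, y, z, e]" X] assms by auto
  show thesis
  proof (cases "evenperm \<sigma>")
    case True
    show ?thesis using that[OF p True v] .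
  next
    case False
    have "permutation \<sigma>" using p assms(1) permutation_permutes by blast
    hence "evenperm (transpose e f \<circ> \<sigma>)"
      using False e f by (auto simp: evenperm_comp permutation_swap_id evenperm_swap)
    moreover have "transpose e f \<circ> \<sigma> permutes X"
      using p e f by (intro permutes_compose permutes_swap_id) auto
    ultimately show ?thesis
      using e f v by (intro that[of "transpose e f \<circ> \<sigma>"]) auto
  qed
qed

text \<open>Starting from \<open>n a = b \<noteq> a\<close>, the commutator of \<open>n\<close> with a 3-cycle \<open>(a b c)\<close> moves
  at most five points; it is a 3-cycle, a double transposition or a 5-cycle, and in the last two
  cases one more commutator is a 3-cycle.\<close>

lemma normalized_group_has_cyc3:
  assumes N: "perm_group N" and fin: "finite X" and card: "card X \<ge> 5"
    and perm: "\<And>n. n \<in> N \<Longrightarrow> n permutes X"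
    and normal: "\<And>n \<pi>. n \<in> N \<Longrightarrow> \<pi> permutes X \<Longrightarrow> evenperm \<pi> \<Longrightarrow> \<pi> \<circ> n \<circ> inv' \<pi> \<in> N"
    and n: "n \<in> N" "n a \<noteq> a"
  shows "\<exists>x\<in>X. \<exists>y\<in>X. \<exists>z\<in>X. x \<noteq> y \<and> y \<noteq> z \<and> x \<noteq> z \<and> cyc3 x y z \<in> N"
proof -
  \<comment> \<open>The commutator of \<open>n\<close> with a 3-cycle is \<open>n\<close> times a
    conjugate of its inverse, hence in \<open>N\<close>; bracketed the other way it is a product of
    two 3-cycles, which makes it computable.\<close>
  have comm: "cyc3 (n x) (n y) (n z) \<circ> cyc3 z y x \<in> N"
    if "n \<in> N" "x \<in> X" "y \<in> X" "z \<in> X" "x \<noteq> y" "y \<noteq> z" "x \<noteq> z" for n x y z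
  proof -
    let ?t = "cyc3 x y z"
    have "?t \<circ> inv' n \<circ> inv' ?t \<in> N"
      using that N by (intro normal cyc3_permutes evenperm_cyc3 perm_groupD(3))
    hence "n \<circ> (?t \<circ> inv' n \<circ> inv' ?t) \<in> N" using perm_groupD(4)[OF N that(1)] by blast
    moreover have "n \<circ> (?t \<circ> inv' n \<circ> inv' ?t) = (n \<circ> ?t \<circ> inv' n) \<circ> inv' ?t" by (simp add: o_assoc)
    ultimately show ?thesis
      using cyc3_conj[OF perm_groupD(2)[OF N that(1)] that(5-7)] inv_cyc3[OF that(5-7)] by simp
  qed
  have goal3: ?thesis if "g \<in> N" "g = cyc3 x y z" "{x, y, z} \<subseteq> X" "x \<noteq> y" "y \<noteq> z" "x \<noteq> z" for g x y z
    using that by blast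
  have goal22: ?thesis
    if "g \<in> N" "g = transpose x y \<circ> transpose z u" "{x, y, z, u} \<subseteq> X" "distinct [x, y, z, u]" for g x y z u
  proof -
    obtain e where e: "e \<in> X" "e \<notin> {x, y, z, u}"
      using obtain_not_in[of "[x, y, z, u]" X] card by auto
    have "cyc3 (g x) (g y) (g e) \<circ> cyc3 e y x \<in> N"
      by (rule comm[OF that(1)]) (use that(3,4) e in auto)
    moreover have "cyc3 (g x) (g y) (g e) \<circ> cyc3 e y x = cyc3 x y e"
      using that e by (auto simp: fun_eq_iff cyc3_apply)
    ultimately show ?thesis using goal3[of _ x y e] that e by auto
  qed
  have goal5: ?thesis
    if "g \<in> N" "g c1 = c2" "g c2 = c3" "g c3 = c4" "g c4 = c5" "g c5 = c1"
      "{c1, c2, c3, c4, c5} \<subseteq> X" "distinct [c1, c2, c3, c4, c5]" for g c1 c2 c3 c4 c5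
  proof -
    have "cyc3 (g c1) (g c2) (g c3) \<circ> cyc3 c3 c2 c1 \<in> N"
      using that by (intro comm) auto
    moreover have "cyc3 (g c1) (g c2) (g c3) \<circ> cyc3 c3 c2 c1 = cyc3 c1 c4 c2"
      using that by (auto simp: fun_eq_iff cyc3_apply)
    ultimately show ?thesis using goal3[of _ c1 c4 c2] that by auto
  qed
  define b where "b = n a"
  define e where "e = n b"
  have px: "n u \<in> X \<longleftrightarrow> u \<in> X" for u using perm[OF n(1)] permutes_in_image by metis
  have inj: "n u = n v \<longleftrightarrow> u = v" for u v using perm[OF n(1)] by (metis permutes_inverses(2))
  have aX: "a \<in> X" using perm[OF n(1)] n(2) permutes_not_in by metis
  hence bX: "b \<in> X" "e \<in> X" by (auto simp: b_def e_def px)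
  \<comment> \<open>With \<open>c\<close> also different from \<open>n b\<close>, the only possible
    coincidences are \<open>e = a\<close>, \<open>f = a\<close> and \<open>f = c\<close>, and
    injectivity excludes \<open>e = f = a\<close>.\<close>
  obtain c where c: "c \<in> X" "c \<notin> {a, b, e}"
    using obtain_not_in[of "[a, b, e]" X] card by auto
  define f where "f = n c"
  have fX: "f \<in> X" using c by (auto simp: f_def px)
  have ne: "a \<noteq> b" "b \<noteq> c" "a \<noteq> c" "e \<noteq> c" "b \<noteq> e" "b \<noteq> f" "e \<noteq> f"
    using n(2) c inj unfolding b_def e_def f_def by (auto simp: inj)
  have k: "cyc3 b e f \<circ> cyc3 c b a \<in> N" (is "?k \<in> N")
    using comm[OF n(1) aX bX(1) c(1)] ne by (simp add: b_def[symmetric] e_def[symmetric] f_def[symmetric])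
  consider "e = a" "f = c" | "e = a" "f \<noteq> c" | "e \<noteq> a" "f = a" | "e \<noteq> a" "f = c"
    | "e \<noteq> a" "f \<noteq> a" "f \<noteq> c" by blast
  thus ?thesis
  proof cases
    case 1
    have "?k = cyc3 a b c" using 1 ne by (auto simp: fun_eq_iff cyc3_apply)
    thus ?thesis using goal3[OF k] aX bX c ne by auto
  next
    case 2
    have "?k = transpose a c \<circ> transpose b f" using 2 ne by (auto simp: fun_eq_iff cyc3_apply transpose_def)
    thus ?thesis using goal22[OF k] aX bX c fX ne 2 by auto
  next
    case 3
    have "?k = cyc3 c e a" using 3 ne by (auto simp: fun_eq_iff cyc3_apply)
    thus ?thesis using goal3[OF k, of c e a] aX bX c ne 3 by auto
  next
    case 4
    have "?k = transpose c e \<circ> transpose a b" using 4 ne by (auto simp: fun_eq_iff cyc3_apply transpose_def)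
    thus ?thesis using goal22[OF k, of c e a b] aX bX c fX ne 4 by auto
  next
    case 5
    have "?k c = e" "?k e = f" "?k f = b" "?k b = a" "?k a = c"
      using 5 ne by (auto simp: cyc3_apply)
    thus ?thesis using goal5[OF k, of c e f b a] aX bX c fX ne 5 by auto
  qed
qed

text \<open>One 3-cycle suffices: even permutations carry its triple to any other, and the 3-cycles
  through a fixed pair generate all even permutations.\<close>

lemma normalized_group_contains_even:
  assumes N: "perm_group N" and fin: "finite X" and card: "card X \<ge> 5"
    and perm: "\<And>n. n \<in> N \<Longrightarrow> n permutes X"
    and normal: "\<And>n \<pi>. n \<in> N \<Longrightarrow> \<pi> permutes X \<Longrightarrow> evenperm \<pi> \<Longrightarrow> \<pi> \<circ> n \<circ> inv' \<pi> \<in> N"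
    and n: "n \<in> N" "n a \<noteq> a"
    and \<pi>: "\<pi> permutes X" "evenperm \<pi>"
  shows "\<pi> \<in> N"
proof -
  obtain a b c where abc: "a \<in> X" "b \<in> X" "c \<in> X" "a \<noteq> b" "b \<noteq> c" "a \<noteq> c" "cyc3 a b c \<in> N"
    using normalized_group_has_cyc3[OF N fin card perm normal n] by blast
  have all: "cyc3 x y z \<in> N"
    if xyz: "x \<in> X" "y \<in> X" "z \<in> X" "x \<noteq> y" "y \<noteq> z" "x \<noteq> z" for x y z
  proof -
    obtain \<pi> where "\<pi> permutes X" "evenperm \<pi>" "\<pi> a = x" "\<pi> b = y" "\<pi> c = z"
      using even_permutation_moving_triple[OF fin card abc(1-6) xyz] .
    thus ?thesis
      using normal[OF abc(7), of \<pi>] cyc3_conj[of \<pi> a b c] abc permutes_bij by metis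
  qed
  show ?thesis
    by (rule even_permutes_generated[OF N fin abc(1,2,4) _ \<pi>]) (use all abc in auto)
qed

definition induced :: "('b \<Rightarrow> 'b) set \<Rightarrow> 'b set \<Rightarrow> ('b \<Rightarrow> 'b) set" where
  "induced K X = {n. n permutes X \<and> (\<exists>k\<in>K. \<forall>u\<in>X. k u = n u)}"

lemma perm_group_induced:
  assumes K: "perm_group K" and KX: "\<And>k. k \<in> K \<Longrightarrow> k ` X = X"
  shows "perm_group (induced K X)"
proof (rule perm_groupI)
  show "id \<in> induced K X" using perm_groupD(1)[OF K] by (auto simp: induced_def permutes_id intro!: bexI[of _ id])
  show "bij g" if "g \<in> induced K X" for g using that by (auto simp: induced_def permutes_bij)
  show "inv' g \<in> induced K X" if "g \<in> induced K X" for g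
  proof -
    obtain k where k: "k \<in> K" "\<forall>u\<in>X. k u = g u" and g: "g permutes X"
      using \<open>g \<in> induced K X\<close> unfolding induced_def by blast
    have "inv' k u = inv' g u" if "u \<in> X" for u
    proof -
      have "inv' g u \<in> X" using g that by (metis permutes_inv permutes_in_image)
      hence "k (inv' g u) = u" using k g permutes_inverses by metis
      thus ?thesis by (rule bij_inv_eqI[OF perm_groupD(2)[OF K k(1)]])
    qed
    thus ?thesis using perm_groupD(3)[OF K k(1)] g permutes_inv by (auto simp: induced_def)
  qed
  show "g \<circ> h \<in> induced K X" if "g \<in> induced K X" "h \<in> induced K X" for g h
  proof -
    obtain k l where k: "k \<in> K" "\<forall>u\<in>X. k u = g u" and l: "l \<in> K" "\<forall>u\<in>X. l u = h u"
      and g: "g permutes X" "h permutes X"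
      using \<open>g \<in> induced K X\<close> \<open>h \<in> induced K X\<close> unfolding induced_def by blast
    hence "\<forall>u\<in>X. (k \<circ> l) u = (g \<circ> h) u" using permutes_in_image by (metis comp_apply)
    moreover have "g \<circ> h permutes X" using g permutes_compose by blast
    ultimately show ?thesis using perm_groupD(4)[OF K k(1) l(1)] unfolding induced_def by blast
  qed
qed

text \<open>The form in which simplicity of the alternating group on at least five points is used.\<close>

lemma rich_if_normalized:
  assumes K: "perm_group K" and fin: "finite X" and card: "card X \<ge> 5"
    and KX: "\<And>k. k \<in> K \<Longrightarrow> k ` X = X"
    and L: "\<And>l. l \<in> L \<Longrightarrow> bij l \<and> l ` X = X" and rich: "rich L X"
    and normal: "\<And>l k. l \<in> L \<Longrightarrow> k \<in> K \<Longrightarrow> l \<circ> k \<circ> inv' l \<in> K"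
    and k0: "k0 \<in> K" "u0 \<in> X" "k0 u0 \<noteq> u0"
  shows "rich K X"
proof -
  define N where "N = induced K X"
  have N_def: "N = {n. n permutes X \<and> (\<exists>k\<in>K. \<forall>u\<in>X. k u = n u)}" by (simp add: N_def induced_def)
  have N: "perm_group N" using perm_group_induced[OF K KX] by (simp add: N_def induced_def)
  have normalN: "\<pi> \<circ> n \<circ> inv' \<pi> \<in> N" if n: "n \<in> N" and p: "\<pi> permutes X" "evenperm \<pi>" for n \<pi>
  proof -
    obtain k where k: "k \<in> K" "\<forall>u\<in>X. k u = n u" and np: "n permutes X"
      using n by (auto simp: N_def)
    obtain l where l: "l \<in> L" "\<And>u. u \<in> X \<Longrightarrow> l u = \<pi> u" using richD[OF rich p] by blast
    have "(l \<circ> k \<circ> inv' l) u = (\<pi> \<circ> n \<circ> inv' \<pi>) u" if "u \<in> X" for u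
    proof -
      have 1: "inv' \<pi> u \<in> X" using p that by (metis permutes_inv permutes_in_image)
      hence "l (inv' \<pi> u) = u" using l(2)[OF 1] permutes_inverses(1)[OF p(1)] by simp
      hence "inv' l u = inv' \<pi> u" by (rule bij_inv_eqI[OF conjunct1[OF L[OF l(1)]]])
      moreover have "n (inv' \<pi> u) \<in> X" using 1 np by (metis permutes_in_image)
      ultimately show ?thesis using k l 1 by simp
    qed
    moreover have "\<pi> \<circ> n \<circ> inv' \<pi> permutes X"
      using p np by (intro permutes_compose permutes_inv)
    ultimately show ?thesis using normal[OF l(1) k(1)] unfolding N_def by blast
  qed
  define n0 where "n0 = restrict_id k0 X"
  have "n0 permutes X"
    unfolding n0_def using KX[OF k0(1)] perm_groupD(2)[OF K k0(1)]
    by (intro permutes_restrict_id bij_betw_imageI) (auto intro: inj_on_subset simp: bij_def)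
  hence n0: "n0 \<in> N" "n0 u0 \<noteq> u0" using k0 by (auto simp: N_def n0_def)
  have "\<pi> \<in> N" if "\<pi> permutes X" "evenperm \<pi>" for \<pi>
    by (rule normalized_group_contains_even[OF N fin card _ normalN n0 that]) (auto simp: N_def)
  thus ?thesis unfolding rich_def N_def by blast
qed

text \<open>A 3-cycle through \<open>a\<close> that avoids \<open>k a\<close> moves one of the two
  points and fixes the other.\<close>

lemma noncommuting_even:
  assumes "finite X" "card X \<ge> 4" "a \<in> X" "k a \<noteq> a" "inj k"
  obtains \<beta> where "\<beta> permutes X" "evenperm \<beta>" "k (\<beta> a) \<noteq> \<beta> (k a)"
proof -
  obtain c where c: "c \<in> X" "c \<notin> {a, k a}"
    using obtain_not_in[of "[a, k a]" X] assms by auto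
  obtain e where e: "e \<in> X" "e \<notin> {a, k a, c}"
    using obtain_not_in[of "[a, k a, c]" X] assms by auto
  have "cyc3 a c e a = c" "cyc3 a c e (k a) = k a" using c e assms by (auto simp: cyc3_apply)
  moreover have "k c \<noteq> k a" using assms(5) c by (auto simp: inj_eq)
  ultimately show thesis
    using c e assms by (intro that[of "cyc3 a c e"]) (auto simp: cyc3_permutes evenperm_cyc3)
qed

lemma rich_noncommuting:
  assumes "rich K X" "finite X" "card X \<ge> 4" "a \<in> X" "k a \<noteq> a" "inj k" "k a \<in> X"
  obtains h where "h \<in> K" "k (h a) \<noteq> h (k a)"
proof -
  obtain \<beta> where \<beta>: "\<beta> permutes X" "evenperm \<beta>" "k (\<beta> a) \<noteq> \<beta> (k a)"
    using noncommuting_even[OF assms(2-6)] .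
  obtain h where h: "h \<in> K" "\<And>u. u \<in> X \<Longrightarrow> h u = \<beta> u" using richD[OF assms(1) \<beta>(1,2)] by blast
  thus thesis using that[of h] \<beta>(3) assms(4,7) by metis
qed

lemma rich_nontrivial:
  assumes "rich K X" "finite X" "card X \<ge> 3"
  obtains h u where "h \<in> K" "u \<in> X" "h u \<noteq> u" "h u \<in> X"
proof -
  obtain a where a: "a \<in> X" using obtain_not_in[of "[]" X] assms by auto
  obtain b where b: "b \<in> X" "b \<notin> {a}" using obtain_not_in[of "[a]" X] assms by auto
  obtain c where c: "c \<in> X" "c \<notin> {a, b}" using obtain_not_in[of "[a, b]" X] assms by auto
  obtain h where "h \<in> K" "\<And>u. u \<in> X \<Longrightarrow> h u = cyc3 a b c u"
    using richD[OF assms(1), of "cyc3 a b c"] a b c cyc3_permutes evenperm_cyc3 by (metis insertCI)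
  thus thesis using that[of h a] a b c by (auto simp: cyc3_apply)
qed

text \<open>Commutators inherit the fixing properties of both groups; this supplies one that is
  still visible on \<open>X\<close>.\<close>

lemma rich_noncommuting2:
  assumes "rich K X" "rich L X" "finite X" "card X \<ge> 4" "\<And>k. k \<in> K \<Longrightarrow> bij k"
    "\<And>l. l \<in> L \<Longrightarrow> bij l" "\<And>k. k \<in> K \<Longrightarrow> k ` X = X" "\<And>l. l \<in> L \<Longrightarrow> l ` X = X"
  obtains k l u where "k \<in> K" "l \<in> L" "u \<in> X" "cmt k l u \<noteq> u"
proof -
  obtain k a where k: "k \<in> K" "a \<in> X" "k a \<noteq> a" "k a \<in> X"
    using rich_nontrivial[OF assms(1,3)] assms(4) by auto
  obtain l where l: "l \<in> L" "k (l a) \<noteq> l (k a)"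
    using rich_noncommuting[OF assms(2-4) k(2,3) bij_is_inj[OF assms(5)[OF k(1)]] k(4)] by blast
  show thesis
    using that[OF k(1) l(1) _ cmt_moves[OF assms(5)[OF k(1)] assms(6)[OF l(1)] l(2)]]
      assms(8)[OF l(1)] k(4) by blast
qed

text \<open>Elements that act on one member of the family and fix the others are multiplied
  together; the induction runs over the set \<open>A\<close> of members already treated, with the
  remaining ones still fixed.\<close>

lemma rich_family:
  assumes K: "perm_group K" and fin: "finite I"
    and KX: "\<And>k i. k \<in> K \<Longrightarrow> i \<in> I \<Longrightarrow> k ` X i = X i"
    and single: "\<And>i \<pi>. i \<in> I \<Longrightarrow> \<pi> permutes X i \<Longrightarrow> evenperm \<pi> \<Longrightarrow>
       \<exists>k\<in>K. (\<forall>u\<in>X i. k u = \<pi> u) \<and> (\<forall>j\<in>I - {i}. \<forall>u\<in>X j. k u = u)"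
    and \<pi>: "\<And>i. i \<in> I \<Longrightarrow> \<pi> i permutes X i \<and> evenperm (\<pi> i)"
  shows "\<exists>k\<in>K. \<forall>i\<in>I. \<forall>u\<in>X i. k u = \<pi> i u"
proof -
  have "\<exists>k\<in>K. \<forall>i\<in>I. \<forall>u\<in>X i. k u = (if i \<in> A then \<pi> i u else u)" if "finite A" "A \<subseteq> I" for A
    using that
  proof (induction rule: finite_induct)
    case empty
    show ?case using perm_groupD(1)[OF K] by (auto intro!: bexI[of _ id])
  next
    case (insert a A)
    obtain k where k: "k \<in> K" "\<forall>i\<in>I. \<forall>u\<in>X i. k u = (if i \<in> A then \<pi> i u else u)"
      using insert by auto
    obtain l where l: "l \<in> K" "\<forall>u\<in>X a. l u = \<pi> a u" "\<forall>j\<in>I - {a}. \<forall>u\<in>X j. l u = u"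
      using single[of a "\<pi> a"] \<pi>[of a] insert.prems by auto
    have "(k \<circ> l) u = (if i \<in> insert a A then \<pi> i u else u)" if i: "i \<in> I" "u \<in> X i" for i u
    proof (cases "i = a")
      case True
      have "l u \<in> X a" using KX[OF l(1)] i True by blast
      thus ?thesis using k(2) l(2) i True insert.hyps by auto
    next
      case False
      thus ?thesis using k(2) l(3) i by auto
    qed
    thus ?case using perm_groupD(4)[OF K k(1) l(1)] by blast
  qed
  from this[OF fin subset_refl] show ?thesis by auto
qed

section \<open>Semiregular trees\<close>

locale bitree =
  fixes T :: "'a bigraph" and d0 d1 :: nat
  assumes tree: "semiregular_tree d0 d1 T" and d0_ge: "d0 \<ge> 6" and d1_ge: "d1 \<ge> 6"
begin

abbreviation V :: "'a set" where "V \<equiv> verts T"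

definition adj :: "'a \<Rightarrow> 'a \<Rightarrow> bool" where "adj u v \<longleftrightarrow> {u, v} \<in> edges T"

definition N :: "'a \<Rightarrow> 'a set" where "N v = {u. adj v u}"

definition ty :: "'a \<Rightarrow> bool" where "ty v \<longleftrightarrow> v \<in> part0 T"

abbreviation d :: "'a \<Rightarrow> 'a \<Rightarrow> nat" where "d \<equiv> graph_dist T"

definition S :: "'a \<Rightarrow> nat \<Rightarrow> 'a set" where "S x r = {v \<in> V. d x v = r}"

text \<open>The children of \<open>v\<close> when the tree is rooted at \<open>x\<close>; for
  \<open>v = x\<close> these are all neighbours.\<close>

definition C :: "'a \<Rightarrow> 'a \<Rightarrow> 'a set" where "C x v = {u \<in> N v. d x u = Suc (d x v)}"

text \<open>Walks of an exact length: unlike distances, their lengths add up and admit induction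
  step by step.\<close>

definition W :: "nat \<Rightarrow> 'a \<Rightarrow> 'a \<Rightarrow> bool" where
  "W n u v \<longleftrightarrow> (\<exists>p. walk T p \<and> hd p = u \<and> last p = v \<and> length p = Suc n)"

lemma adj_sym: "adj u v \<longleftrightarrow> adj v u"
  by (simp add: adj_def insert_commute)

lemma adj_cases: "adj u v \<Longrightarrow> u \<in> part0 T \<and> v \<in> part1 T \<or> u \<in> part1 T \<and> v \<in> part0 T"
  using tree unfolding adj_def semiregular_tree_def by (metis doubleton_eq_iff)

lemma parts_disjoint: "part0 T \<inter> part1 T = {}"
  using tree by (simp add: semiregular_tree_def)

lemma adj_V: "adj u v \<Longrightarrow> u \<in> V" "adj u v \<Longrightarrow> v \<in> V"
  using adj_cases by (auto simp: verts_def)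

lemma adj_ty: "adj u v \<Longrightarrow> ty u \<noteq> ty v"
  using adj_cases parts_disjoint by (auto simp: ty_def)

lemma adj_neq: "adj u v \<Longrightarrow> u \<noteq> v"
  using adj_ty by blast

lemma part1_iff: "v \<in> V \<Longrightarrow> v \<in> part1 T \<longleftrightarrow> \<not> ty v"
  using parts_disjoint by (auto simp: verts_def ty_def)

lemma edges_at_N: "bij_betw (\<lambda>u. {v, u}) (N v) (edges_at T v)"
proof (rule bij_betw_imageI)
  show "inj_on (\<lambda>u. {v, u}) (N v)"
    by (auto simp: inj_on_def doubleton_eq_iff)
  show "(\<lambda>u. {v, u}) ` N v = edges_at T v"
  proof (intro equalityI subsetI)
    fix e assume e: "e \<in> edges_at T v"
    moreover have "\<forall>e\<in>edges T. \<exists>x\<in>part0 T. \<exists>y\<in>part1 T. e = {x, y}"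
      using tree by (simp add: semiregular_tree_def)
    ultimately obtain x y where xy: "e = {x, y}"
      unfolding edges_at_def by blast
    have "x = v \<or> y = v" using e xy by (auto simp: edges_at_def)
    then obtain u where u: "e = {v, u}" using xy insert_commute by blast
    thus "e \<in> (\<lambda>u. {v, u}) ` N v"
      using e by (auto simp: N_def adj_def edges_at_def)
  qed (auto simp: N_def adj_def edges_at_def)
qed

lemma N_finite_card:
  assumes "v \<in> V"
  shows "finite (N v)" "card (N v) = (if ty v then d0 else d1)" "card (N v) \<ge> 6"
proof -
  have "finite (edges_at T v)" and c: "card (edges_at T v) = (if ty v then d0 else d1)"
    using tree assms part1_iff[OF assms] unfolding semiregular_tree_def ty_def by (auto simp: verts_def)
  thus "finite (N v)" using bij_betw_finite[OF edges_at_N] by blast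
  show n: "card (N v) = (if ty v then d0 else d1)"
    using c bij_betw_same_card[OF edges_at_N] by metis
  show "card (N v) \<ge> 6" using n d0_ge d1_ge by auto
qed

section \<open>Walks, distance and parity\<close>

lemma walk_Cons: "p \<noteq> [] \<Longrightarrow> walk T (u # p) \<longleftrightarrow> adj u (hd p) \<and> walk T p"
  using adj_V by (cases p) (auto simp: walk_def adj_def successively_Cons)

lemma W_0: "W 0 u v \<longleftrightarrow> u = v \<and> u \<in> V"
proof
  assume "W 0 u v"
  then obtain p where p: "walk T p" "hd p = u" "last p = v" "length p = Suc 0"
    unfolding W_def by blast
  then obtain a where "p = [a]" by (metis length_0_conv length_Suc_conv)
  thus "u = v \<and> u \<in> V" using p by (auto simp: walk_def)
next
  assume "u = v \<and> u \<in> V"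
  thus "W 0 u v" unfolding W_def by (intro exI[of _ "[u]"]) (auto simp: walk_def)
qed

lemma W_Suc: "W (Suc n) u v \<longleftrightarrow> (\<exists>w. adj u w \<and> W n w v)"
proof
  assume "W (Suc n) u v"
  then obtain p where p: "walk T p" "hd p = u" "last p = v" "length p = Suc (Suc n)"
    unfolding W_def by blast
  then obtain a q where pa: "p = a # q" "length q = Suc n" by (metis length_Suc_conv)
  hence q: "q \<noteq> []" by auto
  have "adj u (hd q)" "W n (hd q) v"
    using p pa q walk_Cons[OF q, of a] unfolding W_def by auto
  thus "\<exists>w. adj u w \<and> W n w v" by blast
next
  assume "\<exists>w. adj u w \<and> W n w v"
  then obtain w q where w: "adj u w" and q: "walk T q" "hd q = w" "last q = v" "length q = Suc n"
    unfolding W_def by blast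
  hence "q \<noteq> []" by auto
  thus "W (Suc n) u v"
    using w q walk_Cons[of q u] unfolding W_def by (intro exI[of _ "u # q"]) auto
qed

lemma W_trans: "W m u v \<Longrightarrow> W n v w \<Longrightarrow> W (m + n) u w"
  by (induction m arbitrary: u) (auto simp: W_0 W_Suc)

lemma W_sym: "W n u v \<Longrightarrow> W n v u"
proof (induction n arbitrary: u)
  case (Suc n)
  then obtain w where w: "adj u w" "W n w v" using W_Suc by blast
  have "W 1 w u" using w(1) adj_V adj_sym by (auto simp: W_0 W_Suc)
  thus ?case using W_trans[OF Suc.IH[OF w(2)]] by fastforce
qed (auto simp: W_0)

lemma W_parity: "W n u v \<Longrightarrow> even n \<longleftrightarrow> ty u = ty v"
proof (induction n arbitrary: u)
  case (Suc n)
  then obtain w where w: "adj u w" "W n w v" using W_Suc by blast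
  thus ?case using Suc.IH adj_ty by auto
qed (simp add: W_0)

lemma d_le: "W n u v \<Longrightarrow> d u v \<le> n"
  unfolding graph_dist_def W_def by (rule Least_le) blast

lemma W_d:
  assumes "u \<in> V" "v \<in> V" shows "W (d u v) u v"
proof -
  obtain p where p: "walk T p" "hd p = u" "last p = v"
    using tree assms unfolding semiregular_tree_def graph_connected_def by blast
  hence "length p = Suc (length p - 1)" by (cases p) (auto simp: walk_def)
  hence "\<exists>n. W n u v" using p unfolding W_def by blast
  thus ?thesis unfolding graph_dist_def W_def by (rule LeastI_ex)
qed

lemma d_parity: "u \<in> V \<Longrightarrow> v \<in> V \<Longrightarrow> even (d u v) \<longleftrightarrow> ty u = ty v"
  using W_d W_parity by blast

lemma d_zero_iff: "u \<in> V \<Longrightarrow> v \<in> V \<Longrightarrow> d u v = 0 \<longleftrightarrow> u = v"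
  using W_d[of u v] d_le[of 0 u v] by (auto simp: W_0)

lemma d_self [simp]: "u \<in> V \<Longrightarrow> d u u = 0"
  using d_zero_iff by blast

lemma d_sym: "u \<in> V \<Longrightarrow> v \<in> V \<Longrightarrow> d u v = d v u"
  using d_le[OF W_sym[OF W_d]] by (metis antisym)

lemma d_triangle: "u \<in> V \<Longrightarrow> v \<in> V \<Longrightarrow> w \<in> V \<Longrightarrow> d u w \<le> d u v + d v w"
  using d_le[OF W_trans[OF W_d W_d]] by blast

lemma d_adj:
  assumes "adj u v" shows "d u v = 1"
proof -
  have "W 1 u v" using assms adj_V by (auto simp: W_Suc W_0)
  moreover have "d u v \<noteq> 0" using assms d_zero_iff adj_V adj_neq by blast
  ultimately show ?thesis using d_le by fastforce
qed

lemma d_1: "u \<in> V \<Longrightarrow> v \<in> V \<Longrightarrow> d u v = 1 \<Longrightarrow> adj u v"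
  using W_d[of u v] by (auto simp: W_Suc W_0)

text \<open>The triangle inequality allows a difference of at most one, and bipartiteness excludes
  equality.\<close>

lemma adj_dist:
  assumes "x \<in> V" "adj u v"
  shows "d x u = Suc (d x v) \<or> d x v = Suc (d x u)"
proof -
  have V: "u \<in> V" "v \<in> V" using assms adj_V by auto
  have "d x u \<le> Suc (d x v)" "d x v \<le> Suc (d x u)"
    using d_triangle[OF assms(1) V(2) V(1)] d_triangle[OF assms(1) V] d_adj[OF assms(2)]
      d_sym[OF V] by auto
  moreover have "d x u \<noteq> d x v"
    using d_parity[OF assms(1) V(1)] d_parity[OF assms(1) V(2)] adj_ty[OF assms(2)] by auto
  ultimately show ?thesis by linarith
qed

lemma adj_dist': "x \<in> V \<Longrightarrow> adj u v \<Longrightarrow> d u x = Suc (d v x) \<or> d v x = Suc (d u x)"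
  using adj_dist[of x u v] d_sym[of x u] d_sym[of x v] adj_V[of u v] by auto

section \<open>Parents, children and spheres around a root\<close>

lemma ex_parent:
  assumes "x \<in> V" "v \<in> V" "d x v = Suc k"
  obtains p where "adj v p" "d x p = k"
proof -
  have "W (Suc k) v x" using W_d[OF assms(2,1)] assms d_sym by metis
  then obtain p where p: "adj v p" "W k p x" using W_Suc by blast
  have "d x p \<le> k" using d_le[OF p(2)] d_sym assms(1) adj_V(2)[OF p(1)] by metis
  thus thesis using that[OF p(1)] adj_dist[OF assms(1) p(1)] assms(3) by auto
qed

text \<open>Pass to parents on both sides until they meet. The path stays in the ball of radius
  \<open>k\<close>, so a common neighbour at distance \<open>k + 1\<close> would close it to a
  cycle; this is the use in \<open>parent_unique\<close>.\<close>

lemma path_in_ball: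
  assumes "x \<in> V" "p \<in> V" "p' \<in> V" "d x p = k" "d x p' = k" "p \<noteq> p'"
  shows "\<exists>q. walk T q \<and> distinct q \<and> hd q = p \<and> last q = p' \<and> 2 \<le> length q \<and> (\<forall>z\<in>set q. d x z \<le> k)"
  using assms(2-)
proof (induction k arbitrary: p p')
  case 0
  thus ?case using d_zero_iff assms(1) by metis
next
  case (Suc k)
  obtain a where a: "adj p a" "d x a = k" using ex_parent[OF assms(1) Suc(2,4)] .
  obtain b where b: "adj p' b" "d x b = k" using ex_parent[OF assms(1) Suc(3,5)] .
  show ?case
  proof (cases "a = b")
    case True
    have "walk T [p, a, p']"
      using a b True adj_V adj_sym[of p' b] by (auto simp: walk_def adj_def)
    moreover have "distinct [p, a, p']" using Suc.prems a b True by auto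
    ultimately show ?thesis using Suc.prems a by (intro exI[of _ "[p, a, p']"]) auto
  next
    case False
    obtain q where q: "walk T q" "distinct q" "hd q = a" "last q = b" "2 \<le> length q" "\<forall>z\<in>set q. d x z \<le> k"
      using Suc.IH[OF _ _ a(2) b(2) False] adj_V a b by blast
    have ne: "q \<noteq> []" using q by auto
    have "walk T (q @ [p'])"
      using q(1,4) b(1) ne adj_V(1)[OF b(1)] adj_sym[of p' b]
      by (auto simp: walk_def successively_append_iff adj_def)
    hence "walk T (p # q @ [p'])" using walk_Cons[of "q @ [p']" p] a(1) q(3) ne by auto
    moreover have "distinct (p # q @ [p'])" using q(2,6) Suc.prems by auto
    moreover have "\<forall>z\<in>set (p # q @ [p']). d x z \<le> Suc k" using q(6) Suc.prems by auto
    ultimately show ?thesis by (intro exI[of _ "p # q @ [p']"]) auto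
  qed
qed

lemma parent_unique:
  assumes "x \<in> V" "adj v p" "adj v p'" "d x v = Suc (d x p)" "d x v = Suc (d x p')"
  shows "p = p'"
proof (rule ccontr)
  assume "p \<noteq> p'"
  then obtain q where q: "walk T q" "distinct q" "hd q = p" "last q = p'" "2 \<le> length q"
      "\<forall>z\<in>set q. d x z \<le> d x p"
    using path_in_ball[OF assms(1), of p p' "d x p"] assms adj_V by auto
  have "q \<noteq> []" using q by auto
  hence "walk T (v # q)" using walk_Cons q assms by auto
  moreover have "distinct (v # q)" using q assms(4) by auto
  moreover have "{last (v # q), hd (v # q)} \<in> edges T"
    using q \<open>q \<noteq> []\<close> assms(3) by (auto simp: adj_def insert_commute)
  moreover have "length (v # q) \<ge> 3" using q by auto
  ultimately show False using tree unfolding semiregular_tree_def graph_acyclic_def by blast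
qed

lemma in_C_iff: "u \<in> C x v \<longleftrightarrow> adj v u \<and> d x u = Suc (d x v)"
  by (auto simp: C_def N_def)

lemma C_V: "u \<in> C x v \<Longrightarrow> u \<in> V \<and> v \<in> V"
  using adj_V by (auto simp: in_C_iff)

lemma C_self: "x \<in> V \<Longrightarrow> C x x = N x"
  using d_adj by (auto simp: C_def N_def)

lemma C_parent:
  assumes "x \<in> V" "adj v p" "d x v = Suc (d x p)"
  shows "C x v = N v - {p}"
proof -
  have "d x u = Suc (d x v) \<longleftrightarrow> u \<noteq> p" if "adj v u" for u
    using parent_unique[OF assms(1,2) that assms(3)] adj_dist[OF assms(1) that] assms(3) by auto
  thus ?thesis by (auto simp: in_C_iff N_def)
qed

lemma C_adj_self: "adj x y \<Longrightarrow> C x y = N y - {x}"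
  using C_parent[of x y x] adj_V adj_sym d_adj by auto

lemma C_finite_card:
  assumes "x \<in> V" "v \<in> V"
  shows "finite (C x v)" "card (C x v) \<ge> 5"
proof -
  show "finite (C x v)" using N_finite_card(1)[OF assms(2)] by (simp add: C_def)
  show "card (C x v) \<ge> 5"
  proof (cases "x = v")
    case True
    thus ?thesis using C_self N_finite_card(3) assms by fastforce
  next
    case False
    then obtain k where "d x v = Suc k" using d_zero_iff[OF assms] by (cases "d x v") auto
    then obtain p where "adj v p" "d x v = Suc (d x p)" using ex_parent[OF assms] by metis
    thus ?thesis using C_parent[OF assms(1)] N_finite_card(1,3)[OF assms(2)]
      by (auto simp: card_Diff_singleton_if)
  qed
qed

lemma C_disjoint:
  assumes "x \<in> V" "u \<in> C x v" "u \<in> C x v'" shows "v = v'"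
  using parent_unique[OF assms(1), of u v v'] assms by (auto simp: in_C_iff adj_sym)

lemma S_SucE:
  assumes "x \<in> V" "u \<in> S x (Suc r)"
  obtains v where "v \<in> S x r" "u \<in> C x v"
  using ex_parent[OF assms(1), of u r] assms adj_V by (auto simp: S_def in_C_iff adj_sym)

lemma S_finite:
  assumes "x \<in> V" shows "finite (S x r)"
proof (induction r)
  case 0
  have "S x 0 = {x}" using assms d_zero_iff by (auto simp: S_def)
  thus ?case by simp
next
  case (Suc r)
  have "S x (Suc r) \<subseteq> (\<Union>v\<in>S x r. C x v)" using S_SucE[OF assms] by blast
  moreover have "finite (\<Union>v\<in>S x r. C x v)" using Suc C_finite_card(1)[OF assms] by (auto simp: S_def)
  ultimately show ?case using finite_subset by blast
qed

lemma C_ne: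
  assumes "x \<in> V" "v \<in> V" "length ys < 5"
  obtains u where "u \<in> C x v" "u \<notin> set ys"
proof -
  have "length ys < card (C x v)" using C_finite_card(2)[OF assms(1,2)] assms(3) by linarith
  thus thesis using obtain_not_in that by metis
qed

text \<open>A vertex off the edge has the same parent from either end. This is what permits
  inductions that move the centre along an edge.\<close>

lemma C_adjacent_centres:
  assumes "adj x y" "v \<in> V" "v \<noteq> x" "v \<noteq> y"
  shows "C x v = C y v"
proof -
  have x: "x \<in> V" and y: "y \<in> V" using assms adj_V by auto
  have key: "C x v = C y v" if "adj x y" "x \<in> V" "y \<in> V" "v \<noteq> x" "v \<noteq> y" "d x v = Suc (d y v)" for x y
  proof -
    obtain k where k: "d y v = Suc k" using d_zero_iff[OF \<open>y \<in> V\<close> assms(2)] \<open>v \<noteq> y\<close> by (cases "d y v") auto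
    obtain p where p: "adj v p" "d y p = k" using ex_parent[OF \<open>y \<in> V\<close> assms(2) k] .
    have "d x p = Suc k"
      using adj_dist'[OF adj_V(2)[OF p(1)] that(1)] adj_dist[OF that(2) p(1)] p(2) k that(6) by linarith
    thus ?thesis using C_parent[OF that(2) p(1)] C_parent[OF that(3) p(1)] p(2) k that(6) by simp
  qed
  show ?thesis
    using adj_dist'[OF assms(2,1)] key[OF assms(1) x y assms(3,4)]
      key[OF _ y x assms(4,3)] assms(1) adj_sym[of x y] by auto
qed

lemma ex_between:
  assumes "a \<in> V" "b \<in> V" "d a b = m + n"
  obtains z where "z \<in> V" "d a z = m" "d z b = n"
proof -
  have "\<exists>z\<in>V. d a z = m \<and> d z b = n"
    using assms(2,3)
  proof (induction n arbitrary: b)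
    case 0
    thus ?case by (intro bexI[of _ b]) auto
  next
    case (Suc n)
    obtain p where p: "adj b p" "d a p = m + n" using ex_parent[of a b "m + n"] assms Suc.prems by auto
    obtain z where z: "z \<in> V" "d a z = m" "d z p = n" using Suc.IH p adj_V by blast
    have "d z b \<le> Suc n" using d_triangle[of z p b] z p adj_V d_adj d_sym by fastforce
    moreover have "d a b \<le> d a z + d z b" using d_triangle assms(1) z(1) Suc.prems by blast
    ultimately show ?case using z Suc.prems by (intro bexI[of _ z]) auto
  qed
  thus thesis using that by blast
qed

text \<open>Used mostly to show that an automorphism fixes a vertex because it fixes, or respects,
  two vertices on either side of it.\<close>

lemma between_unique:
  assumes "a \<in> V" "b \<in> V" "z \<in> V" "z' \<in> V" "d a b = m + n"
    "d a z = m" "d z b = n" "d a z' = m" "d z' b = n"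
  shows "z = z'"
  using assms(2,5,7,9)
proof (induction n arbitrary: b)
  case 0
  thus ?case using d_zero_iff assms by metis
next
  case (Suc n)
  obtain p where p: "adj b p" "d z p = n" using ex_parent[of z b n] assms Suc.prems by auto
  obtain p' where p': "adj b p'" "d z' p' = n" using ex_parent[of z' b n] assms Suc.prems by auto
  have V: "p \<in> V" "p' \<in> V" using p p' adj_V by auto
  have "d a p \<le> m + n" "d a p' \<le> m + n"
    using d_triangle[of a z p] d_triangle[of a z' p'] assms p p' V by auto
  hence dp: "d a p = m + n" "d a p' = m + n"
    using adj_dist[OF assms(1) p(1)] adj_dist[OF assms(1) p'(1)] Suc.prems by auto
  have "p = p'" using parent_unique[OF assms(1) p(1) p'(1)] dp Suc.prems by auto
  thus ?case using Suc.IH[OF V(1)] dp p p' by auto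
qed

subsection \<open>Automorphisms\<close>

definition aut :: "('a \<Rightarrow> 'a) \<Rightarrow> bool" where "aut g \<longleftrightarrow> g \<in> carrier (aut_group T)"

lemma aut_iff: "aut g \<longleftrightarrow> g permutes V \<and> (\<forall>u\<in>V. \<forall>v\<in>V. adj (g u) (g v) \<longleftrightarrow> adj u v)"
  by (simp add: aut_def aut_group_def adj_def)

lemma aut_bij: "aut g \<Longrightarrow> bij g"
  using permutes_bij[of g V] by (simp add: aut_iff)

lemma aut_V [simp]: "aut g \<Longrightarrow> g v \<in> V \<longleftrightarrow> v \<in> V"
  by (simp add: aut_iff permutes_in_image)

lemma aut_outside: "aut g \<Longrightarrow> v \<notin> V \<Longrightarrow> g v = v"
  using permutes_not_in[of g V v] by (simp add: aut_iff)

lemma aut_eq_iff [simp]: "aut g \<Longrightarrow> g u = g v \<longleftrightarrow> u = v"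
  using bij_eq_iff[OF aut_bij] .

lemma aut_adj [simp]: "aut g \<Longrightarrow> adj (g u) (g v) \<longleftrightarrow> adj u v"
  using adj_V aut_V aut_iff by metis

lemma aut_comp: "aut g \<Longrightarrow> aut h \<Longrightarrow> aut (g \<circ> h)"
  by (simp add: aut_iff permutes_compose permutes_in_image)

lemma aut_inv_inv [simp]: "aut g \<Longrightarrow> inv' g (g u) = u" "aut g \<Longrightarrow> g (inv' g v) = v"
  using aut_bij by auto

lemma aut_inv:
  assumes "aut g" shows "aut (inv' g)"
proof -
  have p: "inv' g permutes V" using assms permutes_inv by (auto simp: aut_iff)
  have "adj (inv' g u) (inv' g v) \<longleftrightarrow> adj u v" for u v
    using aut_adj[OF assms, of "inv' g u" "inv' g v"] assms by simp
  thus ?thesis using p by (simp add: aut_iff)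
qed

lemma aut_W: "aut g \<Longrightarrow> W n u v \<Longrightarrow> W n (g u) (g v)"
proof (induction n arbitrary: u)
  case (Suc n)
  then obtain w where "adj u w" "W n w v" using W_Suc by blast
  thus ?case using Suc W_Suc[of n "g u" "g v"] aut_adj by blast
qed (simp add: W_0)

lemma aut_d:
  assumes "aut g" "u \<in> V" "v \<in> V" shows "d (g u) (g v) = d u v"
proof -
  have "d (g u) (g v) \<le> d u v" using d_le[OF aut_W[OF assms(1) W_d[OF assms(2,3)]]] .
  moreover have "d (inv' g (g u)) (inv' g (g v)) \<le> d (g u) (g v)"
    using assms by (intro d_le[OF aut_W[OF aut_inv[OF assms(1)] W_d]]) auto
  ultimately show ?thesis using assms(1) by simp
qed

lemma aut_C:
  assumes "aut g" "x \<in> V" "v \<in> V" shows "g ` C x v = C (g x) (g v)"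
proof (intro equalityI subsetI)
  fix u assume "u \<in> C (g x) (g v)"
  hence u: "adj (g v) u" "d (g x) u = Suc (d (g x) (g v))" by (auto simp: in_C_iff)
  hence uV: "inv' g u \<in> V" using adj_V aut_V[OF aut_inv[OF assms(1)]] by blast
  have "adj v (inv' g u)" using u(1) aut_adj[OF assms(1), of v "inv' g u"] assms(1) by simp
  moreover have "d x (inv' g u) = Suc (d x v)"
    using u(2) aut_d[OF assms(1,2) uV] aut_d[OF assms] assms(1) by simp
  ultimately have "inv' g u \<in> C x v" by (simp add: in_C_iff)
  thus "u \<in> g ` C x v" using assms(1) by (metis aut_inv_inv(2) imageI)
next
  fix u assume "u \<in> g ` C x v"
  thus "u \<in> C (g x) (g v)" using assms adj_V by (auto simp: in_C_iff aut_d)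
qed

lemma aut_N: "aut g \<Longrightarrow> g ` N v = N (g v)"
proof -
  assume g: "aut g"
  have "u \<in> g ` N v" if "u \<in> N (g v)" for u
    using that g aut_adj[OF g, of v "inv' g u"] by (intro image_eqI[of _ _ "inv' g u"]) (auto simp: N_def)
  thus ?thesis using g by (auto simp: N_def)
qed

lemma aut_S: "aut g \<Longrightarrow> x \<in> V \<Longrightarrow> v \<in> S x r \<Longrightarrow> g v \<in> S (g x) r"
  by (auto simp: S_def aut_d)

end

section \<open>Two-point homogeneity\<close>

text \<open>Beyond the given segment, each term is chosen from the previous term and the one
  \<open>n\<close> places before that. A condition on all pairs at distance \<open>n + 1\<close> can
  thus be maintained.\<close>

function extend_seq :: "nat \<Rightarrow> (nat \<Rightarrow> 'b) \<Rightarrow> ('b \<Rightarrow> 'b \<Rightarrow> 'b \<Rightarrow> bool) \<Rightarrow> nat \<Rightarrow> 'b" where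
  "extend_seq n w Q k = (if k \<le> n then w k
     else SOME c. Q (extend_seq n w Q (k - 1 - n)) (extend_seq n w Q (k - 1)) c)"
  by auto
termination by (relation "measure (\<lambda>(n, w, Q, k). k)") auto

declare extend_seq.simps [simp del]

context bitree
begin

section \<open>Geodesics, rays and bi-infinite lines\<close>

definition path_upto :: "nat \<Rightarrow> (nat \<Rightarrow> 'a) \<Rightarrow> bool" where
  "path_upto m f \<longleftrightarrow> (\<forall>i<m. adj (f i) (f (Suc i))) \<and> (\<forall>i. Suc i < m \<longrightarrow> f i \<noteq> f (Suc (Suc i)))"

text \<open>If the distance from the start dropped for the first time, the path would step to the
  parent of its current vertex, which is the vertex it has just come from.\<close>

lemma path_dist_0:
  assumes "path_upto m f" "f 0 \<in> V" "k \<le> m"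
  shows "d (f 0) (f k) = k \<and> f k \<in> V"
  using assms(3)
proof (induction k rule: less_induct)
  case (less k)
  show ?case
  proof (cases k)
    case 0
    thus ?thesis using assms by simp
  next
    case (Suc j)
    have a: "adj (f j) (f k)" using assms(1) Suc less.prems by (auto simp: path_upto_def)
    have dj: "d (f 0) (f j) = j" using less Suc by auto
    have "d (f 0) (f k) = k"
    proof (rule ccontr)
      assume "d (f 0) (f k) \<noteq> k"
      hence j: "j = Suc (d (f 0) (f k))" using adj_dist[OF assms(2) a] dj Suc by auto
      then obtain i where i: "j = Suc i" by auto
      have "adj (f j) (f i)" using assms(1) Suc i less.prems adj_sym by (auto simp: path_upto_def)
      moreover have "d (f 0) (f i) = i" using less Suc i by auto
      ultimately have "f k = f i" using parent_unique[OF assms(2) a] dj i j by auto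
      moreover have "f i \<noteq> f (Suc (Suc i))"
        using assms(1) less.prems Suc i unfolding path_upto_def by auto
      ultimately show False using Suc i by simp
    qed
    thus ?thesis using a adj_V by auto
  qed
qed

lemma path_dist:
  assumes "path_upto m f" "f 0 \<in> V" "i \<le> j" "j \<le> m"
  shows "d (f i) (f j) = j - i" "f i \<in> V" "f j \<in> V"
proof -
  show V: "f i \<in> V" "f j \<in> V" using path_dist_0[OF assms(1,2)] assms(3,4) by auto
  have p: "path_upto (m - i) (\<lambda>k. f (k + i))" using assms(1) by (auto simp: path_upto_def)
  show "d (f i) (f j) = j - i"
    using path_dist_0[OF p, of "j - i"] V assms(3,4) by auto
qed

lemma W_path: "W n a b \<Longrightarrow> \<exists>w. w 0 = a \<and> w n = b \<and> (\<forall>i<n. adj (w i) (w (Suc i)))"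
proof (induction n arbitrary: a)
  case 0
  thus ?case by (intro exI[of _ "\<lambda>_. a"]) (simp add: W_0)
next
  case (Suc n)
  then obtain c where c: "adj a c" "W n c b" using W_Suc by blast
  obtain w where w: "w 0 = c" "w n = b" "\<forall>i<n. adj (w i) (w (Suc i))" using Suc.IH[OF c(2)] by blast
  show ?case
    using w c by (intro exI[of _ "case_nat a w"]) (auto split: nat.splits)
qed

lemma path_W:
  assumes "\<forall>i<n. adj (w i) (w (Suc i))" "i + k \<le> n" "w 0 \<in> V"
  shows "W k (w i) (w (i + k))"
proof -
  have V: "w j \<in> V" if "j \<le> n" for j
  proof (cases j)
    case (Suc i)
    thus ?thesis using that assms(1) adj_V(2)[of "w i" "w j"] by simp
  qed (use assms(3) in simp)
  show ?thesis
    using assms(2)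
  proof (induction k)
    case 0
    thus ?case using V by (simp add: W_0)
  next
    case (Suc k)
    have "W 1 (w (i + k)) (w (Suc (i + k)))" using assms(1) Suc.prems V by (auto simp: W_Suc W_0)
    thus ?case using W_trans[OF Suc.IH] Suc.prems by fastforce
  qed
qed

lemma geodesic:
  assumes "a \<in> V" "b \<in> V"
  obtains w where "w 0 = a" "w (d a b) = b" "path_upto (d a b) w"
proof -
  let ?n = "d a b"
  obtain w where w: "w 0 = a" "w ?n = b" and e: "\<forall>i<?n. adj (w i) (w (Suc i))"
    using W_path[OF W_d[OF assms]] by blast
  have "w i \<noteq> w (Suc (Suc i))" if i: "Suc i < ?n" for i
  proof
    assume eq: "w i = w (Suc (Suc i))"
    have "W i a (w i)" using path_W[OF e, of 0 i] i w assms by auto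
    moreover have "W (?n - Suc (Suc i)) (w i) b"
    proof -
      have "Suc (Suc i) + (?n - Suc (Suc i)) = ?n" using i by simp
      thus ?thesis using path_W[OF e, of "Suc (Suc i)" "?n - Suc (Suc i)"] w assms(1) eq by (metis order_refl)
    qed
    ultimately have "?n \<le> i + (?n - Suc (Suc i))" using d_le[OF W_trans] by blast
    thus False using i by simp
  qed
  thus thesis using that[OF w] e unfolding path_upto_def by blast
qed

lemma extend_ray:
  assumes n: "n \<ge> 1" and w: "path_upto n w" "w 0 \<in> V"
    and ex: "\<And>a b. a \<in> V \<Longrightarrow> b \<in> V \<Longrightarrow> d a b = n \<Longrightarrow> \<exists>c. adj b c \<and> d a c = Suc n \<and> R a c"
  obtains f where "\<And>i. i \<le> n \<Longrightarrow> f i = w i" "\<And>m. path_upto m f" "\<And>i. R (f i) (f (i + n + 1))"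
proof -
  define Q where "Q = (\<lambda>a b c. adj b c \<and> d a c = Suc n \<and> R a c)"
  define f where "f = extend_seq n w Q"
  have f_le: "f i = w i" if "i \<le> n" for i using that by (simp add: f_def extend_seq.simps)
  have f_gt: "f (Suc k) = (SOME c. Q (f (k - n)) (f k) c)" if "n \<le> k" for k
    using that unfolding f_def by (subst extend_seq.simps) simp
  have f0: "f 0 \<in> V" using f_le w by simp
  have main: "path_upto (n + k) f \<and> (\<forall>i<k. R (f i) (f (i + n + 1)))" for k
  proof (induction k)
    case 0
    have "path_upto n f" using w(1) f_le by (auto simp: path_upto_def)
    thus ?case by simp
  next
    case (Suc k)
    have p: "path_upto (n + k) f" using Suc by blast
    have "d (f k) (f (n + k)) = n" "f k \<in> V" "f (n + k) \<in> V"
      using path_dist[OF p f0, of k "n + k"] by auto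
    hence "\<exists>c. Q (f k) (f (n + k)) c" using ex by (auto simp: Q_def)
    moreover have "f (Suc (n + k)) = (SOME c. Q (f k) (f (n + k)) c)" using f_gt[of "n + k"] by simp
    ultimately have q: "Q (f k) (f (n + k)) (f (Suc (n + k)))" by (metis someI_ex)
    have "path_upto (Suc (n + k)) f"
      unfolding path_upto_def
    proof (intro conjI allI impI)
      fix i assume "i < Suc (n + k)"
      thus "adj (f i) (f (Suc i))"
        using p q by (cases "i = n + k") (auto simp: path_upto_def Q_def)
    next
      fix i assume i: "Suc i < Suc (n + k)"
      show "f i \<noteq> f (Suc (Suc i))"
      proof (cases "Suc i = n + k")
        case True
        have "d (f k) (f i) = i - k" using path_dist(1)[OF p f0, of k i] True n by auto
        thus ?thesis using q True n by (auto simp: Q_def)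
      next
        case False
        thus ?thesis using p i unfolding path_upto_def by auto
      qed
    qed
    moreover have "R (f i) (f (i + n + 1))" if "i < Suc k" for i
      using that Suc q by (cases "i = k") (auto simp: Q_def add.commute)
    ultimately show ?case by simp
  qed
  have "path_upto m f" for m
    using main[of m] by (auto simp: path_upto_def)
  moreover have "R (f i) (f (i + n + 1))" for i using main[of "Suc i"] by blast
  ultimately show thesis using that f_le by blast
qed

definition line :: "(int \<Rightarrow> 'a) \<Rightarrow> bool" where
  "line L \<longleftrightarrow> (\<forall>i. adj (L i) (L (i + 1))) \<and> (\<forall>i. L i \<noteq> L (i + 2))"

lemma line_V: "line L \<Longrightarrow> L i \<in> V"
  using adj_V(1)[of "L i" "L (i + 1)"] by (simp add: line_def)

lemma line_dist:
  assumes "line L" shows "d (L i) (L j) = nat \<bar>i - j\<bar>"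
proof -
  have le: "d (L i) (L j) = nat (j - i)" if "i \<le> j" for i j
  proof -
    have "path_upto m (\<lambda>k. L (i + int k))" for m
    proof -
      have "L (i + int (Suc k)) = L (i + int k + 1)" "L (i + int (Suc (Suc k))) = L (i + int k + 2)" for k
        by (simp_all add: algebra_simps)
      thus ?thesis using assms unfolding path_upto_def line_def by simp
    qed
    from path_dist_0[OF this[of "nat (j - i)"], of "nat (j - i)"] show ?thesis
      using line_V[OF assms] that by simp
  qed
  show ?thesis using le[of i j] le[of j i] d_sym[OF line_V[OF assms] line_V[OF assms]]
    by (cases "i \<le> j") auto
qed

lemma line_inj: "line L \<Longrightarrow> L i = L j \<Longrightarrow> i = j"
  using line_dist[of L i j] line_V by auto

text \<open>The geodesic from \<open>a\<close> to \<open>b\<close> is prolonged by a ray at each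
  end. The backward ray reads the relation in the opposite direction, whence the second extension
  hypothesis.\<close>

lemma extend_line:
  assumes n: "n \<ge> 1" and ab: "a \<in> V" "b \<in> V" "d a b = n"
    and ex: "\<And>a b. a \<in> V \<Longrightarrow> b \<in> V \<Longrightarrow> d a b = n \<Longrightarrow> \<exists>c. adj b c \<and> d a c = Suc n \<and> R a c"
    and ex': "\<And>a b. a \<in> V \<Longrightarrow> b \<in> V \<Longrightarrow> d a b = n \<Longrightarrow> \<exists>c. adj b c \<and> d a c = Suc n \<and> R c a"
  obtains L where "line L" "L 0 = a" "L (int n) = b" "\<And>i. R (L i) (L (i + int n + 1))"
proof -
  obtain w where w: "w 0 = a" "w n = b" "path_upto n w" using geodesic[OF ab(1,2)] ab(3) by metis
  obtain f where f: "\<And>i. i \<le> n \<Longrightarrow> f i = w i" "\<And>m. path_upto m f" "\<And>i. R (f i) (f (i + n + 1))"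
    using extend_ray[OF n w(3) _ ex] w(1) ab(1) by blast
  have rev: "path_upto n (\<lambda>i. w (n - i))"
  proof -
    have "adj (w (n - i)) (w (n - Suc i))" if "i < n" for i
    proof -
      have "n - i = Suc (n - Suc i)" using that by auto
      thus ?thesis using w(3) that adj_sym by (auto simp: path_upto_def)
    qed
    moreover have "w (n - i) \<noteq> w (n - Suc (Suc i))" if "Suc i < n" for i
    proof -
      have "n - i = Suc (Suc (n - Suc (Suc i)))" using that by auto
      moreover have "w (n - Suc (Suc i)) \<noteq> w (Suc (Suc (n - Suc (Suc i))))"
        using w(3) that unfolding path_upto_def by auto
      ultimately show ?thesis by simp
    qed
    ultimately show ?thesis by (auto simp: path_upto_def)
  qed
  obtain g where g: "\<And>i. i \<le> n \<Longrightarrow> g i = w (n - i)" "\<And>m. path_upto m g" "\<And>i. R (g (i + n + 1)) (g i)"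
  proof (rule extend_ray[where R = "\<lambda>a c. R c a", OF n rev _ ex'])
    show "w (n - 0) \<in> V" using w(2) ab(2) by simp
  qed auto
  \<comment> \<open>Both rays contain the segment \<open>0..n\<close>, and every pair
    \<open>i\<close>, \<open>i + n + 1\<close> lies on a single one of them: on \<open>f\<close> for
    \<open>i \<ge> 0\<close>, on \<open>g\<close> for \<open>i < 0\<close>.\<close>
  define L where "L i = (if i \<ge> 0 then f (nat i) else g (nat (int n - i)))" for i :: int
  have Lg: "L i = g (nat (int n - i))" if "i \<le> int n" for i
    using that f(1)[of "nat i"] g(1)[of "nat (int n - i)"] by (auto simp: L_def nat_diff_distrib)
  have "adj (L i) (L (i + 1))" for i
  proof (cases "i \<ge> 0")
    case True
    hence "L i = f (nat i)" "L (i + 1) = f (Suc (nat i))" by (simp_all add: L_def nat_add_distrib)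
    thus ?thesis using f(2)[of "Suc (nat i)"] unfolding path_upto_def by simp
  next
    case False
    hence e: "nat (int n - i) = Suc (nat (int n - (i + 1)))" using n by auto
    have "adj (g (nat (int n - (i + 1)))) (g (Suc (nat (int n - (i + 1)))))"
      using g(2)[of "Suc (nat (int n - (i + 1)))"] unfolding path_upto_def by blast
    thus ?thesis using False n Lg[of i] Lg[of "i + 1"] e adj_sym by simp
  qed
  moreover have "L i \<noteq> L (i + 2)" for i
  proof (cases "i \<ge> 0")
    case True
    hence "L i = f (nat i)" "L (i + 2) = f (Suc (Suc (nat i)))" by (simp_all add: L_def nat_add_distrib)
    moreover have "f (nat i) \<noteq> f (Suc (Suc (nat i)))"
      using f(2)[of "Suc (Suc (nat i))"] unfolding path_upto_def by blast
    ultimately show ?thesis by simp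
  next
    case False
    hence e: "nat (int n - i) = Suc (Suc (nat (int n - (i + 2))))" using n by auto
    have "g (nat (int n - (i + 2))) \<noteq> g (Suc (Suc (nat (int n - (i + 2)))))"
      using g(2)[of "Suc (Suc (nat (int n - (i + 2))))"] unfolding path_upto_def by blast
    thus ?thesis using False n Lg[of i] Lg[of "i + 2"] e by simp
  qed
  ultimately have "line L" by (auto simp: line_def)
  moreover have "R (L i) (L (i + int n + 1))" for i
  proof (cases "i \<ge> 0")
    case True
    hence "nat (i + int n + 1) = nat i + n + 1" by auto
    thus ?thesis using f(3)[of "nat i"] True by (auto simp: L_def)
  next
    case False
    hence "nat (int n - i) = nat (- i - 1) + n + 1" "nat (int n - (i + int n + 1)) = nat (- i - 1)" by auto
    thus ?thesis using g(3)[of "nat (- i - 1)"] Lg[of i] Lg[of "i + int n + 1"] False by auto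
  qed
  moreover have "L 0 = a" "L (int n) = b" using f(1) w by (auto simp: L_def)
  ultimately show thesis using that by blast
qed

lemma line_ray:
  assumes "line L" shows "(\<lambda>k. L (int k)) \<in> rays T" "(\<lambda>k. L (- int k)) \<in> rays T"
proof -
  have a: "adj (L i) (L (i + 1))" for i using assms by (simp add: line_def)
  have inj: "inj (\<lambda>k. L (int k))" "inj (\<lambda>k. L (- int k))"
    using line_inj[OF assms] by (auto intro!: injI dest: line_inj[OF assms])
  have "adj (L (int k)) (L (int (Suc k)))" "adj (L (- int k)) (L (- int (Suc k)))" for k
  proof -
    have "int (Suc k) = int k + 1" "- int k = - int (Suc k) + 1" by simp_all
    thus "adj (L (int k)) (L (int (Suc k)))" "adj (L (- int k)) (L (- int (Suc k)))"
      using a[of "int k"] a[of "- int (Suc k)"] adj_sym by metis+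
  qed
  thus "(\<lambda>k. L (int k)) \<in> rays T" "(\<lambda>k. L (- int k)) \<in> rays T"
    using inj line_V[OF assms] by (auto simp: rays_def adj_def)
qed

lemma ray_equiv_refl: "r \<in> rays T \<Longrightarrow> (r, r) \<in> ray_equiv T"
  by (auto simp: ray_equiv_def)

end

text \<open>The hypotheses on \<open>H\<close> in the form in which they are used: the local action
  on neighbours instead of edges, and closedness as stability under approximation on finite
  sets.\<close>

locale bt_group = bitree T d0 d1 for T :: "'a bigraph" and d0 d1 +
  fixes H :: "('a \<Rightarrow> 'a) set"
  assumes H_aut: "\<And>h. h \<in> H \<Longrightarrow> aut h"
    and H_group: "perm_group H"
    and H_ty: "\<And>h v. h \<in> H \<Longrightarrow> v \<in> V \<Longrightarrow> ty (h v) = ty v"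
    and H_local: "\<And>x \<pi>. x \<in> V \<Longrightarrow> \<pi> permutes N x \<Longrightarrow> evenperm \<pi> \<Longrightarrow>
       \<exists>h\<in>H. h x = x \<and> (\<forall>u\<in>N x. h u = \<pi> u)"
    and H_closed: "\<And>g. aut g \<Longrightarrow> (\<And>F. finite F \<Longrightarrow> F \<subseteq> V \<Longrightarrow> \<exists>h\<in>H. \<forall>v\<in>F. h v = g v) \<Longrightarrow> g \<in> H"
    and H_ends: "two_transitive H act_end (ends T)"
begin

lemma H_id: "id \<in> H" and H_inv: "g \<in> H \<Longrightarrow> inv' g \<in> H"
  and H_comp: "g \<in> H \<Longrightarrow> h \<in> H \<Longrightarrow> g \<circ> h \<in> H" and H_bij: "g \<in> H \<Longrightarrow> bij g"
  using H_group perm_groupD by auto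

lemma H_inv_inv [simp]: "h \<in> H \<Longrightarrow> inv' h (h u) = u" "h \<in> H \<Longrightarrow> h (inv' h v) = v"
  using H_aut by auto

lemma H_V [simp]: "h \<in> H \<Longrightarrow> h v \<in> V \<longleftrightarrow> v \<in> V"
  using H_aut by auto

lemma H_d: "h \<in> H \<Longrightarrow> u \<in> V \<Longrightarrow> v \<in> V \<Longrightarrow> d (h u) (h v) = d u v"
  using H_aut aut_d by auto

text \<open>Two-transitivity matches the ends, which gives agreement only far out in both
  directions, with shifts \<open>c\<close> and \<open>c'\<close>. Comparing a long distance on both
  lines forces \<open>c = c'\<close>, and uniqueness of geodesics fills the gap.\<close>

lemma lines_equivalent:
  assumes L: "line L" and L': "line L'"
  obtains h c where "h \<in> H" "\<And>j. h (L' j) = L (j + c)"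
proof -
  define cl where "cl r = ray_equiv T `` {r}" for r
  have cl: "cl r \<in> ends T" "r \<in> cl r" if "r \<in> rays T" for r
    using that ray_equiv_refl[OF that] by (auto simp: cl_def ends_def quotient_def)
  have ne: "cl (\<lambda>k. M (int k)) \<noteq> cl (\<lambda>k. M (- int k))" if M: "line M" for M
  proof
    assume "cl (\<lambda>k. M (int k)) = cl (\<lambda>k. M (- int k))"
    hence "((\<lambda>k. M (int k)), (\<lambda>k. M (- int k))) \<in> ray_equiv T"
      using cl(2)[OF line_ray(2)[OF M]] by (auto simp: cl_def)
    then obtain m n where e: "\<And>k. M (int (m + k)) = M (- int (n + k))" by (auto simp: ray_equiv_def)
    have "int (m + 1) = - int (n + 1)" using line_inj[OF M e[of 1]] .
    thus False by linarith
  qed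
  obtain h where h: "h \<in> H" and h1: "act_end h (cl (\<lambda>k. L' (int k))) = cl (\<lambda>k. L (int k))"
    and h2: "act_end h (cl (\<lambda>k. L' (- int k))) = cl (\<lambda>k. L (- int k))"
    using H_ends ne[OF L] ne[OF L'] cl(1)[OF line_ray(1)] cl(1)[OF line_ray(2)] L L'
    unfolding two_transitive_def by metis
  define M where "M j = h (L' j)" for j
  have M: "line M" using L' H_aut[OF h] by (auto simp: line_def M_def)
  have "h \<circ> (\<lambda>k. L' (int k)) \<in> cl (\<lambda>k. L (int k))"
    using h1 cl(2)[OF line_ray(1)[OF L']] unfolding act_end_def by blast
  then obtain m n where mn: "\<And>k. L (int (m + k)) = M (int (n + k))"
    by (auto simp: cl_def ray_equiv_def M_def)
  have "h \<circ> (\<lambda>k. L' (- int k)) \<in> cl (\<lambda>k. L (- int k))"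
    using h2 cl(2)[OF line_ray(2)[OF L']] unfolding act_end_def by blast
  then obtain m' n' where mn': "\<And>k. L (- int (m' + k)) = M (- int (n' + k))"
    by (auto simp: cl_def ray_equiv_def M_def)
  define c where "c = int m - int n"
  define c' where "c' = int n' - int m'"
  have up: "M j = L (j + c)" if "j \<ge> int n" for j
    using mn[of "nat (j - int n)"] that by (simp add: c_def algebra_simps)
  have down: "M j = L (j + c')" if "j \<le> - int n'" for j
    using mn'[of "nat (- j - int n')"] that by (simp add: c'_def algebra_simps)
  have cc: "c = c'"
  proof -
    \<comment> \<open>Large enough for both agreements to hold at \<open>J\<close> and
      \<open>- J\<close>, and for the signs of the index differences to be known.\<close>
    define J where "J = int n + int n' + \<bar>c\<bar> + \<bar>c'\<bar>"
    have "d (M (- J)) (M J) = nat (2 * J)" using line_dist[OF M] by (simp add: J_def)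
    moreover have "d (M (- J)) (M J) = nat (2 * J + c - c')"
    proof -
      have "M J = L (J + c)" "M (- J) = L (- J + c')" using up[of J] down[of "- J"] by (simp_all add: J_def)
      moreover have "\<bar>(- J + c') - (J + c)\<bar> = 2 * J + c - c'" by (auto simp: J_def)
      ultimately show ?thesis using line_dist[OF L, of "- J + c'" "J + c"] by metis
    qed
    moreover have "2 * J \<ge> 0" "2 * J + c - c' \<ge> 0" by (auto simp: J_def)
    ultimately show ?thesis by linarith
  qed
  have "M j = L (j + c)" for j
  proof -
    define J where "J = int n + int n' + \<bar>j\<bar>"
    have e: "M J = L (J + c)" "M (- J) = L (- J + c)"
      using up[of J] down[of "- J"] cc by (auto simp: J_def)
    show ?thesis
    proof (rule between_unique[of "M (- J)" "M J" _ _ "nat (J + j)" "nat (J - j)"])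
      show "d (M (- J)) (L (j + c)) = nat (J + j)" "d (L (j + c)) (M J) = nat (J - j)"
        unfolding e line_dist[OF L] by (auto simp: J_def)
      show "d (M (- J)) (M J) = nat (J + j) + nat (J - j)" unfolding line_dist[OF M] by (auto simp: J_def)
      show "d (M (- J)) (M j) = nat (J + j)" "d (M j) (M J) = nat (J - j)"
        unfolding line_dist[OF M] by (auto simp: J_def)
    qed (use line_V L M in auto)
  qed
  thus thesis using that h unfolding M_def by blast
qed

lemma local_transitive:
  assumes "x \<in> V" "u \<in> N x" "v \<in> N x"
  obtains h where "h \<in> H" "h x = x" "h u = v"
proof (cases "u = v")
  case True
  thus thesis using that[OF H_id] by simp
next
  case False
  obtain e where e: "e \<in> N x" "e \<notin> {u, v}"
    using obtain_not_in[of "[u, v]" "N x"] N_finite_card(3)[OF assms(1)] by auto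
  obtain h where "h \<in> H" "h x = x" "\<forall>w\<in>N x. h w = cyc3 u v e w"
    using H_local[OF assms(1) cyc3_permutes evenperm_cyc3, of u v e] assms e False by auto
  thus thesis using that[of h] assms False e by (auto simp: cyc3_apply)
qed

lemma vertex_transitive:
  assumes "a \<in> V" "a' \<in> V" "ty a = ty a'"
  obtains h where "h \<in> H" "h a = a'"
proof -
  have "\<exists>h\<in>H. h a = a'" if "d a a' = 2 * m" for m
    using assms(1) that
  proof (induction m arbitrary: a)
    case 0
    thus ?case using d_zero_iff assms(2) H_id by (metis id_apply mult_0_right)
  next
    case (Suc m)
    obtain z where z: "z \<in> V" "d a z = 2" "d z a' = 2 * m"
      using ex_between[OF Suc.prems(1) assms(2), of 2 "2 * m"] Suc.prems by auto
    obtain y where y: "y \<in> V" "d a y = 1" "d y z = 1"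
      using ex_between[OF Suc.prems(1) z(1), of 1 1] z by auto
    have "a \<in> N y" "z \<in> N y" using d_1 y z Suc.prems adj_sym by (auto simp: N_def)
    then obtain k where k: "k \<in> H" "k a = z" using local_transitive[OF y(1)] by metis
    obtain h where h: "h \<in> H" "h z = a'" using Suc.IH[OF z(1,3)] by blast
    show ?case using H_comp[OF h(1) k(1)] h k by (intro bexI[of _ "h \<circ> k"]) auto
  qed
  moreover have "even (d a a')" using d_parity assms by auto
  ultimately show thesis using that by (metis evenE)
qed

text \<open>All pairs at distance \<open>n + 1\<close> on some line \<open>L\<close> starting in the right part lie in the orbit
  of a given pair; a line through any other pair is carried to \<open>L\<close>, possibly with a shift.\<close>

lemma homogeneous:
  assumes "a \<in> V" "b \<in> V" "a' \<in> V" "b' \<in> V" "ty a = ty a'" "d a b = d a' b'"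
  obtains h where "h \<in> H" "h a = a'" "h b = b'"
proof -
  have "\<exists>h\<in>H. h a = a' \<and> h b = b'" if "d a b = n" "d a' b' = n" for n
    using assms(1-5) that
  proof (induction n arbitrary: a b a' b')
    case 0
    have "a = b" "a' = b'" using 0 d_zero_iff by auto
    thus ?case using vertex_transitive[OF 0(1,3,5)] by metis
  next
    case (Suc n)
    note p = Suc.prems
    show ?case
    proof (cases "n = 0")
      case True
      obtain h where h: "h \<in> H" "h a = a'" using vertex_transitive[OF p(1,3,5)] .
      have ab: "adj a b" "adj a' b'" using d_1 p True by auto
      hence "h b \<in> N a'" "b' \<in> N a'" using h aut_adj[OF H_aut[OF h(1)], of a b] by (auto simp: N_def)
      then obtain k where k: "k \<in> H" "k a' = a'" "k (h b) = b'" using local_transitive[OF p(3)] by metis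
      show ?thesis using H_comp[OF k(1) h(1)] h k by (intro bexI[of _ "k \<circ> h"]) auto
    next
      case False
      hence n: "n \<ge> 1" by simp
      \<comment> \<open>\<open>H\<close> preserves types, so only pairs starting in the type of
        \<open>a\<close> can lie in the orbit, and \<open>R\<close> is vacuous for the rest. The
        induction hypothesis for the first \<open>n\<close> steps from \<open>a\<close> to
        \<open>b\<close> gives the forward extensions, for the last \<open>n\<close> steps the
        backward ones.\<close>
      define R where "R u v \<longleftrightarrow> (ty u = ty a \<longrightarrow> (\<exists>h\<in>H. h a = u \<and> h b = v))" for u v
      obtain b1 where b1: "b1 \<in> V" "d a b1 = n" "d b1 b = 1" using ex_between[of a b n 1] p by auto
      obtain a1 where a1: "a1 \<in> V" "d a a1 = 1" "d a1 b = n" using ex_between[of a b 1 n] p by auto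
      have ex: "\<exists>w. adj v w \<and> d u w = Suc n \<and> R u w" if uv: "u \<in> V" "v \<in> V" "d u v = n" for u v
      proof (cases "ty u = ty a")
        case True
        obtain h where h: "h \<in> H" "h a = u" "h b1 = v" using Suc.IH[OF p(1) b1(1) uv(1,2) _ b1(2) uv(3)] True by auto
        have "adj v (h b)" using aut_adj[OF H_aut[OF h(1)], of b1 b] h d_1[OF b1(1) p(2) b1(3)] by simp
        moreover have "d u (h b) = Suc n" using H_d[OF h(1) p(1,2)] h p by simp
        ultimately show ?thesis using h unfolding R_def by blast
      next
        case False
        obtain w where "w \<in> C u v" using C_ne[OF uv(1,2), of "[]"] by auto
        thus ?thesis using False uv by (auto simp: R_def in_C_iff)
      qed
      have ex': "\<exists>w. adj v w \<and> d u w = Suc n \<and> R w u" if uv: "u \<in> V" "v \<in> V" "d u v = n" for u v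
      proof (cases "ty v = ty a")
        case False
        have "adj a a1" using d_1 p a1 by auto
        hence "ty a1 = ty v" using adj_ty False by blast
        then obtain h where h: "h \<in> H" "h a1 = v" "h b = u"
          using Suc.IH[OF a1(1) p(2) uv(2,1) _ a1(3)] d_sym uv by metis
        have "adj v (h a)" using aut_adj[OF H_aut[OF h(1)], of a1 a] h \<open>adj a a1\<close> adj_sym by simp
        moreover have "d u (h a) = Suc n" using H_d[OF h(1) p(2,1)] h p d_sym by simp
        ultimately show ?thesis using h unfolding R_def by blast
      next
        case True
        obtain w where w: "w \<in> C u v" using C_ne[OF uv(1,2), of "[]"] by auto
        hence "ty w \<noteq> ty a" using True adj_ty by (auto simp: in_C_iff)
        thus ?thesis using w uv by (auto simp: R_def in_C_iff)
      qed
      have "\<exists>L. line L \<and> (\<forall>i. R (L i) (L (i + int n + 1)))"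
        using extend_line[where R = R and thesis = "\<exists>L. line L \<and> (\<forall>i. R (L i) (L (i + int n + 1)))",
            OF n p(1) b1(1,2) ex ex'] by blast
      then obtain L where L: "line L" "\<And>i. R (L i) (L (i + int n + 1))" by blast
      have triv: "\<exists>w. adj v w \<and> d u w = Suc (Suc n) \<and> True" if uv: "u \<in> V" "v \<in> V" "d u v = Suc n" for u v
        using C_ne[OF uv(1,2), of "[]"] uv by (auto simp: in_C_iff)
      obtain L' where L': "line L'" "L' 0 = a'" "L' (int (Suc n)) = b'"
        by (rule extend_line[where R = "\<lambda>_ _. True", OF _ p(3,4) p(7) triv triv]) auto
      obtain h c where h: "h \<in> H" "\<And>j. h (L' j) = L (j + c)" using lines_equivalent[OF L(1) L'(1)] by metis
      have "h a' = L c" "h b' = L (c + int n + 1)"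
        using h(2)[of 0] h(2)[of "int (Suc n)"] L' by (auto simp: algebra_simps)
      \<comment> \<open>The shift \<open>c\<close> is arbitrary, but types are preserved, so
        \<open>L c\<close> starts a pair for which \<open>R\<close> is not vacuous.\<close>
      moreover have "ty (h a') = ty a" using H_ty h(1) p by auto
      ultimately obtain k where k: "k \<in> H" "k a = h a'" "k b = h b'" using L(2)[of c] unfolding R_def by auto
      show ?thesis using H_comp[OF H_inv[OF h(1)] k(1)] k h(1) by (intro bexI[of _ "inv' h \<circ> k"]) auto
    qed
  qed
  thus thesis using that assms(6) by blast
qed

text \<open>The image of \<open>x\<close> has the same position on the geodesic from
  \<open>a\<close> to \<open>b'\<close> as \<open>x\<close> itself.\<close>

lemma homogeneous_through:
  assumes "x \<in> V" "a \<in> V" "b \<in> V" "b' \<in> V" "d a b = d a x + d x b" "d a b' = d a x + d x b'" "d x b = d x b'"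
  obtains h where "h \<in> H" "h x = x" "h a = a" "h b = b'"
proof -
  obtain h where h: "h \<in> H" "h a = a" "h b = b'"
    using homogeneous[OF assms(2,3,2,4)] assms by auto
  have "d a (h x) = d a x" using H_d[OF h(1) assms(2,1)] h by simp
  moreover have "d (h x) b' = d x b'" using H_d[OF h(1) assms(1,3)] h assms by simp
  ultimately have "h x = x"
    using between_unique[of a b' "h x" x] h(1) assms by simp
  thus thesis using that h by blast
qed

end

section \<open>Pointwise stabilizers\<close>

definition pfix :: "'b set \<Rightarrow> ('b \<Rightarrow> 'b) set \<Rightarrow> ('b \<Rightarrow> 'b) set" where
  "pfix A K = {k \<in> K. \<forall>a\<in>A. k a = a}"

lemma perm_group_pfix:
  assumes "perm_group K" shows "perm_group (pfix A K)"
proof (rule perm_groupI)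
  show "inv' g \<in> pfix A K" if "g \<in> pfix A K" for g
  proof -
    have g: "g \<in> K" "\<And>a. a \<in> A \<Longrightarrow> g a = a" using that by (auto simp: pfix_def)
    have "inv' g a = a" if "a \<in> A" for a
      by (rule bij_inv_eqI[OF perm_groupD(2)[OF assms g(1)] g(2)[OF that]])
    thus ?thesis using perm_groupD(3)[OF assms g(1)] by (simp add: pfix_def)
  qed
qed (use perm_groupD[OF assms] in \<open>auto simp: pfix_def\<close>)

lemma pfixI: "k \<in> K \<Longrightarrow> (\<And>a. a \<in> A \<Longrightarrow> k a = a) \<Longrightarrow> k \<in> pfix A K"
  by (simp add: pfix_def)

lemma pfix_mono: "A \<subseteq> A' \<Longrightarrow> pfix A' K \<subseteq> pfix A K"
  by (auto simp: pfix_def)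

lemma pfix_conj:
  assumes "perm_group K" "k \<in> pfix A K" "l \<in> K"
  shows "l \<circ> k \<circ> inv' l \<in> pfix (l ` A) K"
  using assms perm_groupD[OF assms(1)] by (intro pfixI perm_groupD(4)[OF assms(1)]) (auto simp: pfix_def)

text \<open>Signs cancel in a commutator. Its action on a finite set can therefore be undone by a
  group known only to realize even permutations.\<close>

lemma even_cmt:
  assumes "finite X" "bij g" "bij h" "g ` X = X" "h ` X = X"
  shows "restrict_id (cmt g h) X permutes X" "evenperm (restrict_id (cmt g h) X)"
proof -
  define a where "a = restrict_id g X"
  define b where "b = restrict_id h X"
  have p: "restrict_id k X permutes X" if "bij k" "k ` X = X" for k
    using that by (intro permutes_restrict_id bij_betw_imageI) (auto intro: inj_on_subset simp: bij_def)
  have ab: "a permutes X" "b permutes X" using p assms by (auto simp: a_def b_def)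
  have inv: "inv' (restrict_id k X) u = inv' k u" if "bij k" "k ` X = X" "u \<in> X" for k u
  proof (rule bij_inv_eqI[OF permutes_bij[OF p[OF that(1,2)]]])
    show "restrict_id k X (inv' k u) = u" using inv_image_mem[OF that] that(1) by simp
  qed
  have "restrict_id (cmt g h) X u = cmt a b u" for u
  proof (cases "u \<in> X")
    case True
    have 1: "inv' b u = inv' h u" "inv' h u \<in> X" using inv inv_image_mem True assms by (auto simp: b_def)
    have 2: "inv' a (inv' h u) = inv' g (inv' h u)" "inv' g (inv' h u) \<in> X"
      using inv inv_image_mem 1 assms by (auto simp: a_def)
    have "h (inv' g (inv' h u)) \<in> X" using 2 assms(5) by blast
    thus ?thesis using 1 2 True by (simp add: a_def b_def)
  next
    case False
    thus ?thesis using ab permutes_not_in[OF ab(1)] permutes_not_in[OF ab(2)]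
        permutes_not_in[OF permutes_inv[OF ab(1)]] permutes_not_in[OF permutes_inv[OF ab(2)]] by simp
  qed
  hence e: "restrict_id (cmt g h) X = cmt a b" by blast
  have "permutation a" "permutation b" using ab assms(1) permutation_permutes by blast+
  thus "evenperm (restrict_id (cmt g h) X)" unfolding e
    by (auto simp: evenperm_comp evenperm_inv permutation_compose permutation_inverse)
  show "restrict_id (cmt g h) X permutes X" unfolding e
    using ab by (intro permutes_compose permutes_inv)
qed

context bitree
begin

definition B :: "'a \<Rightarrow> nat \<Rightarrow> 'a set" where "B x r = {v \<in> V. d x v \<le> r}"

lemma aut_image_B:
  assumes "aut g" "x \<in> V" shows "g ` B x r = B (g x) r"
proof (intro equalityI subsetI)
  fix v assume v: "v \<in> B (g x) r"
  hence "inv' g v \<in> V" using aut_V[OF aut_inv[OF assms(1)]] by (simp add: B_def)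
  moreover have "d x (inv' g v) = d (g x) v"
    using aut_d[OF assms(1,2), of "inv' g v"] calculation assms(1) by simp
  ultimately have "inv' g v \<in> B x r" using v by (simp add: B_def)
  thus "v \<in> g ` B x r" using assms(1) by (metis aut_inv_inv(2) imageI)
qed (use assms aut_d in \<open>auto simp: B_def\<close>)

lemma fix_parent:
  assumes "aut h" "x \<in> V" "h x = x" "u \<in> C x v" "h u \<in> C x v" shows "h v = v"
proof -
  have "h ` C x v = C x (h v)" using aut_C[OF assms(1,2), of v] C_V[OF assms(4)] assms(3) by simp
  hence "h u \<in> C x (h v)" using assms(4) by blast
  thus ?thesis using C_disjoint[OF assms(2)] assms(5) by blast
qed

lemma fix_C: "aut h \<Longrightarrow> x \<in> V \<Longrightarrow> v \<in> V \<Longrightarrow> h x = x \<Longrightarrow> h v = v \<Longrightarrow> h ` C x v = C x v"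
  using aut_C[of h x v] by simp

lemma ball_boundary: "x \<in> V \<Longrightarrow> v \<in> B x (Suc r) \<Longrightarrow> v \<notin> B x r \<Longrightarrow> \<exists>u\<in>S x r. v \<in> C x u"
  using S_SucE[of x v r] by (auto simp: B_def S_def le_Suc_eq)

lemma C_ball: "v \<in> S x r \<Longrightarrow> u \<in> C x v \<Longrightarrow> u \<in> B x (Suc r) \<and> u \<notin> B x r"
  using C_V by (auto simp: B_def S_def in_C_iff)

lemma ball_mono: "r \<le> r' \<Longrightarrow> B x r \<subseteq> B x r'"
  by (auto simp: B_def)

text \<open>\<open>w\<close> lies on the side of \<open>y\<close> and \<open>u\<close> on that of
  \<open>x\<close>, so the geodesic between them passes through \<open>x\<close>. Walking from
  \<open>x\<close> towards \<open>u\<close>, a step that came nearer to \<open>w\<close> would have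
  to go back.\<close>

lemma d_through_edge:
  assumes "adj x y" "w \<in> V" "d x w = Suc (d y w)" "u \<in> V" "d y u = Suc (d x u)"
  shows "d w u = d w x + d x u"
  using assms(4,5)
proof (induction "d x u" arbitrary: u rule: less_induct)
  case less
  have x: "x \<in> V" "y \<in> V" using assms(1) adj_V by auto
  show ?case
  proof (cases "d x u")
    case 0
    thus ?thesis using d_zero_iff[OF x(1) less(2)] by simp
  next
    case (Suc n)
    obtain p where p: "adj u p" "d x p = n" using ex_parent[OF x(1) less(2) Suc] .
    have pV: "p \<in> V" using p adj_V by blast
    have dyp: "d y p = Suc n"
      using adj_dist'[OF pV assms(1)] adj_dist[OF x(2) p(1)] p(2) less.prems(2) Suc by linarith
    have dwp: "d w p = d w x + n" using less.hyps[of p] p Suc pV dyp by simp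
    have "d w p \<noteq> Suc (d w u)"
    proof
      assume a: "d w p = Suc (d w u)"
      \<comment> \<open>The neighbour of \<open>p\<close> towards \<open>w\<close>: it is
        \<open>y\<close> if \<open>p = x\<close>, and otherwise the parent of \<open>p\<close> seen
        from \<open>x\<close>.\<close>
      obtain p0 where p0: "adj p p0" "d w p = Suc (d w p0)" "d x p0 \<noteq> Suc n \<or> p0 = y"
      proof (cases n)
        case 0
        hence "p = x" using d_zero_iff[OF x(1) pV] p by simp
        thus ?thesis using that[of y] assms d_sym x by auto
      next
        case (Suc m)
        obtain q where q: "adj p q" "d x q = m" using ex_parent[OF x(1) pV] p Suc by auto
        have qV: "q \<in> V" using q adj_V by blast
        have "d y q = Suc m"
          using adj_dist'[OF qV assms(1)] adj_dist[OF x(2) q(1)] q(2) dyp Suc by linarith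
        hence "d w q = d w x + m" using less.hyps[of q] q Suc \<open>d x u = Suc n\<close> qV by simp
        thus ?thesis using that[of q] q dwp Suc by simp
      qed
      have "u = p0" using parent_unique[OF assms(2) _ p0(1) a p0(2)] p(1) adj_sym by blast
      thus False using p0(3) Suc less.prems(2) x by auto
    qed
    thus ?thesis using adj_dist[OF assms(2) p(1)] dwp Suc by linarith
  qed
qed

lemma ex_beyond:
  assumes "w \<in> V" "x \<in> V" "y \<in> C w x"
  obtains u where "u \<in> V" "d y u = m" "d x u = Suc m" "d w u = d w x + Suc m"
proof -
  have y: "y \<in> V" "adj x y" using assms C_V by (auto simp: in_C_iff)
  have "\<exists>u\<in>V. d y u = m \<and> d x u = Suc m \<and> d w u = d w x + Suc m"
  proof (induction m)
    case 0
    show ?case using assms(3) y d_adj by (intro bexI[of _ y]) (auto simp: in_C_iff)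
  next
    case (Suc m)
    then obtain u where u: "u \<in> V" "d y u = m" "d x u = Suc m" "d w u = d w x + Suc m" by blast
    obtain z where z: "z \<in> C w u" using C_ne[OF assms(1) u(1), of "[]"] by auto
    hence zV: "z \<in> V" and dz: "d u z = 1" "d w z = d w x + Suc (Suc m)"
      using C_V[OF z] d_adj u by (auto simp: in_C_iff)
    have "d w z \<le> d w x + d x z" "d x z \<le> d x y + d y z" "d y z \<le> d y u + d u z"
      using d_triangle assms y u zV by blast+
    moreover have "d x y = 1" using d_adj y by blast
    ultimately have "d y z = Suc m" "d x z = Suc (Suc m)" using dz u by linarith+
    thus ?case using zV dz by auto
  qed
  thus thesis using that by blast
qed

end

section \<open>Independence of the local actions on spheres\<close>

context bt_group
begin

definition ball_fixer :: "nat \<Rightarrow> 'a \<Rightarrow> ('a \<Rightarrow> 'a) set" where "ball_fixer r x = pfix (B x r) H"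

text \<open>For \<open>u\<close> at distance \<open>r\<close> from \<open>x\<close>: within the ball
  of radius \<open>r + 1\<close>, only children of \<open>u\<close> can move.\<close>

definition Q :: "nat \<Rightarrow> 'a \<Rightarrow> 'a \<Rightarrow> ('a \<Rightarrow> 'a) set" where "Q r x u = pfix (B x (Suc r) - C x u) H"

definition trivial_on :: "('a \<Rightarrow> 'a) \<Rightarrow> 'a set \<Rightarrow> bool" where "trivial_on k X \<longleftrightarrow> (\<forall>u\<in>X. k u = u)"

lemma pfix_group: "perm_group (pfix A H)"
  using perm_group_pfix[OF H_group] .

lemma ball_fixer_group: "perm_group (ball_fixer r x)"
  unfolding ball_fixer_def by (rule pfix_group)

lemma H_fix_C: "h \<in> H \<Longrightarrow> x \<in> V \<Longrightarrow> v \<in> V \<Longrightarrow> h x = x \<Longrightarrow> h v = v \<Longrightarrow> h ` C x v = C x v"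
  using fix_C H_aut by blast

lemma ball_fixer_D: "h \<in> ball_fixer r x \<Longrightarrow> h \<in> H" "h \<in> ball_fixer r x \<Longrightarrow> v \<in> V \<Longrightarrow> d x v \<le> r \<Longrightarrow> h v = v"
  by (auto simp: ball_fixer_def pfix_def B_def)

lemma ball_fixer_C: "h \<in> ball_fixer r x \<Longrightarrow> x \<in> V \<Longrightarrow> v \<in> V \<Longrightarrow> d x v \<le> r \<Longrightarrow> h ` C x v = C x v"
  using H_fix_C ball_fixer_D by simp

lemma ball_fixer_conj:
  assumes "l \<in> H" "k \<in> ball_fixer r x" "x \<in> V" shows "l \<circ> k \<circ> inv' l \<in> ball_fixer r (l x)"
  using pfix_conj[OF H_group, of k "B x r" l] assms aut_image_B[OF H_aut[OF assms(1)] assms(3)]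
  by (simp add: ball_fixer_def)

lemma Q_conj:
  assumes "l \<in> H" "k \<in> Q r x u" "x \<in> V" "u \<in> V" shows "l \<circ> k \<circ> inv' l \<in> Q r (l x) (l u)"
proof -
  have "l ` (B x (Suc r) - C x u) = B (l x) (Suc r) - C (l x) (l u)"
    using image_set_diff[OF bij_is_inj[OF H_bij[OF assms(1)]]] H_aut[OF assms(1)]
      aut_image_B aut_C assms by metis
  thus ?thesis using pfix_conj[OF H_group _ assms(1)] assms(2) unfolding Q_def by metis
qed

lemma Q_D:
  assumes "h \<in> Q r x u"
  shows "h \<in> H" "v \<in> V \<Longrightarrow> d x v \<le> Suc r \<Longrightarrow> v \<notin> C x u \<Longrightarrow> h v = v"
  using assms by (auto simp: Q_def pfix_def B_def)

lemma Q_ball_fixer: "x \<in> V \<Longrightarrow> u \<in> S x r \<Longrightarrow> Q r x u \<subseteq> ball_fixer r x"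
  unfolding Q_def ball_fixer_def using C_ball ball_mono[of r "Suc r"] by (intro pfix_mono) fastforce

text \<open>The workhorse: to make a normalized subgroup rich on a set of children, it remains to
  find one element acting nontrivially there.\<close>

lemma rich_H:
  assumes "K \<subseteq> H" "L \<subseteq> H" "perm_group K" "x \<in> V" "v \<in> V" "rich L (C x v)"
    and "\<And>k. k \<in> K \<Longrightarrow> k ` C x v = C x v" "\<And>l. l \<in> L \<Longrightarrow> l ` C x v = C x v"
    and "\<And>l k. l \<in> L \<Longrightarrow> k \<in> K \<Longrightarrow> l \<circ> k \<circ> inv' l \<in> K"
    and "k0 \<in> K" "\<not> trivial_on k0 (C x v)"
  shows "rich K (C x v)"
proof -
  obtain u where "u \<in> C x v" "k0 u \<noteq> u" using assms(11) by (auto simp: trivial_on_def)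
  thus ?thesis
    using assms H_bij by (intro rich_if_normalized[OF assms(3) C_finite_card[OF assms(4,5)] assms(7) _ assms(6,9,10)]) auto
qed

lemma noncommuting_H:
  assumes "rich K (C x v)" "rich L (C x v)" "K \<subseteq> H" "L \<subseteq> H" "x \<in> V" "v \<in> V"
    "\<And>k. k \<in> K \<Longrightarrow> k ` C x v = C x v" "\<And>l. l \<in> L \<Longrightarrow> l ` C x v = C x v"
  obtains k l where "k \<in> K" "l \<in> L" "\<not> trivial_on (cmt k l) (C x v)"
proof -
  have "card (C x v) \<ge> 4" using C_finite_card(2)[OF assms(5,6)] by linarith
  then obtain k l u where "k \<in> K" "l \<in> L" "u \<in> C x v" "cmt k l u \<noteq> u"
    using rich_noncommuting2[OF assms(1,2) C_finite_card(1)[OF assms(5,6)] _ _ _ assms(7,8)]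
      H_bij assms(3,4) by (metis subsetD)
  thus thesis using that by (auto simp: trivial_on_def)
qed

lemma rich_edge:
  assumes "adj x y" shows "rich (pfix {x, y} H) (C x y)"
  unfolding rich_def
proof (intro allI impI)
  fix \<pi> assume \<pi>: "\<pi> permutes C x y \<and> evenperm \<pi>"
  have c: "C x y = N y - {x}" using C_adj_self[OF assms] .
  have p: "\<pi> permutes N y" using permutes_subset[of \<pi> "C x y" "N y"] \<pi> c by auto
  have "\<pi> x = x" using permutes_not_in[of \<pi> "C x y" x] \<pi> c by auto
  moreover have "x \<in> N y" using assms adj_sym by (simp add: N_def)
  moreover obtain h where "h \<in> H" "h y = y" "\<forall>u\<in>N y. h u = \<pi> u"
    using H_local[OF adj_V(2)[OF assms] p] \<pi> by blast
  ultimately show "\<exists>h\<in>pfix {x, y} H. \<forall>u\<in>C x y. h u = \<pi> u"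
    using c by (intro bexI[of _ h] pfixI) auto
qed

lemma rich_vertex:
  assumes "x \<in> V" shows "rich (pfix {x} H) (C x x)"
  unfolding rich_def C_self[OF assms] using H_local[OF assms] by (fastforce simp: pfix_def)

definition full :: "nat \<Rightarrow> bool" where
  "full r \<longleftrightarrow> (\<forall>x\<in>V. \<forall>u\<in>S x r. rich (Q r x u) (C x u))"

lemma first_step:
  assumes "x \<in> V" "v \<in> S x (Suc s)"
  obtains y where "adj x y" "d y v = s" "d x y = 1"
proof -
  have v: "v \<in> V" "d x v = Suc s" using assms by (auto simp: S_def)
  obtain y where y: "adj x y" "d v y = s" using ex_parent[of v x s] d_sym v assms by auto
  thus thesis using that d_adj d_sym v adj_V by metis
qed

text \<open>At distance one this is the local action at \<open>v\<close>. Further out,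
  \<open>full s\<close> is applied around the first vertex \<open>y\<close> of the geodesic:
  \<open>Q s y v\<close> fixes \<open>x\<close> and \<open>v\<close>, and \<open>v\<close> has the
  same children from \<open>y\<close>.\<close>

lemma rich_two_point:
  assumes "x \<in> V" "v \<in> S x (Suc s)" "s \<ge> 1 \<Longrightarrow> full s"
  shows "rich (pfix {x, v} H) (C x v)"
proof -
  have v: "v \<in> V" "d x v = Suc s" using assms by (auto simp: S_def)
  show ?thesis
  proof (cases "s = 0")
    case True
    thus ?thesis using rich_edge d_1 assms v by simp
  next
    case False
    obtain y where y: "adj x y" "d y v = s" "d x y = 1" using first_step[OF assms(1,2)] .
    have yV: "y \<in> V" using y adj_V by blast
    have c: "C x v = C y v"
    proof (rule C_adjacent_centres[OF y(1) v(1)])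
      show "v \<noteq> x" "v \<noteq> y" using v y False assms(1) yV by auto
    qed
    have "rich (Q s y v) (C y v)" using assms(3) False yV v y by (simp add: full_def S_def)
    moreover have "Q s y v \<subseteq> pfix {x, v} H"
      unfolding Q_def using v y False assms(1) yV d_sym[of x y]
      by (intro pfix_mono) (auto simp: B_def in_C_iff)
    ultimately show ?thesis using rich_mono c by simp
  qed
qed

lemma rich_ball_fixer:
  assumes "x \<in> V" "v \<in> S x r" "rich (pfix {x, v} H) (C x v)" "k \<in> ball_fixer r x" "\<not> trivial_on k (C x v)"
  shows "rich (ball_fixer r x) (C x v)"
proof (rule rich_H[OF _ _ ball_fixer_group assms(1) _ assms(3) _ _ _ assms(4,5)])
  show "l \<circ> k \<circ> inv' l \<in> ball_fixer r x" if "l \<in> pfix {x, v} H" "k \<in> ball_fixer r x" for l k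
    using ball_fixer_conj[of l k r x] that assms(1) by (simp add: pfix_def)
  show "k ` C x v = C x v" if "k \<in> ball_fixer r x" for k
    using ball_fixer_C[OF that] assms(1,2) by (simp add: S_def)
qed (use assms(1,2) H_fix_C in \<open>auto simp: S_def pfix_def ball_fixer_def\<close>)

text \<open>The other sets of children are killed one at a time. A commutator of an element trivial
  over \<open>A\<close> with one trivial over \<open>b\<close> is trivial over both; richness of the
  two groups on \<open>C x v\<close> lets one survive there, and normality turns it into richness
  again.\<close>

lemma full_if_unlinked:
  assumes x: "x \<in> V" and v: "v \<in> S x r" and rich: "rich (ball_fixer r x) (C x v)"
    and unl: "\<And>v'. v' \<in> S x r \<Longrightarrow> v' \<noteq> v \<Longrightarrow> \<exists>h\<in>ball_fixer r x. trivial_on h (C x v') \<and> \<not> trivial_on h (C x v)"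
  shows "rich (Q r x v) (C x v)"
proof -
  have vV: "v \<in> V" "d x v = r" using v by (auto simp: S_def)
  define K where "K A = pfix (B x r \<union> (\<Union>a\<in>A. C x a)) H" for A
  have KFx: "K A \<subseteq> ball_fixer r x" for A unfolding K_def ball_fixer_def by (intro pfix_mono) auto
  have KC: "k ` C x a = C x a" if "k \<in> ball_fixer r x" "a \<in> S x r" for k a
    using ball_fixer_C[OF that(1) x] that(2) by (auto simp: S_def)
  have FxH: "ball_fixer r x \<subseteq> H" using ball_fixer_D(1) by blast
  have KH: "K A \<subseteq> H" for A using KFx FxH by blast
  have Kv: "k ` C x v = C x v" if "k \<in> K A" for k A using that KFx KC v by blast
  have Kgrp: "perm_group (K A)" for A using pfix_group by (simp add: K_def)
  have normal: "l \<circ> k \<circ> inv' l \<in> K A" if "l \<in> ball_fixer r x" "k \<in> K A" "A \<subseteq> S x r" for l k A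
  proof -
    have "l ` B x r = B x r"
      using aut_image_B[OF H_aut[OF ball_fixer_D(1)[OF that(1)]] x] ball_fixer_D(2)[OF that(1) x] x by simp
    moreover have "l ` (\<Union>a\<in>A. C x a) = (\<Union>a\<in>A. C x a)"
      using KC[OF that(1)] that(3) by (simp add: image_UN subset_iff)
    ultimately have "l ` (B x r \<union> (\<Union>a\<in>A. C x a)) = B x r \<union> (\<Union>a\<in>A. C x a)" by (simp add: image_Un)
    thus ?thesis using pfix_conj[OF H_group] that ball_fixer_D(1) unfolding K_def by metis
  qed
  have "rich (K A) (C x v)" if "finite A" "A \<subseteq> S x r - {v}" for A
    using that
  proof (induction rule: finite_induct)
    case empty
    thus ?case using rich by (simp add: K_def ball_fixer_def)
  next
    case (insert b A)
    have r1: "rich (K A) (C x v)" using insert by auto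
    obtain h where h: "h \<in> ball_fixer r x" "trivial_on h (C x b)" "\<not> trivial_on h (C x v)" using unl[of b] insert.prems by auto
    have mem_b: "h \<in> K {b}" using h by (auto simp: K_def ball_fixer_def pfix_def trivial_on_def)
    have r2: "rich (K {b}) (C x v)"
      using insert.prems
      by (intro rich_H[OF KH FxH Kgrp x vV(1) rich Kv KC[OF _ v] normal mem_b h(3)]) auto
    obtain k l where kl: "k \<in> K A" "l \<in> K {b}" "\<not> trivial_on (cmt k l) (C x v)"
      by (rule noncommuting_H[OF r1 r2 _ _ x vV(1)]) (use KFx KC v ball_fixer_D(1) in blast)+
    have kH: "bij k" "bij l" using kl KFx ball_fixer_D(1) H_bij by blast+
    have "cmt k l \<in> ball_fixer r x" using kl KFx by (intro perm_group_cmt[OF ball_fixer_group]) auto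
    moreover have "cmt k l u = u" if "a \<in> A" "u \<in> C x a" for a u
    proof (rule cmt_fix[OF kH _ _ that(2)])
      show "l ` C x a = C x a" using kl(2) KFx that(1) insert.prems by (intro KC) auto
      show "k w = w" if "w \<in> C x a" for w using kl(1) that \<open>a \<in> A\<close> by (auto simp: K_def pfix_def)
    qed
    moreover have "cmt k l u = u" if "u \<in> C x b" for u
    proof (rule cmt_fix'[OF kH _ _ that])
      show "k ` C x b = C x b" using kl(1) KFx insert.prems by (intro KC) auto
      show "l w = w" if "w \<in> C x b" for w using kl(2) that by (auto simp: K_def pfix_def)
    qed
    ultimately have mem: "cmt k l \<in> K (insert b A)"
      by (auto simp: K_def ball_fixer_def pfix_def)
    show ?case
      using insert.prems
      by (intro rich_H[OF KH FxH Kgrp x vV(1) rich Kv KC[OF _ v] normal mem kl(3)]) auto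
  qed
  from this[of "S x r - {v}"] have "rich (K (S x r - {v})) (C x v)" using S_finite[OF x] by simp
  moreover have "B x (Suc r) - C x v \<subseteq> B x r \<union> (\<Union>a\<in>S x r - {v}. C x a)"
    using ball_boundary[OF x] by blast
  hence "K (S x r - {v}) \<subseteq> Q r x v" unfolding K_def Q_def by (rule pfix_mono)
  ultimately show ?thesis using rich_mono by blast
qed

subsection \<open>Spheres of radius one\<close>

lemma N_insert: "adj x y \<Longrightarrow> N y = insert x (C x y)"
  using C_adj_self adj_sym by (auto simp: N_def)

lemma ball_fixer_1_iff: "x \<in> V \<Longrightarrow> h \<in> ball_fixer 1 x \<longleftrightarrow> h \<in> H \<and> h x = x \<and> trivial_on h (N x)"
proof -
  assume x: "x \<in> V"
  have "B x 1 = insert x (N x)"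
  proof (intro equalityI subsetI)
    fix v assume v: "v \<in> B x 1"
    hence "d x v = 0 \<or> d x v = 1" "v \<in> V" by (auto simp: B_def)
    thus "v \<in> insert x (N x)" using d_1[OF x] d_zero_iff[OF x] by (auto simp: N_def)
  qed (use x d_adj adj_V in \<open>auto simp: B_def N_def\<close>)
  thus ?thesis by (auto simp: ball_fixer_def pfix_def trivial_on_def)
qed

text \<open>One inclusion is immediate. If \<open>ball_fixer 1 y\<close> acted nontrivially on
  \<open>C y x\<close>, it would be rich there and could cancel on \<open>C y x\<close> a commutator
  \<open>c\<close> that is visible on \<open>C x y\<close>. The corrected element lies in
  \<open>ball_fixer 1 x\<close>, so it is trivial on \<open>C x y\<close>; but there the correction
  changes nothing.\<close>

lemma ball_fixer_1_equal:
  assumes "adj x y" and trivial_on: "\<And>k. k \<in> ball_fixer 1 x \<Longrightarrow> trivial_on k (C x y)"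
  shows "ball_fixer 1 x = ball_fixer 1 y"
proof
  have V: "x \<in> V" "y \<in> V" using assms adj_V by auto
  have yx: "adj y x" using assms adj_sym by blast
  show "ball_fixer 1 x \<subseteq> ball_fixer 1 y"
  proof (rule subsetI)
    fix k assume k: "k \<in> ball_fixer 1 x"
    hence "k x = x" "k y = y" "k \<in> H" using ball_fixer_1_iff[OF V(1)] assms(1) by (auto simp: trivial_on_def N_def)
    thus "k \<in> ball_fixer 1 y" using trivial_on[OF k] N_insert[OF assms(1)] unfolding ball_fixer_1_iff[OF V(2)] by (simp add: trivial_on_def)
  qed
  have L: "l ` C y x = C y x" "l ` C x y = C x y" "l \<in> H" "l x = x" "l y = y" if "l \<in> pfix {x, y} H" for l
    using that H_fix_C[of l] V by (auto simp: pfix_def)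
  have sub: "ball_fixer 1 y \<subseteq> pfix {x, y} H"
    using V d_adj[OF yx] by (auto simp: ball_fixer_def B_def pfix_def)
  have subH: "pfix {x, y} H \<subseteq> H" by (auto simp: pfix_def)
  have "trivial_on k (C y x)" if k: "k \<in> ball_fixer 1 y" for k
  proof (rule ccontr)
    assume nt: "\<not> trivial_on k (C y x)"
    have richR: "rich (ball_fixer 1 y) (C y x)"
    proof (rule rich_H[OF _ subH ball_fixer_group V(2,1) _ _ _ _ k nt])
      show "rich (pfix {x, y} H) (C y x)" using rich_edge[OF yx] by (simp add: insert_commute)
      show "l \<circ> k \<circ> inv' l \<in> ball_fixer 1 y" if "l \<in> pfix {x, y} H" "k \<in> ball_fixer 1 y" for l k
        using ball_fixer_conj[of l k 1 y] L(3,5)[OF that(1)] that(2) V by simp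
      show "k ` C y x = C y x" if "k \<in> ball_fixer 1 y" for k using L(1) sub that by blast
      show "ball_fixer 1 y \<subseteq> H" using sub subH by blast
    qed (rule L(1))
    obtain a b where ab: "a \<in> pfix {x, y} H" "b \<in> pfix {x, y} H" "\<not> trivial_on (cmt a b) (C x y)"
      by (rule noncommuting_H[OF rich_edge[OF assms(1)] rich_edge[OF assms(1)] subH subH V]) (use L in blast)+
    have bij: "bij a" "bij b" using ab L(3) H_bij by auto
    define c where "c = cmt a b"
    have cP: "c \<in> pfix {x, y} H" using perm_group_cmt[OF pfix_group ab(1,2)] by (simp add: c_def)
    obtain \<rho> where \<rho>: "\<rho> \<in> ball_fixer 1 y" "\<And>u. u \<in> C y x \<Longrightarrow> \<rho> u = restrict_id c (C y x) u"
      using richD[OF richR even_cmt[OF C_finite_card(1)[OF V(2,1)] bij]] L ab unfolding c_def by metis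
    define f where "f = inv' \<rho> \<circ> c"
    have \<rho>H: "\<rho> \<in> H" "\<rho> x = x" "\<rho> y = y" using \<rho>(1) L sub by auto
    have f1: "f \<in> ball_fixer 1 x"
    proof -
      have "f u = u" if "u \<in> N x" for u
      proof (cases "u = y")
        case True
        thus ?thesis using L(5)[OF cP] bij_inv_eqI[OF H_bij[OF \<rho>H(1)] \<rho>H(3)] by (simp add: f_def)
      next
        case False
        hence "u \<in> C y x" using that N_insert[OF yx] by auto
        thus ?thesis using bij_inv_eqI[OF H_bij[OF \<rho>H(1)] \<rho>(2), of u] by (simp add: f_def)
      qed
      moreover have "f x = x" using L(4)[OF cP] bij_inv_eqI[OF H_bij[OF \<rho>H(1)] \<rho>H(2)] by (simp add: f_def)
      moreover have "f \<in> H" using H_comp[OF H_inv[OF \<rho>H(1)] L(3)[OF cP]] by (simp add: f_def)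
      ultimately show ?thesis unfolding ball_fixer_1_iff[OF V(1)] by (simp add: trivial_on_def)
    qed
    have "c u = u" if u: "u \<in> C x y" for u
    proof -
      have "\<rho> u = u" using \<rho>(1) u ball_fixer_1_iff[OF V(2)] N_insert[OF assms(1)] by (simp add: trivial_on_def)
      moreover have "inv' \<rho> (c u) = u" using trivial_on[OF f1] u by (simp add: f_def trivial_on_def)
      ultimately show ?thesis using H_inv_inv(2)[OF \<rho>H(1), of "c u"] by simp
    qed
    thus False using ab(3) by (auto simp: trivial_on_def c_def)
  qed
  note tr = this
  show "ball_fixer 1 y \<subseteq> ball_fixer 1 x"
  proof (rule subsetI)
    fix k assume k: "k \<in> ball_fixer 1 y"
    hence kP: "k \<in> pfix {x, y} H" using sub by blast
    have "trivial_on k (N x)" using tr[OF k] L(5)[OF kP] N_insert[OF yx] by (simp add: trivial_on_def)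
    thus "k \<in> ball_fixer 1 x" using L(3,4)[OF kP] ball_fixer_1_iff[OF V(1)] by blast
  qed
qed

text \<open>Fixing a child of \<open>v\<close> forces fixing \<open>v\<close>; homogeneity moves
  that child to a sibling while fixing \<open>x\<close> and \<open>v\<close>, so the inclusion is
  strict.\<close>

lemma stabilizers_decrease:
  assumes "x \<in> V" "v \<in> V"
  obtains u where "u \<in> V" "pfix {x, u} H \<subset> pfix {x, v} H"
proof -
  obtain u where u: "u \<in> C x v" using C_ne[OF assms, of "[]"] by auto
  obtain u' where u': "u' \<in> C x v" "u' \<noteq> u" using C_ne[OF assms, of "[u]"] by auto
  have d1: "d v u = 1" "d v u' = 1" "d x u = Suc (d x v)" "d x u' = Suc (d x v)" "u \<in> V" "u' \<in> V"
    using u u' d_adj C_V[OF u] C_V[OF u'(1)] by (auto simp: in_C_iff)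
  obtain h where h: "h \<in> H" "h v = v" "h x = x" "h u = u'"
    using homogeneous_through[OF assms(2,1) d1(5,6)] d1 by auto
  have "pfix {x, u} H \<subseteq> pfix {x, v} H"
    using fix_parent[OF H_aut assms(1) _ u] u by (auto simp: pfix_def)
  moreover have "h \<in> pfix {x, v} H - pfix {x, u} H" using h u' by (auto simp: pfix_def)
  ultimately show thesis using that d1(5) by blast
qed

text \<open>If \<open>ball_fixer 1 x\<close> acted trivially on the sphere of radius two around every vertex \<open>x\<close> of one type,
  then \<open>ball_fixer 1 x\<close> would be the same group for all vertices \<open>x\<close>, hence trivial, and vertex
  stabilizers would be finite; but the stabilizers of longer and longer geodesics
  decrease strictly.\<close>

lemma ball_fixer_1_nontrivial:
  assumes "adj x0 y0"
  shows "\<exists>k\<in>ball_fixer 1 x0. \<not> trivial_on k (C x0 y0)"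
proof (rule ccontr)
  assume "\<not> ?thesis"
  hence triv0: "trivial_on k (C x0 y0)" if "k \<in> ball_fixer 1 x0" for k using that by blast
  have V0: "x0 \<in> V" "y0 \<in> V" using assms adj_V by auto
  have eq0: "ball_fixer 1 x = ball_fixer 1 y" if xy: "adj x y" "ty x = ty x0" for x y
  proof (rule ball_fixer_1_equal[OF xy(1)])
    fix k assume k: "k \<in> ball_fixer 1 x"
    have V: "x \<in> V" "y \<in> V" using xy adj_V by auto
    obtain h where h: "h \<in> H" "h x = x0" "h y = y0"
      using homogeneous[OF V V0 xy(2)] d_adj xy(1) assms by metis
    have "h \<circ> k \<circ> inv' h \<in> ball_fixer 1 x0" using ball_fixer_conj[OF h(1) k V(1)] h(2) by simp
    hence t: "trivial_on (h \<circ> k \<circ> inv' h) (C x0 y0)" by (rule triv0)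
    have "k u = u" if "u \<in> C x y" for u
    proof -
      have "h u \<in> C x0 y0" using that aut_C[OF H_aut[OF h(1)] V] h by auto
      hence "(h \<circ> k \<circ> inv' h) (h u) = h u" using t unfolding trivial_on_def by blast
      hence "h (k u) = h u" using h(1) by simp
      thus ?thesis using H_aut[OF h(1)] by simp
    qed
    thus "trivial_on k (C x y)" by (simp add: trivial_on_def)
  qed
  have eq: "ball_fixer 1 x = ball_fixer 1 y" if "adj x y" for x y
    using eq0[of x y] eq0[of y x] that adj_sym[of x y] adj_ty[OF that] by blast
  have "ball_fixer 1 x0 = ball_fixer 1 v" if "v \<in> V" "d x0 v = n" for v n
    using that
  proof (induction n arbitrary: v)
    case 0
    thus ?case using d_zero_iff[OF V0(1)] by simp
  next
    case (Suc n)
    obtain p where "adj v p" "d x0 p = n" using ex_parent[OF V0(1) Suc.prems] .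
    thus ?case using Suc.IH eq adj_V by metis
  qed
  hence fixall: "k v = v" if "k \<in> ball_fixer 1 x0" "v \<in> V" for k v
    using ball_fixer_1_iff[OF that(2)] that by blast
  \<comment> \<open>All of \<open>ball_fixer 1 x0\<close> is now trivial, so the stabilizer of
    \<open>x0\<close> embeds into the permutations of \<open>N x0\<close> and is finite. A two-point
    stabilizer of least order then contradicts the strict decrease.\<close>
  define res where "res = (\<lambda>h. restrict_id h (N x0) :: 'a \<Rightarrow> 'a)"
  have "inj_on res (pfix {x0} H)"
  proof (rule inj_onI)
    fix g h assume gh: "g \<in> pfix {x0} H" "h \<in> pfix {x0} H" "res g = res h"
    have H': "g \<in> H" "h \<in> H" "g x0 = x0" "h x0 = x0" using gh by (auto simp: pfix_def)
    have "g u = h u" if "u \<in> N x0" for u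
      using fun_cong[OF gh(3), of u] that by (simp add: res_def)
    hence "inv' h \<circ> g \<in> ball_fixer 1 x0"
      using H' H_comp[OF H_inv] bij_inv_eqI[OF H_bij[OF H'(2)] H'(4)]
      unfolding ball_fixer_1_iff[OF V0(1)] by (auto simp: trivial_on_def)
    hence "inv' h (g v) = v" if "v \<in> V" for v using fixall that by fastforce
    hence "g v = h v" if "v \<in> V" for v using that H_inv_inv(2)[OF H'(2), of "g v"] by simp
    moreover have "g v = h v" if "v \<notin> V" for v using that aut_outside[OF H_aut[OF H'(1)]] aut_outside[OF H_aut[OF H'(2)]] by simp
    ultimately show "g = h" by blast
  qed
  moreover have "res ` pfix {x0} H \<subseteq> {p. p permutes N x0}"
  proof
    fix p assume "p \<in> res ` pfix {x0} H"
    then obtain h where h: "h \<in> H" "h x0 = x0" "p = res h" by (auto simp: pfix_def)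
    have "h ` N x0 = N x0" using aut_N[OF H_aut[OF h(1)], of x0] h(2) by simp
    hence "p permutes N x0" unfolding h(3) res_def using H_bij[OF h(1)]
      by (intro permutes_restrict_id bij_betw_imageI) (auto intro: inj_on_subset simp: bij_def)
    thus "p \<in> {p. p permutes N x0}" by simp
  qed
  ultimately have "finite (pfix {x0} H)"
    using inj_on_finite finite_permutations N_finite_card(1)[OF V0(1)] by blast
  moreover have "pfix {x0, v} H \<subseteq> pfix {x0} H" for v by (auto simp: pfix_def)
  ultimately have fin: "finite (pfix {x0, v} H)" for v using finite_subset by blast
  obtain v where v: "v \<in> V" "\<And>u. u \<in> V \<Longrightarrow> card (pfix {x0, v} H) \<le> card (pfix {x0, u} H)"
    using ex_has_least_nat[of "\<lambda>v. v \<in> V" x0 "\<lambda>v. card (pfix {x0, v} H)"] V0(1) by blast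
  obtain u where "u \<in> V" "pfix {x0, u} H \<subset> pfix {x0, v} H" using stabilizers_decrease[OF V0(1) v(1)] .
  thus False using psubset_card_mono[OF fin] v(2) by (meson leD)
qed

lemma rich_ball_fixer_1:
  assumes "adj x y" shows "rich (ball_fixer 1 x) (C x y)"
proof -
  have V: "x \<in> V" "y \<in> V" "y \<in> S x 1" using assms adj_V d_adj by (auto simp: S_def)
  obtain k where "k \<in> ball_fixer 1 x" "\<not> trivial_on k (C x y)" using ball_fixer_1_nontrivial[OF assms] by blast
  thus ?thesis using rich_ball_fixer[OF V(1,3) rich_edge[OF assms]] by blast
qed

text \<open>The implication in the hypotheses is a link from \<open>v'\<close> to \<open>v\<close>;
  conjugation by an element fixing \<open>x\<close> transports links.\<close>

lemma link_conj:
  assumes "h \<in> H" "x \<in> V" "h x = x" "v \<in> V" "v' \<in> V"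
    and "\<And>k. k \<in> ball_fixer r x \<Longrightarrow> trivial_on k (C x v') \<Longrightarrow> trivial_on k (C x v)"
    and "k \<in> ball_fixer r x" "trivial_on k (C x (h v'))"
  shows "trivial_on k (C x (h v))"
proof -
  have im: "h ` C x w = C x (h w)" if "w \<in> V" for w
    using aut_C[OF H_aut[OF assms(1)] assms(2) that] assms(3) by simp
  define l where "l = inv' h \<circ> k \<circ> inv' (inv' h)"
  have ih: "inv' h x = x" using bij_inv_eqI[OF H_bij[OF assms(1)] assms(3)] .
  have l: "l \<in> ball_fixer r x" unfolding l_def using ball_fixer_conj[OF H_inv[OF assms(1)] assms(7,2)] ih by simp
  have lu: "l u = inv' h (k (h u))" for u using H_bij[OF assms(1)] by (simp add: l_def inv_inv_eq)
  have "k (h u) = h u" if "u \<in> C x v'" for u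
    using assms(8) im[OF assms(5)] that unfolding trivial_on_def by blast
  hence "trivial_on l (C x v')" using assms(1) by (simp add: trivial_on_def lu)
  hence t: "trivial_on l (C x v)" using assms(6)[OF l] by blast
  show ?thesis unfolding trivial_on_def im[OF assms(4), symmetric]
  proof
    fix w assume "w \<in> h ` C x v"
    then obtain u where u: "u \<in> C x v" "w = h u" by blast
    have "inv' h (k (h u)) = u" using t u by (simp add: trivial_on_def lu)
    thus "k w = w" using H_inv_inv(2)[OF assms(1), of "k (h u)"] u by simp
  qed
qed

text \<open>If two local actions of \<open>ball_fixer 1 x\<close> were linked, all of them would be. Then the elements
  that commute with \<open>ball_fixer 1 x\<close> on the sphere of radius two form a normal subgroup of the stabilizer
  of \<open>x\<close>. If it is rich on the neighbours of \<open>x\<close>, it identifies the sets \<open>C x y\<close> with one another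
  equivariantly, contradicting homogeneity; if it is trivial there, then commutators on
  \<open>C y x\<close> can be corrected by \<open>ball_fixer 1 x\<close> to give a contradiction.\<close>

lemma unlinked_1:
  assumes xy: "adj x y" "adj x y'" "y \<noteq> y'"
  shows "\<exists>h\<in>ball_fixer 1 x. trivial_on h (C x y') \<and> \<not> trivial_on h (C x y)"
proof (rule ccontr)
  assume "\<not> ?thesis"
  hence link0: "trivial_on k (C x y)" if "k \<in> ball_fixer 1 x" "trivial_on k (C x y')" for k using that by blast
  have V: "x \<in> V" "y \<in> V" "y' \<in> V" using xy adj_V by auto
  have dN: "d x z = 1" "d z x = 1" "z \<in> V" if "z \<in> N x" for z
    using that d_adj adj_V(2) adj_sym by (auto simp: N_def)
  have d2: "d z z' = 1 + 1" if "z \<in> N x" "z' \<in> N x" "z \<noteq> z'" for z z'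
  proof -
    have "d z z' \<le> 2" using d_triangle[OF dN(3)[OF that(1)] V(1) dN(3)[OF that(2)]] dN that by simp
    moreover have "even (d z z')"
      using d_parity[OF dN(3)[OF that(1)] dN(3)[OF that(2)]] adj_ty that by (auto simp: N_def)
    moreover have "d z z' \<noteq> 0" using that dN d_zero_iff by simp
    ultimately show ?thesis by presburger
  qed
  have yN: "y \<in> N x" "y' \<in> N x" using xy by (auto simp: N_def)
  have link: "trivial_on k (C x z)" if k: "k \<in> ball_fixer 1 x" "trivial_on k (C x z')" and z: "z \<in> N x" "z' \<in> N x" for k z z'
  proof (cases "z = z'")
    case False
    have ty: "ty y = ty z" using adj_ty[OF xy(1)] adj_ty[of x z] z by (simp add: N_def)
    have "d y y' = d z z'" using d2[OF yN xy(3)] d2[OF z False] by simp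
    then obtain h where h: "h \<in> H" "h y = z" "h y' = z'"
      using homogeneous[OF V(2,3) dN(3)[OF z(1)] dN(3)[OF z(2)] ty] by blast
    have "d z (h x) = 1" "d (h x) z' = 1"
      using H_d[OF h(1) V(2,1)] H_d[OF h(1) V(1,3)] dN(1)[OF yN(2)] dN(2)[OF yN(1)] unfolding h(2,3) by simp_all
    moreover have "h x \<in> V" using h(1) V(1) by simp
    ultimately have "h x = x"
      using between_unique[OF dN(3)[OF z(1)] dN(3)[OF z(2)] _ V(1) d2[OF z False]] dN(2)[OF z(1)] dN(1)[OF z(2)] by blast
    thus ?thesis using link_conj[OF h(1) V(1) _ V(2,3) link0 k(1)] h k(2) by simp
  qed (use k in simp)
  define M where "M = {g \<in> pfix {x} H. \<forall>h\<in>ball_fixer 1 x. \<forall>z\<in>N x. \<forall>u\<in>C x z. g (h u) = h (g u)}"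
  have MH: "M \<subseteq> pfix {x} H" by (auto simp: M_def)
  have P: "g \<in> H" "g x = x" "inv' g x = x" "bij g" if "g \<in> pfix {x} H" for g
    using that bij_inv_eqI[OF H_bij] H_bij by (auto simp: pfix_def)
  have move: "g u \<in> C x (g z)" "g z \<in> N x" if "g \<in> pfix {x} H" "u \<in> C x z" "z \<in> N x" for g u z
    using aut_C[OF H_aut[OF P(1)[OF that(1)]] V(1) dN(3)[OF that(3)]]
      aut_N[OF H_aut[OF P(1)[OF that(1)]], of x] P(2)[OF that(1)] that by auto
  have mD: "g (h u) = h (g u)" if "g \<in> M" "h \<in> ball_fixer 1 x" "z \<in> N x" "u \<in> C x z" for g h z u
    using that by (auto simp: M_def)
  have Mgrp: "perm_group M"
  proof (rule perm_groupI)
    show "id \<in> M" using H_id by (simp add: M_def pfix_def)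
    show "bij g" if "g \<in> M" for g using that MH P by blast
    show "g \<circ> g' \<in> M" if "g \<in> M" "g' \<in> M" for g g'
    proof -
      have "(g \<circ> g') (h u) = h ((g \<circ> g') u)" if "h \<in> ball_fixer 1 x" "z \<in> N x" "u \<in> C x z" for h z u
        using mD[OF \<open>g' \<in> M\<close> that] mD[OF \<open>g \<in> M\<close> that(1)] move[of g' u z] \<open>g' \<in> M\<close> MH that by auto
      thus ?thesis using perm_groupD(4)[OF pfix_group] that MH unfolding M_def by blast
    qed
    show "inv' g \<in> M" if g: "g \<in> M" for g
    proof -
      have gP: "g \<in> pfix {x} H" "inv' g \<in> pfix {x} H" using g MH perm_groupD(3)[OF pfix_group] by auto
      have "inv' g (h u) = h (inv' g u)" if "h \<in> ball_fixer 1 x" "z \<in> N x" "u \<in> C x z" for h z u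
      proof -
        have "g (h (inv' g u)) = h (g (inv' g u))"
          using mD[OF g that(1)] move[OF gP(2) that(3,2)] by blast
        thus ?thesis using bij_inv_eqI[OF P(4)[OF gP(1)], of "h (inv' g u)"] P(1)[OF gP(1)] by simp
      qed
      thus ?thesis using gP(2) unfolding M_def by blast
    qed
  qed
  have Mnormal: "l \<circ> g \<circ> inv' l \<in> M" if l: "l \<in> pfix {x} H" and g: "g \<in> M" for l g
  proof -
    have lP: "inv' l \<in> pfix {x} H" using perm_groupD(3)[OF pfix_group l] .
    have lgP: "l \<circ> g \<circ> inv' l \<in> pfix {x} H"
      using perm_groupD(4)[OF pfix_group perm_groupD(4)[OF pfix_group l] lP] g MH by blast
    have "(l \<circ> g \<circ> inv' l) (h u) = h ((l \<circ> g \<circ> inv' l) u)" if h: "h \<in> ball_fixer 1 x" "z \<in> N x" "u \<in> C x z" for h z u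
    proof -
      define h' where "h' = inv' l \<circ> h \<circ> inv' (inv' l)"
      have "h' \<in> ball_fixer 1 x" unfolding h'_def
        using ball_fixer_conj[OF H_inv[OF P(1)[OF l]] h(1) V(1)] P(3)[OF l] by simp
      hence "g (h' (inv' l u)) = h' (g (inv' l u))" using mD[OF g] move[OF lP h(3,2)] by blast
      thus ?thesis using P(1)[OF l] P(4)[OF l] by (simp add: h'_def inv_inv_eq)
    qed
    thus ?thesis using lgP unfolding M_def by blast
  qed
  \<comment> \<open>The commutator of \<open>g\<close> with an element of
    \<open>ball_fixer 1 x\<close> lies in that group again. Being trivial over one neighbour
    \<open>z\<close>, it is trivial over all by the links, so commuting needs to be checked over a
    single fixed neighbour.\<close>
  have inM: "g \<in> M" if g: "g \<in> pfix {x} H" and gz: "g z = z" "z \<in> N x"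
    and comm: "\<And>h u. h \<in> ball_fixer 1 x \<Longrightarrow> u \<in> C x z \<Longrightarrow> g (h u) = h (g u)" for g z
  proof -
    have "g (h u) = h (g u)" if h: "h \<in> ball_fixer 1 x" and u: "z' \<in> N x" "u \<in> C x z'" for h z' u
    proof -
      have c: "cmt g h \<in> ball_fixer 1 x"
        using cmt_normal[OF ball_fixer_group h] ball_fixer_conj[OF P(1)[OF g] h V(1)] P(2)[OF g] by simp
      have ig: "inv' g (inv' h w) \<in> C x z" if "w \<in> C x z" for w
      proof -
        have "inv' g \<in> pfix {x} H" "inv' g z = z" "inv' h \<in> ball_fixer 1 x"
          using perm_groupD(3)[OF pfix_group g] bij_inv_eqI[OF P(4)[OF g] gz(1)] perm_groupD(3)[OF ball_fixer_group h] by auto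
        thus ?thesis using ball_fixer_C[of "inv' h" 1 x z] move(1)[of "inv' g" "inv' h w" z] dN[OF gz(2)] V(1) gz(2) that by auto
      qed
      have "trivial_on (cmt g h) (C x z)"
        unfolding trivial_on_def
      proof
        fix w assume w: "w \<in> C x z"
        have "g (h (inv' g (inv' h w))) = h (g (inv' g (inv' h w)))" by (rule comm[OF h ig[OF w]])
        thus "cmt g h w = w" using P(1)[OF g] ball_fixer_D(1)[OF h] by simp
      qed
      hence t: "trivial_on (cmt g h) (C x z')" if "z' \<in> N x" for z' using link[OF c _ that gz(2)] by blast
      have "g u \<in> C x (g z')" "g z' \<in> N x" using move[OF g u(2,1)] by auto
      moreover have "d x (g z') \<le> 1" using dN(1)[OF calculation(2)] by simp
      ultimately have "h (g u) \<in> C x (g z')" using ball_fixer_C[OF h V(1) dN(3)] by blast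
      hence "cmt g h (h (g u)) = h (g u)" using t[OF move(2)[OF g u(2,1)]] unfolding trivial_on_def by blast
      thus ?thesis using P(1)[OF g] ball_fixer_D(1)[OF h] by simp
    qed
    thus ?thesis using g unfolding M_def by blast
  qed
  have XN: "C x x = N x" using C_self[OF V(1)] .
  have MN: "g ` C x x = C x x" if "g \<in> pfix {x} H" for g
    using H_fix_C[OF P(1)[OF that] V(1,1)] P(2)[OF that] by simp
  show False
  proof (cases "\<exists>m\<in>M. \<not> trivial_on m (C x x)")
    case True
    then obtain m0 where m0: "m0 \<in> M" "\<not> trivial_on m0 (C x x)" by blast
    have PH: "pfix {x} H \<subseteq> H" using P(1) by blast
    have "rich M (C x x)"
      by (rule rich_H[OF _ PH Mgrp V(1,1) rich_vertex[OF V(1)] _ MN Mnormal m0]) (use MH PH MN in blast)+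
    moreover obtain e where e: "e \<in> N x" "e \<notin> {y, y'}"
      using obtain_not_in[of "[y, y']" "N x"] N_finite_card(3)[OF V(1)] by auto
    ultimately obtain n where n: "n \<in> M" "n y = y'"
      using richD[of M "C x x" "cyc3 y y' e"] cyc3_permutes[OF yN e(1)] evenperm_cyc3[OF xy(3), of e] yN xy(3)
      unfolding XN by (metis cyc3_apply insertI1 insertI2)
    have nP: "n \<in> pfix {x} H" using n MH by blast
    obtain w where w: "w \<in> C x y" using C_ne[OF V(1,2), of "[]"] by auto
    define w' where "w' = n w"
    have w': "w' \<in> C x y'" using move(1)[OF nP w yN(1)] n by (simp add: w'_def)
    obtain w'' where w'': "w'' \<in> C x y'" "w'' \<noteq> w'" using C_ne[OF V(1,3), of "[w']"] by auto
    have far: "d w u = d w x + d x u" if "u \<in> C x y'" for u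
    proof (rule d_through_edge[OF xy(1)])
      have a: "adj y w" "d x w = 2" using w dN(1)[OF yN(1)] by (auto simp: in_C_iff)
      thus "w \<in> V" "d x w = Suc (d y w)" using adj_V d_adj[OF a(1)] by auto
      show "u \<in> V" using C_V that by blast
      have "C x y' = C y y'"
      proof (rule C_adjacent_centres[OF xy(1) V(3)])
        show "y' \<noteq> x" "y' \<noteq> y" using xy adj_neq by auto
      qed
      hence "u \<in> C y y'" using that by simp
      thus "d y u = Suc (d x u)" using that d2[OF yN xy(3)] dN(1)[OF yN(2)] by (simp add: in_C_iff)
    qed
    have dd: "d x w' = d x w''" using w' w'' by (simp add: in_C_iff)
    obtain g where g: "g \<in> H" "g x = x" "g w = w" "g w' = w''"
      using homogeneous_through[OF V(1) _ _ _ far[OF w'] far[OF w''(1)] dd] C_V w w' w'' by blast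
    have gP: "g \<in> pfix {x} H" using g by (simp add: pfix_def)
    have gy: "g y = y" using fix_parent[OF H_aut[OF g(1)] V(1) g(2) w] g(3) w by simp
    have gy': "g y' = y'" using fix_parent[OF H_aut[OF g(1)] V(1) g(2) w'] g(4) w'' by simp
    \<comment> \<open>\<open>g\<close> fixes \<open>w\<close> but moves \<open>n w\<close>, so
      \<open>n\<close> and its conjugate by \<open>g\<close> differ at \<open>w\<close>. Their
      quotient \<open>m\<close> fixes \<open>y\<close>, moves \<open>w\<close> and still commutes
      with \<open>ball_fixer 1 x\<close>, which is impossible as that group is rich on
      \<open>C x y\<close>.\<close>
    define m where "m = inv' n \<circ> (g \<circ> n \<circ> inv' g)"
    have mM: "m \<in> M" unfolding m_def using perm_groupD(4)[OF Mgrp perm_groupD(3)[OF Mgrp n(1)] Mnormal[OF gP n(1)]] .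
    have my: "m y = y"
      using bij_inv_eqI[OF P(4)[OF gP] gy] n gy' bij_inv_eqI[OF P(4)[OF nP] n(2)] by (simp add: m_def)
    have mw: "m w \<noteq> w"
    proof
      assume "m w = w"
      hence "inv' n (g (n w)) = w" using bij_inv_eqI[OF P(4)[OF gP] g(3)] by (simp add: m_def)
      hence "g (n w) = n w" using P(1)[OF nP] by (metis H_inv_inv(2))
      thus False using g(4) w'' by (simp add: w'_def)
    qed
    have mP: "m \<in> pfix {x} H" using mM MH by blast
    have "m w \<in> C x y" using move(1)[OF mP w yN(1)] my by simp
    moreover have "card (C x y) \<ge> 4" using C_finite_card(2)[OF V(1,2)] by linarith
    ultimately obtain h where "h \<in> ball_fixer 1 x" "m (h w) \<noteq> h (m w)"
      using rich_noncommuting[where k = m and a = w, OF rich_ball_fixer_1[OF xy(1)] C_finite_card(1)[OF V(1,2)]]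
        w mw bij_is_inj[OF P(4)[OF mP]] by blast
    thus False using mD[OF mM _ yN(1) w] by blast
  next
    case False
    have yx: "adj y x" using xy(1) adj_sym by blast
    have subH: "pfix {x, y} H \<subseteq> H" by (auto simp: pfix_def)
    have L: "l ` C y x = C y x" "l ` C x y = C x y" "l \<in> H" "l x = x" "l y = y" if "l \<in> pfix {x, y} H" for l
      using that H_fix_C[of l] V by (auto simp: pfix_def)
    have re: "rich (pfix {x, y} H) (C y x)" using rich_edge[OF yx] by (simp add: insert_commute)
    obtain a b where ab: "a \<in> pfix {x, y} H" "b \<in> pfix {x, y} H" "\<not> trivial_on (cmt a b) (C y x)"
      by (rule noncommuting_H[OF re re subH subH V(2,1)]) (use L in blast)+
    have bij: "bij a" "bij b" using ab L(3) H_bij by auto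
    define c where "c = cmt a b"
    have cP: "c \<in> pfix {x, y} H" using perm_group_cmt[OF pfix_group ab(1,2)] by (simp add: c_def)
    obtain h where h: "h \<in> ball_fixer 1 x" "\<And>u. u \<in> C x y \<Longrightarrow> h u = restrict_id c (C x y) u"
      using richD[OF rich_ball_fixer_1[OF xy(1)] even_cmt[OF C_finite_card(1)[OF V(1,2)] bij]] L ab unfolding c_def by metis
    have hH: "h \<in> H" "h x = x" "trivial_on h (N x)" using h(1) ball_fixer_1_iff[OF V(1)] by auto
    define f where "f = inv' h \<circ> c"
    have ih: "inv' h u = v" if "h v = u" for u v using bij_inv_eqI[OF H_bij[OF hH(1)] that] .
    have fH: "f \<in> H" unfolding f_def using H_comp[OF H_inv[OF hH(1)] L(3)[OF cP]] .
    have "h y = y" using hH(3) yN(1) by (simp add: trivial_on_def)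
    hence "f x = x" "f y = y" using L(4,5)[OF cP] ih[OF hH(2)] ih[of y y] by (auto simp: f_def)
    moreover have "f u = u" if "u \<in> C x y" for u using h(2)[OF that] that ih[of u "c u"] by (simp add: f_def)
    moreover have "k u \<in> C x y" if "k \<in> ball_fixer 1 x" "u \<in> C x y" for k u
      using ball_fixer_C[OF that(1) V(1,2)] dN(1)[OF yN(1)] that(2) by auto
    \<comment> \<open>\<open>f\<close> is the identity on \<open>C x y\<close>, which
      \<open>ball_fixer 1 x\<close> preserves, so the two commute over \<open>y\<close>;
      \<open>inM\<close> spreads this to all neighbours.\<close>
    ultimately have "f \<in> M"
      using fH by (intro inM[OF _ _ yN(1)]) (auto simp: pfix_def)
    hence ft: "trivial_on f (N x)" using False XN by auto
    have "c u = u" if u: "u \<in> C y x" for u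
    proof -
      have uN: "u \<in> N x" using u by (simp add: C_def)
      hence "inv' h (c u) = u" using ft by (simp add: trivial_on_def f_def)
      hence "c u = h u" using H_inv_inv(2)[OF hH(1), of "c u"] by simp
      thus ?thesis using hH(3) uN by (simp add: trivial_on_def)
    qed
    thus False using ab(3) by (auto simp: trivial_on_def c_def)
  qed
qed

lemma full_1: "full 1"
  unfolding full_def
proof (intro ballI)
  fix x u assume x: "x \<in> V" and u: "u \<in> S x 1"
  have a: "adj x v" if "v \<in> S x 1" for v using that d_1[OF x] by (auto simp: S_def)
  show "rich (Q 1 x u) (C x u)"
    by (rule full_if_unlinked[OF x u rich_ball_fixer_1[OF a[OF u]]]) (use unlinked_1 a u in blast)
qed

subsection \<open>Spheres of larger radius\<close>

lemma C_first_step: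
  assumes "x \<in> V" "v \<in> S x (Suc s)" "s \<ge> 1" "adj x y" "d y v = s"
  shows "C x v = C y v" "v \<in> S y s" "v \<in> V"
proof -
  have v: "v \<in> V" "d x v = Suc s" "y \<in> V" using assms adj_V by (auto simp: S_def)
  show "C x v = C y v"
  proof (rule C_adjacent_centres[OF assms(4) v(1)])
    show "v \<noteq> x" "v \<noteq> y" using v assms by auto
  qed
  show "v \<in> S y s" "v \<in> V" using v assms(5) by (auto simp: S_def)
qed

text \<open>Let \<open>y\<close> be the first vertex on the geodesic from \<open>x\<close> to \<open>w\<close>. Elements of \<open>Q s y w\<close> move
  \<open>C x w\<close>, and within the ball of radius \<open>s + 1\<close> around \<open>x\<close> they move only the sets \<open>C x u\<close> with \<open>u\<close> opposite
  to \<open>w\<close>. The groups \<open>Q s x u\<close> either correct commutators of such elements there, or two of them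
  already have a commutator that moves \<open>C x w\<close>.\<close>

lemma ball_fixer_Suc_nontrivial:
  assumes full: "full s" and s: "s \<ge> 1" and x: "x \<in> V" and w: "w \<in> S x (Suc s)"
  shows "\<exists>k\<in>ball_fixer (Suc s) x. \<not> trivial_on k (C x w)"
proof (rule ccontr)
  assume "\<not> ?thesis"
  hence none: "trivial_on k (C x w)" if "k \<in> ball_fixer (Suc s) x" for k using that by blast
  obtain y where y: "adj x y" "d y w = s" "d x y = 1" using first_step[OF x w] .
  have yV: "y \<in> V" using y adj_V by blast
  have cw: "C x w = C y w" "w \<in> S y s" "w \<in> V" using C_first_step[OF x w s y(1,2)] by auto
  have dw: "d x w = Suc s" "d w x = Suc s" using w d_sym[OF x cw(3)] by (auto simp: S_def)
  \<comment> \<open>Children of vertices in \<open>U\<close> have distance \<open>s + 2\<close> from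
    \<open>y\<close>, just beyond the control of \<open>Q s y w\<close>; all other vertices within
    \<open>s + 1\<close> of \<open>x\<close> are fixed by that group.\<close>
  define U where "U = {u \<in> S x s. d y u = Suc s}"
  have UD: "u \<in> V" "d x u = s" "d y u = Suc s" "u \<in> S x s" if "u \<in> U" for u
    using that by (auto simp: U_def S_def)
  have Uopp: "d w u = d w x + d x u" if "u \<in> U" for u
    using d_through_edge[OF y(1) cw(3) _ UD(1)[OF that]] UD[OF that] dw y(2) by simp
  have UX: "C x u = C y u" if "u \<in> U" for u
  proof (rule C_adjacent_centres[OF y(1) UD(1)[OF that]])
    show "u \<noteq> x" "u \<noteq> y" using UD[OF that] s x yV by auto
  qed
  have wU: "w \<notin> C x u" if "u \<in> U" for u
  proof
    assume "w \<in> C x u"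
    hence "w \<in> C y u" using UX[OF that] by simp
    thus False using y(2) UD[OF that] by (simp add: in_C_iff)
  qed
  have wxU: "u \<notin> C x w" if "u \<in> U" for u using UD[OF that] dw by (auto simp: in_C_iff)
  define G where "G = Q s y w"
  have GH: "G \<subseteq> H" and Ggrp: "perm_group G" using Q_D(1) pfix_group by (auto simp: G_def Q_def)
  have Gfix: "g v = v" if "g \<in> G" "v \<in> V" "d y v \<le> Suc s" "v \<notin> C x w" for g v
    using Q_D(2)[of g s y w v] that cw(1) by (simp add: G_def)
  have wCw: "w \<notin> C x w" "x \<notin> C x w" using dw x by (auto simp: in_C_iff)
  have Gx: "g x = x" "g w = w" if "g \<in> G" for g
    using Gfix[OF that x] Gfix[OF that cw(3)] wCw y d_adj[of y x] adj_sym[of x y] by auto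
  have Gu: "g u = u" if "g \<in> G" "u \<in> U" for g u using Gfix[OF that(1)] UD[OF that(2)] wxU[OF that(2)] by simp
  have GC: "g ` C x w = C x w" if "g \<in> G" for g using H_fix_C Gx[OF that] GH that x cw(3) by blast
  have richG: "rich G (C x w)" using full cw yV by (simp add: full_def G_def)
  define P where "P u = Q s x u" for u
  have PH: "P u \<subseteq> H" and Pgrp: "perm_group (P u)" for u using Q_D(1) pfix_group by (auto simp: P_def Q_def)
  have Pfix: "p v = v" if "p \<in> P u" "v \<in> V" "d x v \<le> Suc s" "v \<notin> C x u" for p u v
    using Q_D(2)[of p s x u v] that by (simp add: P_def)
  have Px: "p x = x" "p w = w" "p u = u" if "p \<in> P u" "u \<in> U" for p u
    using Pfix[OF that(1) x] Pfix[OF that(1) cw(3)] Pfix[OF that(1) UD(1)[OF that(2)]]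
      wU[OF that(2)] UD[OF that(2)] x dw by (auto simp: in_C_iff)
  have PC: "p ` C x w = C x w" "p ` C x u = C x u" if "p \<in> P u" "u \<in> U" for p u
    using H_fix_C[of p x w] H_fix_C[of p x u] Px[OF that] PH that(1) x cw(3) UD(1)[OF that(2)] by blast+
  have richP: "rich (P u) (C x w)" if u: "u \<in> U" and p: "p \<in> P u" "\<not> trivial_on p (C x w)" for u p
  proof (rule rich_H[OF PH GH Pgrp x cw(3) richG PC(1)[OF _ u] GC _ p])
    show "l \<circ> k \<circ> inv' l \<in> P u" if "l \<in> G" "k \<in> P u" for l k
      using Q_conj[of l k s x u] that GH x UD(1)[OF u] Gx(1)[OF that(1)] Gu[OF that(1) u] by (auto simp: P_def)
  qed
  have Cdisj: "v \<notin> C x u'" if "v \<in> C x u" "u \<noteq> u'" for u u' v using C_disjoint[OF x] that by blast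
  have Cd: "v \<in> V" "d x v = Suc s" if "v \<in> C x u" "u \<in> U" for u v
    using C_V[OF that(1)] that(1) UD(2)[OF that(2)] by (auto simp: in_C_iff)
  \<comment> \<open>Two opposite vertices are needed: elements of \<open>P u\<close> may move
    \<open>C x u\<close>, but their commutators with elements of \<open>P u'\<close> fix both
    \<open>C x u\<close> and \<open>C x u'\<close>.\<close>
  obtain u1 u2 where u12: "u1 \<in> U" "u2 \<in> U" "u1 \<noteq> u2"
  proof -
    obtain m where m: "s = Suc m" using s by (cases s) auto
    obtain y1 where y1: "y1 \<in> C w x" using C_ne[OF cw(3) x, of "[]"] by auto
    obtain y2 where y2: "y2 \<in> C w x" "y2 \<noteq> y1" using C_ne[OF cw(3) x, of "[y1]"] by auto
    obtain u1 where u1: "u1 \<in> V" "d y1 u1 = m" "d x u1 = Suc m" "d w u1 = d w x + Suc m"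
      using ex_beyond[OF cw(3) x y1] .
    obtain u2 where u2: "u2 \<in> V" "d y2 u2 = m" "d x u2 = Suc m" "d w u2 = d w x + Suc m"
      using ex_beyond[OF cw(3) x y2(1)] .
    have inU: "u \<in> U" if "u \<in> V" "d x u = Suc m" "d w u = d w x + Suc m" for u
    proof -
      have "d w u \<le> d w y + d y u" "d y u \<le> d y x + d x u"
        using d_triangle cw(3) yV x that(1) by blast+
      hence "d y u = Suc s" using that m dw y d_sym[OF x yV] d_sym[OF cw(3) yV] by simp
      thus ?thesis using that m by (simp add: U_def S_def)
    qed
    have a: "adj x y1" "adj x y2" using y1 y2 by (auto simp: in_C_iff)
    have "u1 \<noteq> u2"
    proof
      assume "u1 = u2"
      hence "y1 = y2"
        using between_unique[of x u1 y1 y2 1 m] u1 u2 a adj_V d_adj x by simp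
      thus False using y2 by simp
    qed
    thus thesis using that inU u1 u2 by blast
  qed
  show False
  proof (cases "\<exists>u\<in>U. \<exists>p\<in>P u. \<not> trivial_on p (C x w)")
    case True
    then obtain u p where u: "u \<in> U" and p: "p \<in> P u" "\<not> trivial_on p (C x w)" by blast
    obtain u' where u': "u' \<in> U" "u' \<noteq> u" using u12 by metis
    obtain h where h: "h \<in> H" "h x = x" "h w = w" "h u = u'"
      using homogeneous_through[OF x cw(3) UD(1)[OF u] UD(1)[OF u'(1)] Uopp[OF u] Uopp[OF u'(1)]]
        UD(2)[OF u] UD(2)[OF u'(1)] by auto
    define p' where "p' = h \<circ> p \<circ> inv' h"
    have p': "p' \<in> P u'" using Q_conj[OF h(1) _ x UD(1)[OF u]] p(1) h by (simp add: P_def p'_def)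
    have "\<not> trivial_on p' (C x w)"
    proof
      assume t: "trivial_on p' (C x w)"
      have "p z = z" if z: "z \<in> C x w" for z
      proof -
        have "h z \<in> C x w" using H_fix_C[OF h(1) x cw(3) h(2,3)] z by blast
        hence "p' (h z) = h z" using t by (simp add: trivial_on_def)
        hence "h (p z) = h z" using h(1) by (simp add: p'_def)
        thus ?thesis using H_aut[OF h(1)] by simp
      qed
      thus False using p(2) by (simp add: trivial_on_def)
    qed
    hence r: "rich (P u) (C x w)" "rich (P u') (C x w)" using richP u u' p p' by blast+
    obtain k l where kl: "k \<in> P u" "l \<in> P u'" "\<not> trivial_on (cmt k l) (C x w)"
      by (rule noncommuting_H[OF r PH PH x cw(3) PC(1)[OF _ u] PC(1)[OF _ u'(1)]])
    have kH: "k \<in> H" "l \<in> H" using kl PH by auto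
    have "cmt k l v = v" if v: "v \<in> V" "d x v \<le> Suc s" for v
    proof -
      consider "v \<in> C x u" | "v \<in> C x u'" | "v \<notin> C x u" "v \<notin> C x u'" by blast
      thus ?thesis
      proof cases
        case 1
        show ?thesis
          by (rule cmt_fix'[OF H_bij H_bij PC(2)[OF kl(1) u] _ 1])
            (use kH Pfix[OF kl(2)] Cd[OF _ u] Cdisj u' in auto)
      next
        case 2
        show ?thesis
          by (rule cmt_fix[OF H_bij H_bij PC(2)[OF kl(2) u'(1)] _ 2])
            (use kH Pfix[OF kl(1)] Cd[OF _ u'(1)] Cdisj u' in auto)
      next
        case 3
        have f: "k v = v" "l v = v" using Pfix[OF kl(1) v] Pfix[OF kl(2) v] 3 by auto
        show ?thesis using bij_inv_eqI[OF H_bij[OF kH(1)] f(1)] bij_inv_eqI[OF H_bij[OF kH(2)] f(2)] f by simp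
      qed
    qed
    moreover have "cmt k l \<in> H" using perm_group_cmt[OF H_group kH] .
    ultimately have "cmt k l \<in> ball_fixer (Suc s) x" by (auto simp: ball_fixer_def pfix_def B_def)
    thus False using none kl(3) by blast
  next
    case False
    hence Ptriv: "trivial_on p (C x w)" if "u \<in> U" "p \<in> P u" for u p using that by blast
    obtain a b where ab: "a \<in> G" "b \<in> G" "\<not> trivial_on (cmt a b) (C x w)"
      by (rule noncommuting_H[OF richG richG GH GH x cw(3) GC GC])
    define c where "c = cmt a b"
    have cG: "c \<in> G" using perm_group_cmt[OF Ggrp ab(1,2)] by (simp add: c_def)
    \<comment> \<open>The corrections must leave \<open>C x w\<close> alone, since the commutator
      \<open>c\<close> has to remain visible there. By the case assumption every \<open>P u\<close>
      with \<open>u \<in> U\<close> satisfies this.\<close>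
    define M where "M = pfix (B x s \<union> (\<Union>u\<in>S x s - U. C x u) \<union> C x w) H"
    have M: "perm_group M" unfolding M_def by (rule pfix_group)
    have MD: "m \<in> H" "v \<in> V \<Longrightarrow> d x v \<le> s \<Longrightarrow> m v = v" "v \<in> C x w \<Longrightarrow> m v = v"
      "u \<in> S x s - U \<Longrightarrow> v \<in> C x u \<Longrightarrow> m v = v" if "m \<in> M" for m u v
      using that by (auto simp: M_def pfix_def B_def)
    have finU: "finite U" using S_finite[OF x] by (simp add: U_def)
    have PM: "P u \<subseteq> M" if u: "u \<in> U" for u
    proof
      fix p assume p: "p \<in> P u"
      have "p v = v" if "v \<in> B x s" for v
        using Pfix[OF p, of v] that UD[OF u] by (auto simp: B_def in_C_iff)
      moreover have "p v = v" if "u' \<in> S x s - U" "v \<in> C x u'" for u' v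
      proof (rule Pfix[OF p])
        show "v \<in> V" "d x v \<le> Suc s" using that C_V[OF that(2)] by (auto simp: in_C_iff S_def)
        show "v \<notin> C x u" using Cdisj[OF that(2), of u] that(1) u by auto
      qed
      moreover have "p \<in> H" using PH p by blast
      ultimately show "p \<in> M" using Ptriv[OF u p] by (auto simp: M_def pfix_def trivial_on_def)
    qed
    have "\<exists>m\<in>M. \<forall>u\<in>U. \<forall>v\<in>C x u. m v = restrict_id c (C x u) v"
    proof (rule rich_family[OF M finU])
      show "m ` C x u = C x u" if "m \<in> M" "u \<in> U" for m u
        using H_fix_C[OF MD(1)[OF that(1)] x UD(1)[OF that(2)]] MD(2)[OF that(1)] x UD[OF that(2)] by simp
      show "restrict_id c (C x u) permutes C x u \<and> evenperm (restrict_id c (C x u))" if u: "u \<in> U" for u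
      proof -
        have "g ` C x u = C x u" if "g \<in> G" for g
          using H_fix_C[of g x u] Gx(1)[OF that] Gu[OF that u] GH that x UD(1)[OF u] by blast
        hence g: "a ` C x u = C x u" "b ` C x u = C x u" using ab by auto
        have "bij a" "bij b" using ab(1,2) GH H_bij by auto
        thus ?thesis using even_cmt[OF C_finite_card(1)[OF x UD(1)[OF u]] _ _ g] unfolding c_def by blast
      qed
      show "\<exists>k\<in>M. (\<forall>v\<in>C x u. k v = \<pi> v) \<and> (\<forall>j\<in>U - {u}. \<forall>v\<in>C x j. k v = v)"
        if u: "u \<in> U" and \<pi>: "\<pi> permutes C x u" "evenperm \<pi>" for u \<pi>
      proof -
        have "rich (P u) (C x u)" using full x UD(4)[OF u] by (simp add: full_def P_def)
        then obtain p where p: "p \<in> P u" "\<And>v. v \<in> C x u \<Longrightarrow> p v = \<pi> v" using richD \<pi> by blast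
        have "p v = v" if "j \<in> U - {u}" "v \<in> C x j" for j v
          using Pfix[OF p(1)] Cd[OF that(2)] Cdisj[OF that(2)] that(1) by simp
        thus ?thesis using p PM[OF u] by blast
      qed
    qed
    then obtain m where m: "m \<in> M" "\<And>u v. u \<in> U \<Longrightarrow> v \<in> C x u \<Longrightarrow> m v = c v" by auto
    have im: "inv' m v = v'" if "m v' = v" for v v' using bij_inv_eqI[OF H_bij[OF MD(1)[OF m(1)]] that] .
    define f where "f = inv' m \<circ> c"
    have "f v = v" if v: "v \<in> V" "d x v \<le> Suc s" for v
    proof (cases "d x v \<le> s")
      case True
      have "d y v \<le> Suc s" using d_triangle[OF yV x v(1)] True d_sym[OF x yV] y(3) by simp
      moreover have "v \<notin> C x w" using True dw by (auto simp: in_C_iff)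
      ultimately show ?thesis using Gfix[OF cG v(1)] im[OF MD(2)[OF m(1) v(1) True]] by (simp add: f_def)
    next
      case False
      hence "v \<in> S x (Suc s)" using v by (auto simp: S_def)
      then obtain u where u: "u \<in> S x s" "v \<in> C x u" using S_SucE[OF x] by blast
      show ?thesis
      proof (cases "u \<in> U")
        case True
        thus ?thesis using im[OF m(2)[OF True u(2)]] by (simp add: f_def)
      next
        case False
        have uV: "u \<in> V" "d x u = s" "adj u v" using u by (auto simp: S_def in_C_iff)
        have "s = Suc (d y u)" using adj_dist'[OF uV(1) y(1)] uV u(1) False by (auto simp: U_def)
        moreover have "d y v \<le> d y u + d u v" using d_triangle yV uV(1) v(1) by blast
        ultimately have "d y v \<le> Suc s" using d_adj[OF uV(3)] by simp
        moreover have "v \<notin> C x w" using v dw by (auto simp: in_C_iff)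
        ultimately have "c v = v" using Gfix[OF cG v(1)] by blast
        moreover have "u \<in> S x s - U" using u(1) False by blast
        ultimately show ?thesis using im[OF MD(4)[OF m(1) _ u(2)]] by (simp add: f_def)
      qed
    qed
    moreover have "f \<in> H" unfolding f_def using H_comp[OF H_inv[OF MD(1)[OF m(1)]]] cG GH by blast
    ultimately have "f \<in> ball_fixer (Suc s) x" by (auto simp: ball_fixer_def pfix_def B_def)
    hence t: "trivial_on f (C x w)" by (rule none)
    have "c z = z" if z: "z \<in> C x w" for z
    proof -
      have "c z \<in> C x w" using GC[OF cG] z by blast
      hence "inv' m (c z) = c z" using im[OF MD(3)[OF m(1)]] by blast
      thus ?thesis using t z by (simp add: trivial_on_def f_def)
    qed
    thus False using ab(3) by (simp add: trivial_on_def c_def)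
  qed
qed

text \<open>From the common first vertex \<open>y\<close>, the group \<open>Q s y v\<close> is rich
  on \<open>C x v\<close> and trivial on \<open>C x v'\<close>. It normalizes
  \<open>ball_fixer (Suc s) x\<close>, so a commutator between the two stays in the latter, is
  trivial on \<open>C x v'\<close>, and can be chosen nontrivial on \<open>C x v\<close>.\<close>

lemma unlinked_same_branch:
  assumes full: "full s" and s: "s \<ge> 1" and x: "x \<in> V" and v: "v \<in> S x (Suc s)" "v' \<in> S x (Suc s)" "v \<noteq> v'"
    and y: "adj x y" "d y v = s" "d y v' = s" and rich: "rich (ball_fixer (Suc s) x) (C x v)"
  shows "\<exists>h\<in>ball_fixer (Suc s) x. trivial_on h (C x v') \<and> \<not> trivial_on h (C x v)"
proof -
  have yV: "y \<in> V" using y adj_V by blast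
  have a: "C x v = C y v" "v \<in> S y s" "v \<in> V" using C_first_step[OF x v(1) s y(1,2)] by auto
  have b: "C x v' = C y v'" "v' \<in> S y s" "v' \<in> V" using C_first_step[OF x v(2) s y(1,3)] by auto
  define G where "G = Q s y v"
  have GH: "G \<subseteq> H" using Q_D(1) by (auto simp: G_def)
  have Gx: "g x = x" "g v = v" if "g \<in> G" for g
    using Q_D(2)[of g s y v x] Q_D(2)[of g s y v v] that x a y d_adj[of y x] adj_sym[of x y] v(1) a(1) s
    by (auto simp: G_def in_C_iff S_def)
  have GC: "g ` C x v = C x v" if "g \<in> G" for g using H_fix_C Gx[OF that] GH that x a(3) by blast
  have richG: "rich G (C x v)" using full a yV by (simp add: full_def G_def)
  have FH: "ball_fixer (Suc s) x \<subseteq> H" using ball_fixer_D(1) by blast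
  have FC: "k ` C x u = C x u" if "k \<in> ball_fixer (Suc s) x" "u \<in> S x (Suc s)" for k u
    using ball_fixer_C[OF that(1) x] that(2) by (simp add: S_def)
  obtain g h where gh: "g \<in> G" "h \<in> ball_fixer (Suc s) x" "\<not> trivial_on (cmt g h) (C x v)"
    by (rule noncommuting_H[OF richG rich GH FH x a(3) GC FC[OF _ v(1)]])
  have "cmt g h \<in> ball_fixer (Suc s) x"
    using cmt_normal[OF ball_fixer_group gh(2)] ball_fixer_conj[of g h "Suc s" x] gh(1,2) GH Gx(1)[OF gh(1)] x by auto
  moreover have "cmt g h u = u" if "u \<in> C x v'" for u
  proof (rule cmt_fix[OF H_bij H_bij FC[OF gh(2) v(2)] _ that])
    show "g \<in> H" "h \<in> H" using gh GH FH by auto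
    show "g z = z" if "z \<in> C x v'" for z
    proof -
      have "z \<in> V" "d y z = Suc s" "z \<notin> C y v"
        using that b C_V C_disjoint[OF yV, of z v v'] v(3) by (auto simp: in_C_iff S_def)
      thus ?thesis using Q_D(2)[of g s y v z] gh(1) by (simp add: G_def)
    qed
  qed
  ultimately show ?thesis using gh(3) unfolding trivial_on_def by blast
qed

text \<open>If \<open>v\<close> and \<open>v'\<close> lie in different branches at \<open>x\<close> and were linked, then by homogeneity \<open>v'\<close> would
  be linked, through \<open>v\<close>, to a vertex of its own branch.\<close>

lemma unlinked_Suc:
  assumes full: "full s" and s: "s \<ge> 1" and x: "x \<in> V" and v: "v \<in> S x (Suc s)" "v' \<in> S x (Suc s)" "v \<noteq> v'"
    and rich: "\<And>u. u \<in> S x (Suc s) \<Longrightarrow> rich (ball_fixer (Suc s) x) (C x u)"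
  shows "\<exists>h\<in>ball_fixer (Suc s) x. trivial_on h (C x v') \<and> \<not> trivial_on h (C x v)"
proof (rule ccontr)
  assume no: "\<not> ?thesis"
  hence link: "trivial_on k (C x v)" if "k \<in> ball_fixer (Suc s) x" "trivial_on k (C x v')" for k using that by blast
  obtain y where y: "adj x y" "d y v = s" "d x y = 1" using first_step[OF x v(1)] .
  obtain y' where y': "adj x y'" "d y' v' = s" "d x y' = 1" using first_step[OF x v(2)] .
  have V: "v \<in> V" "v' \<in> V" "d x v = Suc s" "d x v' = Suc s" "y \<in> V" "y' \<in> V"
    using v adj_V y y' by (auto simp: S_def)
  have "d y v' \<noteq> s" using no unlinked_same_branch[OF full s x v y(1,2) _ rich[OF v(1)]] by blast
  hence ne: "y \<noteq> y'" using y' by blast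
  obtain p where p: "adj v' p" "d x p = s" using ex_parent[OF x V(2,4)] .
  have pV: "p \<in> V" and v'p: "v' \<in> C x p" using p adj_V adj_sym V by (auto simp: in_C_iff)
  have dp: "s = Suc (d y' p)"
  proof (rule ccontr)
    assume "s \<noteq> Suc (d y' p)"
    hence a: "d y' p = Suc s" using adj_dist'[OF pV y'(1)] p(2) by auto
    have "C x p = C y' p"
    proof (rule C_adjacent_centres[OF y'(1) pV])
      show "p \<noteq> x" "p \<noteq> y'" using p s x a V by auto
    qed
    thus False using v'p a y'(2) by (simp add: in_C_iff)
  qed
  obtain v'' where v'': "v'' \<in> C x p" "v'' \<noteq> v'" using C_ne[OF x pV, of "[v']"] by auto
  have V'': "v'' \<in> V" "d x v'' = Suc s" "v'' \<in> S x (Suc s)" using v'' C_V p by (auto simp: in_C_iff S_def)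
  have dv'': "d y' v'' = s"
  proof -
    have "d y' v'' \<le> d y' p + d p v''" "d x v'' \<le> d x y' + d y' v''"
      using d_triangle V x pV V''(1) by blast+
    moreover have "d p v'' = 1" using v'' d_adj by (auto simp: in_C_iff)
    ultimately show ?thesis using dp V'' y' by simp
  qed
  have far: "d v u = Suc s + Suc s" "d u v = Suc s + Suc s"
    if u: "u \<in> V" "d x u = Suc s" "d y' u = s" for u
  proof -
    have "d y u \<noteq> s"
    proof
      assume "d y u = s"
      hence "y = y'" using between_unique[OF x u(1) V(5,6), of 1 s] u y y' by simp
      thus False using ne by blast
    qed
    hence "d y u = Suc (d x u)" using adj_dist'[OF u(1) y(1)] u(2) by auto
    thus "d v u = Suc s + Suc s"
      using d_through_edge[OF y(1) V(1) _ u(1)] V(3) y(2) u(2) d_sym[OF x V(1)] by simp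
    thus "d u v = Suc s + Suc s" using d_sym[OF u(1) V(1)] by simp
  qed
  have f1: "d v v' = Suc s + Suc s" and f2: "d v'' v = Suc s + Suc s"
    using far(1)[OF V(2,4) y'(2)] far(2)[OF V''(1,2) dv''] by auto
  have ty: "ty v = ty v''" using d_parity[OF x V(1)] d_parity[OF x V''(1)] V(3) V''(2) by auto
  obtain h where h: "h \<in> H" "h v = v''" "h v' = v"
    using homogeneous[OF V(1,2) V''(1) V(1) ty] f1 f2 by auto
  have "d v'' (h x) = Suc s" "d (h x) v = Suc s"
    using H_d[OF h(1) V(1) x] H_d[OF h(1) x V(2)] V(3,4) d_sym[OF x V(1)] unfolding h(2,3) by simp_all
  hence hx: "h x = x"
    using between_unique[OF V''(1) V(1) _ x f2, of "h x"] H_V[OF h(1), of x] x V''(2) V(3) d_sym[OF x V''(1)] by metis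
  have "trivial_on k (C x v'')" if "k \<in> ball_fixer (Suc s) x" "trivial_on k (C x v')" for k
    using link_conj[OF h(1) x hx V(1,2) link that(1)] link[OF that] unfolding h(2,3) by blast
  moreover have "\<exists>h\<in>ball_fixer (Suc s) x. trivial_on h (C x v') \<and> \<not> trivial_on h (C x v'')"
    by (rule unlinked_same_branch[OF full s x V''(3) v(2) v''(2) y'(1) dv'' y'(2) rich[OF V''(3)]])
  ultimately show False by blast
qed

lemma full_Suc:
  assumes full: "full s" and s: "s \<ge> 1"
  shows "full (Suc s)"
  unfolding full_def
proof (intro ballI)
  fix x u assume x: "x \<in> V" and u: "u \<in> S x (Suc s)"
  have rich: "rich (ball_fixer (Suc s) x) (C x v)" if v: "v \<in> S x (Suc s)" for v
  proof -
    obtain k where "k \<in> ball_fixer (Suc s) x" "\<not> trivial_on k (C x v)" using ball_fixer_Suc_nontrivial[OF full s x v] by blast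
    thus ?thesis using rich_ball_fixer[OF x v rich_two_point[OF x v full]] by blast
  qed
  show "rich (Q (Suc s) x u) (C x u)"
    by (rule full_if_unlinked[OF x u rich[OF u]]) (use unlinked_Suc[OF full s x u] rich in blast)
qed

lemma full: "full (Suc r)"
  by (induction r) (use full_1 full_Suc in auto)

lemma full_family:
  assumes x: "x \<in> V" and \<pi>: "\<And>v. v \<in> S x (Suc r) \<Longrightarrow> \<pi> v permutes C x v \<and> evenperm (\<pi> v)"
  obtains h where "h \<in> ball_fixer (Suc r) x" "\<And>v u. v \<in> S x (Suc r) \<Longrightarrow> u \<in> C x v \<Longrightarrow> h u = \<pi> v u"
proof -
  have "\<exists>k\<in>ball_fixer (Suc r) x. \<forall>v\<in>S x (Suc r). \<forall>u\<in>C x v. k u = \<pi> v u"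
  proof (rule rich_family[OF ball_fixer_group S_finite[OF x] _ _ \<pi>])
    show "k ` C x v = C x v" if "k \<in> ball_fixer (Suc r) x" "v \<in> S x (Suc r)" for k v
      using ball_fixer_C[OF that(1) x] that(2) by (simp add: S_def)
    show "\<exists>k\<in>ball_fixer (Suc r) x. (\<forall>u\<in>C x v. k u = \<pi>' u) \<and> (\<forall>j\<in>S x (Suc r) - {v}. \<forall>u\<in>C x j. k u = u)"
      if v: "v \<in> S x (Suc r)" and p: "\<pi>' permutes C x v" "evenperm \<pi>'" for v \<pi>'
    proof -
      have "rich (Q (Suc r) x v) (C x v)" using full x v by (simp add: full_def)
      then obtain k where k: "k \<in> Q (Suc r) x v" "\<And>u. u \<in> C x v \<Longrightarrow> k u = \<pi>' u" using richD p by blast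
      have "k u = u" if "j \<in> S x (Suc r) - {v}" "u \<in> C x j" for j u
      proof (rule Q_D(2)[OF k(1)])
        show "u \<in> V" "d x u \<le> Suc (Suc r)" using that C_V[OF that(2)] by (auto simp: in_C_iff S_def)
        show "u \<notin> C x v" using that C_disjoint[OF x, of u j v] by blast
      qed
      thus ?thesis using k Q_ball_fixer[OF x v] by blast
    qed
  qed
  thus thesis using that by blast
qed

end

section \<open>Elements of order three that are supported on three branches\<close>

text \<open>Only even corrections are available, so an odd \<open>\<rho>\<close> cannot be
  cancelled; but \<open>\<rho> \<circ> m\<close> can always be made the identity or a
  transposition.\<close>

lemma even_square_root_correction:
  assumes "\<rho> permutes X" "finite X" "card X \<ge> 2"
  shows "\<exists>m. m permutes X \<and> evenperm m \<and> (\<forall>u\<in>X. \<rho> (m (\<rho> (m u))) = u)"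
proof -
  have p: "permutation \<rho>" using assms permutation_permutes by blast
  have inv: "inv' \<rho> permutes X" using assms(1) by (rule permutes_inv)
  note r = permutes_inverses(1)[OF assms(1)]
  show ?thesis
  proof (cases "evenperm \<rho>")
    case True
    thus ?thesis using inv p r by (intro exI[of _ "inv' \<rho>"]) (auto simp: evenperm_inv)
  next
    case False
    obtain a where a: "a \<in> X" using obtain_not_in[of "[]" X] assms(3) by auto
    obtain b where b: "b \<in> X" "b \<noteq> a" using obtain_not_in[of "[a]" X] assms(3) by auto
    define m where "m = inv' \<rho> \<circ> transpose a b"
    have "m permutes X" unfolding m_def using a b inv by (intro permutes_compose permutes_swap_id)
    moreover have "evenperm m" unfolding m_def
      using False p b by (simp add: evenperm_comp evenperm_inv permutation_inverse permutation_swap_id evenperm_swap)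
    moreover have "\<rho> (m (\<rho> (m u))) = u" for u using r by (simp add: m_def)
    ultimately show ?thesis by blast
  qed
qed

context bitree
begin

text \<open>For \<open>e\<close> adjacent to \<open>x\<close>: the half tree beyond the edge from \<open>x\<close> to \<open>e\<close>.\<close>

definition half_tree :: "'a \<Rightarrow> 'a \<Rightarrow> 'a set" where "half_tree x e = {v \<in> V. d x v = Suc (d e v)}"

lemma half_tree_V: "v \<in> half_tree x e \<Longrightarrow> v \<in> V"
  by (simp add: half_tree_def)

lemma N_D: "e \<in> N x \<Longrightarrow> adj x e" "e \<in> N x \<Longrightarrow> e \<in> V" "e \<in> N x \<Longrightarrow> d x e = 1"
  using adj_V d_adj by (auto simp: N_def)

lemma half_tree_ex:
  assumes "x \<in> V" "v \<in> V" "v \<noteq> x"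
  obtains e where "e \<in> N x" "v \<in> half_tree x e"
proof -
  obtain k where "d v x = Suc k" using d_zero_iff assms by (cases "d v x") auto
  then obtain e where "adj x e" "d v x = Suc (d v e)" using ex_parent[OF assms(2,1)] by metis
  thus thesis using that d_sym assms adj_V by (auto simp: half_tree_def N_def)
qed

lemma half_tree_unique:
  assumes "x \<in> V" "e \<in> N x" "e' \<in> N x" "v \<in> half_tree x e" "v \<in> half_tree x e'" shows "e = e'"
proof -
  have V: "v \<in> V" "e \<in> V" "e' \<in> V" using assms(4) N_D(2) assms(2,3) by (auto simp: half_tree_def)
  have "d v x = Suc (d v e)" "d v x = Suc (d v e')"
    using assms(4,5) d_sym[OF V(1) assms(1)] d_sym[OF V(1,2)] d_sym[OF V(1,3)] by (simp_all add: half_tree_def)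
  thus ?thesis using parent_unique[OF V(1) N_D(1)[OF assms(2)] N_D(1)[OF assms(3)]] by blast
qed

lemma half_tree_self: "x \<in> V \<Longrightarrow> e \<in> N x \<Longrightarrow> e \<in> half_tree x e"
  using N_D by (simp add: half_tree_def)

lemma half_tree_not_centre: "x \<in> V \<Longrightarrow> v \<in> half_tree x e \<Longrightarrow> v \<noteq> x"
  by (auto simp: half_tree_def)

lemma half_tree_image:
  assumes "aut t" "t x = x" "x \<in> V" "e \<in> V" "v \<in> half_tree x e" shows "t v \<in> half_tree x (t e)"
  using aut_d[OF assms(1,3), of v] aut_d[OF assms(1,4), of v] assms by (simp add: half_tree_def)

lemma half_tree_child:
  assumes "x \<in> V" "e \<in> N x" "v \<in> half_tree x e" "u \<in> C x v" shows "u \<in> half_tree x e"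
proof -
  have V: "u \<in> V" "v \<in> V" "e \<in> V" using C_V[OF assms(4)] N_D(2)[OF assms(2)] by auto
  have "d x u = Suc (d x v)" "d v u = 1" using assms(4) d_adj by (auto simp: in_C_iff)
  moreover have "d e u \<le> d e v + d v u" "d x u \<le> d x e + d e u" using d_triangle V assms(1) by blast+
  ultimately show ?thesis using assms(3) N_D(3)[OF assms(2)] V by (simp add: half_tree_def)
qed

lemma half_tree_complement:
  assumes "adj x y" "v \<in> V" shows "v \<in> half_tree x y \<longleftrightarrow> v \<notin> half_tree y x"
  using adj_dist'[OF assms(2,1)] assms(2) unfolding half_tree_def mem_Collect_eq by linarith

end

context bt_group
begin

lemma sequence_limit:
  assumes x: "x \<in> V" and t: "\<And>n. t n \<in> H" "\<And>n. t n x = x"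
    and step: "\<And>n v. v \<in> B x n \<Longrightarrow> t (Suc n) v = t n v"
  obtains s where "s \<in> H" "\<And>n v. v \<in> B x n \<Longrightarrow> s v = t n v"
proof -
  \<comment> \<open>From stage \<open>d x v\<close> on, the value at \<open>v\<close> no longer
    changes.\<close>
  define s where "s v = (if v \<in> V then t (d x v) v else v)" for v
  have eq: "s v = t n v" if "v \<in> V" "d x v \<le> n" for n v
    using that(2)
  proof (induction n rule: dec_induct)
    case base
    thus ?case using that by (simp add: s_def)
  next
    case (step n)
    thus ?case using assms(4)[of v n] that(1) by (simp add: B_def)
  qed
  have sV: "s v \<in> V" if "v \<in> V" for v using that t(1) by (simp add: s_def)
  have two: "\<exists>n. s u = t n u \<and> s v = t n v" if "u \<in> V" "v \<in> V" for u v
    using eq[OF that(1), of "max (d x u) (d x v)"] eq[OF that(2), of "max (d x u) (d x v)"] by auto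
  have "bij_betw s V V"
  proof (rule bij_betw_imageI)
    show "inj_on s V"
      using two t(1) H_aut by (metis inj_onI aut_eq_iff)
    show "s ` V = V"
    proof (intro equalityI subsetI)
      fix v assume v: "v \<in> V"
      define u where "u = inv' (t (d x v)) v"
      have u: "u \<in> V" "t (d x v) u = v" using v t(1) H_inv by (auto simp: u_def)
      have "d x u = d x v" using H_d[OF t(1)[of "d x v"] x u(1)] t(2) u(2) by simp
      hence "s u = v" using u by (simp add: s_def)
      thus "v \<in> s ` V" using u(1) by blast
    qed (use sV in blast)
  qed
  hence "s permutes V" by (rule bij_imp_permutes) (simp add: s_def)
  moreover have "adj (s u) (s v) \<longleftrightarrow> adj u v" if "u \<in> V" "v \<in> V" for u v
    using two[OF that] t(1) H_aut by (metis aut_adj)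
  ultimately have "aut s" by (simp add: aut_iff)
  moreover have "\<exists>h\<in>H. \<forall>v\<in>F. h v = s v" if F: "finite F" "F \<subseteq> V" for F
  proof (intro bexI ballI)
    fix v assume "v \<in> F"
    hence "d x v \<le> Max (d x ` F)" "v \<in> V" using F by auto
    thus "t (Max (d x ` F)) v = s v" using eq by simp
  qed (rule t(1))
  ultimately have "s \<in> H" by (rule H_closed)
  thus thesis using that eq by (auto simp: B_def)
qed

definition rot3 :: "'a \<Rightarrow> 'a \<Rightarrow> 'a \<Rightarrow> 'a \<Rightarrow> nat \<Rightarrow> ('a \<Rightarrow> 'a) \<Rightarrow> bool" where
  "rot3 x a b c n t \<longleftrightarrow> t \<in> H \<and> t x = x \<and> (\<forall>u\<in>N x. t u = cyc3 a b c u) \<and>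
     (\<forall>v\<in>B x n. t (t (t v)) = v) \<and> (\<forall>e\<in>N x - {a, b, c}. \<forall>v\<in>half_tree x e \<inter> B x n. t v = v)"

text \<open>An even correction \<open>m\<close> on the sphere of radius \<open>n\<close> turns \<open>t\<close> into an element \<open>s\<close> such that \<open>s\<close>
  (on the fixed branches) or its cube (on the others) acts on the next sphere as an involution.
  Then the fourth power of \<open>s\<close> has the desired properties one step further.\<close>

lemma rot3_step:
  assumes x: "x \<in> V" and abc: "a \<in> N x" "b \<in> N x" "c \<in> N x" "a \<noteq> b" "b \<noteq> c" "a \<noteq> c"
    and t: "rot3 x a b c (Suc r) t"
  shows "\<exists>t'. rot3 x a b c (Suc (Suc r)) t' \<and> (\<forall>v\<in>B x (Suc r). t' v = t v)"
proof -
  let ?n = "Suc r"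
  have tH: "t \<in> H" "t x = x" and tN: "\<And>u. u \<in> N x \<Longrightarrow> t u = cyc3 a b c u"
    and t3: "\<And>v. v \<in> B x ?n \<Longrightarrow> t (t (t v)) = v"
    and t1: "\<And>e v. e \<in> N x - {a, b, c} \<Longrightarrow> v \<in> half_tree x e \<Longrightarrow> v \<in> B x ?n \<Longrightarrow> t v = v"
    using t by (auto simp: rot3_def)
  have tabc: "t a = b" "t b = c" "t c = a" using tN abc by (auto simp: cyc3_apply)
  have SV: "v \<in> V" "v \<in> B x ?n" "v \<noteq> x" if "v \<in> S x ?n" for v using that x by (auto simp: S_def B_def)
  have tS: "h v \<in> S x ?n" if "h \<in> H" "h x = x" "v \<in> S x ?n" for h v
    using aut_S[OF H_aut[OF that(1)] x that(3)] that(2) by simp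
  have tC: "h u \<in> C x (h v)" if "h \<in> H" "h x = x" "v \<in> S x ?n" "u \<in> C x v" for h u v
    using aut_C[OF H_aut[OF that(1)] x SV(1)[OF that(3)]] that(2,4) by auto
  have thb: "t v \<in> half_tree x (t e)" if "v \<in> half_tree x e" "e \<in> N x" for v e
    using half_tree_image[OF H_aut[OF tH(1)] tH(2) x N_D(2)[OF that(2)] that(1)] .
  have hbne: "v \<notin> half_tree x e'" if "v \<in> half_tree x e" "e \<in> N x" "e' \<in> N x" "e \<noteq> e'" for v e e'
    using half_tree_unique[OF x that(2,3,1)] that(4) by blast
  have perm: "restrict_id h (C x v) permutes C x v" if "h \<in> H" "h x = x" "h v = v" "v \<in> V" for h v
    using H_fix_C[OF that(1) x that(4,2,3)] H_bij[OF that(1)]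
    by (intro permutes_restrict_id bij_betw_imageI) (auto intro: inj_on_subset simp: bij_def)
  \<comment> \<open>The map that returns a branch to itself is \<open>t\<close> on a fixed branch
    and its cube on the three permuted ones. For these it suffices to correct it over
    \<open>a\<close>, so the correction over \<open>b\<close> and \<open>c\<close> is the
    identity.\<close>
  define \<rho> where "\<rho> v = restrict_id (if v \<in> half_tree x a then t \<circ> t \<circ> t else t) (C x v)" for v
  have "\<exists>m. m permutes C x v \<and> evenperm m \<and> (v \<in> half_tree x b \<union> half_tree x c \<longrightarrow> m = id) \<and>
      (v \<notin> half_tree x b \<union> half_tree x c \<longrightarrow> (\<forall>u\<in>C x v. \<rho> v (m (\<rho> v (m u))) = u))" if v: "v \<in> S x ?n" for v
  proof (cases "v \<in> half_tree x b \<union> half_tree x c")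
    case True
    thus ?thesis by (intro exI[of _ id]) (auto simp: permutes_id)
  next
    case False
    have "\<rho> v permutes C x v"
    proof (cases "v \<in> half_tree x a")
      case True
      thus ?thesis unfolding \<rho>_def using perm[of "t \<circ> t \<circ> t" v] H_comp tH t3 SV[OF v] by simp
    next
      case f: False
      obtain e where e: "e \<in> N x" "v \<in> half_tree x e" using half_tree_ex[OF x SV(1,3)[OF v]] .
      hence "t v = v" using t1[of e v] False f SV[OF v] by blast
      thus ?thesis unfolding \<rho>_def using perm[of t v] tH SV[OF v] f by simp
    qed
    moreover have "card (C x v) \<ge> 2" using C_finite_card(2)[OF x SV(1)[OF v]] by linarith
    ultimately obtain m where "m permutes C x v" "evenperm m" "\<forall>u\<in>C x v. \<rho> v (m (\<rho> v (m u))) = u"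
      using even_square_root_correction C_finite_card(1)[OF x SV(1)[OF v]] by blast
    thus ?thesis using False by blast
  qed
  then obtain \<mu> where \<mu>: "\<And>v. v \<in> S x ?n \<Longrightarrow> \<mu> v permutes C x v \<and> evenperm (\<mu> v)"
    and \<mu>id: "\<And>v. v \<in> S x ?n \<Longrightarrow> v \<in> half_tree x b \<union> half_tree x c \<Longrightarrow> \<mu> v = id"
    and \<mu>\<rho>: "\<And>v u. v \<in> S x ?n \<Longrightarrow> v \<notin> half_tree x b \<union> half_tree x c \<Longrightarrow> u \<in> C x v \<Longrightarrow> \<rho> v (\<mu> v (\<rho> v (\<mu> v u))) = u"
    by metis
  obtain m where m: "m \<in> ball_fixer ?n x" "\<And>v u. v \<in> S x ?n \<Longrightarrow> u \<in> C x v \<Longrightarrow> m u = \<mu> v u"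
    using full_family[OF x \<mu>] by blast
  define s where "s = t \<circ> m"
  have mB: "m v = v" if "v \<in> B x ?n" for v using ball_fixer_D(2)[OF m(1)] that by (simp add: B_def)
  have sB: "s v = t v" if "v \<in> B x ?n" for v using mB[OF that] by (simp add: s_def)
  have xB: "x \<in> B x ?n" using x by (simp add: B_def)
  have sH: "s \<in> H" "s x = x" unfolding s_def using H_comp[OF tH(1) ball_fixer_D(1)[OF m(1)]] mB[OF xB] tH by auto
  have mC: "m u \<in> C x v" if "v \<in> S x ?n" "u \<in> C x v" for u v
    using m(2)[OF that] \<mu>[OF that(1)] that(2) permutes_in_image by metis
  have inv1: "s (s u) = u \<and> s u \<in> C x v"
    if v: "v \<in> S x ?n" "v \<in> half_tree x e" "e \<in> N x - {a, b, c}" and u: "u \<in> C x v" for v e u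
  proof -
    have tv: "t v = v" using t1[OF v(3,2) SV(2)[OF v(1)]] .
    have nb: "v \<notin> half_tree x b \<union> half_tree x c" "v \<notin> half_tree x a" using hbne[OF v(2)] v(3) abc by auto
    have su: "s u = \<rho> v (\<mu> v u) \<and> s u \<in> C x v" if "u \<in> C x v" for u
      using mC[OF v(1) that] m(2)[OF v(1) that] nb tC[OF tH v(1) mC[OF v(1) that]] tv by (simp add: s_def \<rho>_def)
    have "s (s u) = \<rho> v (\<mu> v (\<rho> v (\<mu> v u)))" "s u \<in> C x v" using su[OF u] su[of "s u"] by metis+
    thus ?thesis using \<mu>\<rho>[OF v(1) nb(1) u] by simp
  qed
  have inv3: "s (s (s u)) = \<rho> v (\<mu> v u) \<and> s (s (s u)) \<in> C x v"
    if v: "v \<in> S x ?n" "v \<in> half_tree x a" and u: "u \<in> C x v" for v u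
  proof -
    have mu: "m u \<in> C x v" using mC[OF v(1) u] .
    have tv: "t v \<in> S x ?n" "t v \<in> half_tree x b" "t (t v) \<in> S x ?n" "t (t v) \<in> half_tree x c"
      using tS[OF tH] v thb[OF v(2) abc(1)] thb[of "t v" b] abc tabc by auto
    have 1: "s u = t (m u)" "t (m u) \<in> C x (t v)" using tC[OF tH v(1) mu] by (auto simp: s_def)
    have 2: "s (t (m u)) = t (t (m u))" using m(2)[OF tv(1) 1(2)] \<mu>id[OF tv(1)] tv(2) by (simp add: s_def)
    have 3: "t (t (m u)) \<in> C x (t (t v))" using tC[OF tH tv(1) 1(2)] .
    have 4: "s (t (t (m u))) = t (t (t (m u)))" using m(2)[OF tv(3) 3] \<mu>id[OF tv(3)] tv(4) by (simp add: s_def)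
    have 5: "t (t (t (m u))) \<in> C x v" using tC[OF tH tv(3) 3] t3[OF SV(2)[OF v(1)]] by simp
    show ?thesis using 1 2 4 5 mu m(2)[OF v(1) u] v(2) by (simp add: \<rho>_def)
  qed
  have six_a: "(s ^^ 6) u = u" if v: "v \<in> S x ?n" "v \<in> half_tree x a" and u: "u \<in> C x v" for v u
  proof -
    have nb: "v \<notin> half_tree x b \<union> half_tree x c" using hbne[OF v(2)] abc by auto
    have "s (s (s (s (s (s u))))) = \<rho> v (\<mu> v (s (s (s u))))" using inv3[OF v, of "s (s (s u))"] inv3[OF v u] by blast
    hence "s (s (s (s (s (s u))))) = u" using inv3[OF v u] \<mu>\<rho>[OF v(1) nb u] by simp
    thus ?thesis by (simp add: eval_nat_numeral)
  qed
  have six: "(s ^^ 6) u = u" if u: "u \<in> B x (Suc ?n)" for u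
  proof (cases "u \<in> B x ?n")
    case True
    have im: "t v \<in> B x ?n" if "v \<in> B x ?n" for v
      using aut_image_B[OF H_aut[OF tH(1)] x, of ?n] tH(2) that by auto
    show ?thesis using True im t3 by (simp add: eval_nat_numeral sB)
  next
    case False
    then obtain v where v: "v \<in> S x ?n" "u \<in> C x v" using ball_boundary[OF x u] by blast
    obtain e where e: "e \<in> N x" "v \<in> half_tree x e" using half_tree_ex[OF x SV(1,3)[OF v(1)]] .
    \<comment> \<open>Everything over \<open>t e'\<close> is the \<open>s\<close>-image of something
      over \<open>e'\<close>. As \<open>s\<close> commutes with its powers, the branches of
      \<open>b\<close> and \<open>c\<close> reduce to that of \<open>a\<close>.\<close>
    have shift: "\<exists>w v'. v' \<in> S x ?n \<and> v' \<in> half_tree x e' \<and> w \<in> C x v' \<and> u = s w"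
      if v: "v \<in> S x ?n" "v \<in> half_tree x (t e')" "u \<in> C x v" and e': "e' \<in> N x" for u v e'
    proof -
      define v' where "v' = inv' t v"
      have iv: "inv' s \<in> H" "inv' s x = x" "inv' t \<in> H" "inv' t x = x"
        using H_inv sH(1) tH(1) bij_inv_eqI[OF H_bij[OF sH(1)] sH(2)] bij_inv_eqI[OF H_bij[OF tH(1)] tH(2)] by auto
      have v': "v' \<in> S x ?n" unfolding v'_def using tS[OF iv(3,4) v(1)] .
      have "v' \<in> half_tree x (inv' t (t e'))" unfolding v'_def
        using half_tree_image[OF H_aut[OF iv(3)] iv(4) x _ v(2)] N_D(2)[OF e'] tH(1) by simp
      moreover have "s v' = v" using sB[OF SV(2)[OF v']] tH(1) by (simp add: v'_def)
      hence "inv' s v = v'" using bij_inv_eqI[OF H_bij[OF sH(1)]] by blast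
      hence "inv' s u \<in> C x v'" using tC[OF iv(1,2) v(1,3)] by simp
      ultimately show ?thesis using v' sH(1) tH(1)
        by (intro exI[of _ "inv' s u"] exI[of _ v']) simp
    qed
    consider "e = a" | "e = b" | "e = c" | "e \<in> N x - {a, b, c}" using e(1) by blast
    thus ?thesis
    proof cases
      case 1
      thus ?thesis using six_a v e by blast
    next
      case 2
      then obtain w v' where w: "v' \<in> S x ?n" "v' \<in> half_tree x a" "w \<in> C x v'" "u = s w"
        using shift[OF v(1) _ v(2) abc(1)] e tabc by auto
      have "(s ^^ 6) (s w) = s ((s ^^ 6) w)" by (simp add: funpow_swap1)
      thus ?thesis using six_a[OF w(1-3)] w(4) by simp
    next
      case 3
      then obtain w v' where w: "v' \<in> S x ?n" "v' \<in> half_tree x b" "w \<in> C x v'" "u = s w"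
        using shift[OF v(1) _ v(2) abc(2)] e tabc by auto
      then obtain w' v'' where w': "v'' \<in> S x ?n" "v'' \<in> half_tree x a" "w' \<in> C x v''" "w = s w'"
        using shift[OF w(1) _ w(3) abc(1)] tabc by auto
      have "(s ^^ 6) (s (s w')) = s (s ((s ^^ 6) w'))" by (simp add: funpow_swap1)
      thus ?thesis using six_a[OF w'(1-3)] w(4) w'(4) by simp
    next
      case 4
      have "s (s u) = u" using inv1[OF v(1) e(2) 4 v(2)] by blast
      thus ?thesis by (simp add: eval_nat_numeral)
    qed
  qed
  \<comment> \<open>Four is 1 modulo 3 and 0 modulo 2: on the old ball, where the cube of
    \<open>s\<close> is trivial, \<open>s ^^ 4\<close> equals \<open>s\<close>; on the new sphere
    over fixed branches, where \<open>s\<close> is an involution, it is trivial. Its cube is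
    \<open>s ^^ 12\<close>, trivial on the larger ball.\<close>
  define t' where "t' = s ^^ 4"
  have t'H: "t' \<in> H" "t' x = x" unfolding t'_def using sH H_comp by (simp_all add: eval_nat_numeral)
  have t'B: "t' v = t v" if "v \<in> B x ?n" for v
  proof -
    have im: "t v \<in> B x ?n" if "v \<in> B x ?n" for v
      using aut_image_B[OF H_aut[OF tH(1)] x, of ?n] tH(2) that by auto
    show ?thesis using that im t3 by (simp add: t'_def eval_nat_numeral sB)
  qed
  have "t' (t' (t' v)) = v" if "v \<in> B x (Suc ?n)" for v
  proof -
    have "t' (t' (t' v)) = (s ^^ 6) ((s ^^ 6) v)" by (simp add: t'_def eval_nat_numeral)
    thus ?thesis using six[OF that] by simp
  qed
  moreover have "t' v = v" if e: "e \<in> N x - {a, b, c}" and v: "v \<in> half_tree x e" "v \<in> B x (Suc ?n)" for e v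
  proof (cases "v \<in> B x ?n")
    case True
    thus ?thesis using t'B t1[OF e v(1)] by simp
  next
    case False
    then obtain w where w: "w \<in> S x ?n" "v \<in> C x w" using ball_boundary[OF x v(2)] by blast
    obtain e' where e': "e' \<in> N x" "w \<in> half_tree x e'" using half_tree_ex[OF x SV(1,3)[OF w(1)]] .
    have "e' = e" using half_tree_unique[OF x e'(1) _ half_tree_child[OF x e' w(2)] v(1)] e by blast
    hence "s (s v) = v" using inv1[OF w(1) e'(2) _ w(2)] e by blast
    thus ?thesis by (simp add: t'_def eval_nat_numeral)
  qed
  moreover have "t' u = cyc3 a b c u" if "u \<in> N x" for u
    using t'B[of u] tN[OF that] N_D[OF that] by (simp add: B_def)
  ultimately have "rot3 x a b c (Suc ?n) t'" using t'H unfolding rot3_def by blast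
  thus ?thesis using t'B by blast
qed

text \<open>Any element inducing the 3-cycle on \<open>N x\<close> and fixing \<open>x\<close> has
  order three on the ball of radius one. The refinements by \<open>rot3_step\<close> agree on
  growing balls, so their limit exists in \<open>H\<close>.\<close>

lemma ex_rot3:
  assumes x: "x \<in> V" and abc: "a \<in> N x" "b \<in> N x" "c \<in> N x" "a \<noteq> b" "b \<noteq> c" "a \<noteq> c"
  obtains t where "t \<in> H" "t x = x" "\<And>u. u \<in> N x \<Longrightarrow> t u = cyc3 a b c u"
    "\<And>v. v \<in> V \<Longrightarrow> t (t (t v)) = v" "\<And>e v. e \<in> N x - {a, b, c} \<Longrightarrow> v \<in> half_tree x e \<Longrightarrow> t v = v"
proof -
  obtain t0 where t0: "t0 \<in> H" "t0 x = x" "\<forall>u\<in>N x. t0 u = cyc3 a b c u"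
    using H_local[OF x cyc3_permutes[OF abc(1-3)] evenperm_cyc3[OF abc(4,5)]] by blast
  have B1: "v = x \<or> v \<in> N x" if "v \<in> B x (Suc 0)" for v
    using that d_1[OF x, of v] d_zero_iff[OF x, of v] by (auto simp: B_def N_def le_Suc_eq)
  have "t0 (t0 (t0 v)) = v" if v: "v \<in> B x (Suc 0)" for v
  proof -
    have "cyc3 a b c u \<in> N x" if "u \<in> N x" for u
      using that permutes_in_image[OF cyc3_permutes[OF abc(1-3)]] by simp
    thus ?thesis using B1[OF v] t0 abc by (auto simp: cyc3_apply)
  qed
  moreover have "t0 v = v" if "e \<in> N x - {a, b, c}" "v \<in> half_tree x e" "v \<in> B x (Suc 0)" for e v
  proof -
    have "v \<in> N x" using B1[OF that(3)] half_tree_not_centre[OF x that(2)] by blast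
    moreover from this have "v = e" using half_tree_unique[OF x _ _ half_tree_self[OF x]] that by blast
    ultimately show ?thesis using t0(3) that(1) abc by (auto simp: cyc3_apply)
  qed
  ultimately have r0: "rot3 x a b c (Suc 0) t0" using t0 unfolding rot3_def by blast
  obtain f where f: "f 0 = t0" "\<And>n. rot3 x a b c (Suc n) (f n)" "\<And>n. \<forall>v\<in>B x (Suc n). f (Suc n) v = f n v"
  proof -
    \<comment> \<open>Dependent choice does not prescribe the first term; the clause for
      \<open>n = 0\<close> in the predicate pins it to \<open>t0\<close>.\<close>
    have "\<exists>f. f 0 = t0 \<and> (\<forall>n. rot3 x a b c (Suc n) (f n)) \<and> (\<forall>n. \<forall>v\<in>B x (Suc n). f (Suc n) v = f n v)"
      using r0 rot3_step[OF x abc]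
        dependent_nat_choice[of "\<lambda>n t. rot3 x a b c (Suc n) t \<and> (n = 0 \<longrightarrow> t = t0)" "\<lambda>n t t'. \<forall>v\<in>B x (Suc n). t' v = t v"]
      by (metis nat.distinct(1))
    thus thesis using that by blast
  qed
  have fH: "f n \<in> H" "f n x = x" for n using f(2)[of n] by (auto simp: rot3_def)
  have step: "f (Suc n) v = f n v" if "v \<in> B x n" for n v
    using f(3)[of n] that ball_mono[of n "Suc n" x] by auto
  obtain s where s: "s \<in> H" "\<And>n v. v \<in> B x n \<Longrightarrow> s v = f n v" using sequence_limit[where t = f, OF x fH step] by metis
  have inB: "v \<in> B x (d x v)" if "v \<in> V" for v using that by (simp add: B_def)
  show thesis
  proof (rule that[OF s(1)])
    show "s x = x" using s(2)[of x 0] fH x by (simp add: B_def)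
    show "s u = cyc3 a b c u" if "u \<in> N x" for u
      using s(2)[of u 1] f(2)[of 1] N_D[OF that] that by (simp add: B_def rot3_def)
    show "s (s (s v)) = v" if "v \<in> V" for v
    proof -
      let ?n = "d x v"
      have im: "f ?n u \<in> B x ?n" if "u \<in> B x ?n" for u
        using aut_image_B[OF H_aut[OF fH(1)[of ?n]] x, of ?n] fH(2)[of ?n] that by auto
      have "v \<in> B x (Suc ?n)" using that by (simp add: B_def)
      hence "f ?n (f ?n (f ?n v)) = v" using f(2)[of ?n] by (simp add: rot3_def)
      thus ?thesis using s(2)[of _ ?n] im inB[OF that] by simp
    qed
    show "s v = v" if "e \<in> N x - {a, b, c}" "v \<in> half_tree x e" for e v
    proof -
      let ?n = "d x v"
      have "v \<in> B x (Suc ?n)" using half_tree_V[OF that(2)] by (simp add: B_def)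
      hence "f ?n v = v" using f(2)[of ?n] that by (auto simp: rot3_def)
      thus ?thesis using s(2)[OF inB[OF half_tree_V[OF that(2)]]] by simp
    qed
  qed
qed

section \<open>Coherent identifications of the branches at a vertex\<close>

text \<open>\<open>Delta x y \<Theta>\<close> acts on the union of the branches at \<open>x\<close>, identified by \<open>\<Theta>\<close> with
  \<open>N x \<times> half_tree x y\<close>, through its action on \<open>N x\<close> alone.\<close>

definition Delta :: "'a \<Rightarrow> 'a \<Rightarrow> ('a \<Rightarrow> 'a \<Rightarrow> 'a) \<Rightarrow> ('a \<Rightarrow> 'a) set" where
  "Delta x y \<Theta> = {h \<in> H. h x = x \<and> evenperm (restrict_id h (N x)) \<and>
     (\<forall>a\<in>N x. \<forall>v\<in>half_tree x y. h (\<Theta> a v) = \<Theta> (h a) v)}"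

lemma H_fix_N: "h \<in> H \<Longrightarrow> h x = x \<Longrightarrow> h ` N x = N x"
  using aut_N H_aut by metis

lemma perm_restrict:
  assumes "h \<in> H" "h ` X = X" shows "restrict_id h X permutes X"
  using assms H_bij[OF assms(1)]
  by (intro permutes_restrict_id bij_betw_imageI) (auto intro: inj_on_subset simp: bij_def)

lemma Delta_group:
  assumes x: "x \<in> V" shows "perm_group (Delta x y \<Theta>)"
proof (rule perm_groupI)
  have fin: "finite (N x)" using N_finite_card(1)[OF x] .
  have D: "h \<in> H" "h x = x" "h ` N x = N x" "evenperm (restrict_id h (N x))"
    "a \<in> N x \<Longrightarrow> v \<in> half_tree x y \<Longrightarrow> h (\<Theta> a v) = \<Theta> (h a) v" if "h \<in> Delta x y \<Theta>" for h a v
    using that H_fix_N by (auto simp: Delta_def)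
  have comp: "restrict_id (g \<circ> h) (N x) = restrict_id g (N x) \<circ> restrict_id h (N x)" if "h ` N x = N x" for g h
    using that by (auto simp: fun_eq_iff restrict_id_def)
  have perm: "permutation (restrict_id h (N x))" if "h \<in> H" "h x = x" for h
    using perm_restrict[OF that(1) H_fix_N[OF that]] fin permutation_permutes by blast
  have "restrict_id id (N x) = id" by (auto simp: restrict_id_def fun_eq_iff)
  thus "id \<in> Delta x y \<Theta>" using H_id by (simp add: Delta_def)
  show "bij h" if "h \<in> Delta x y \<Theta>" for h using H_bij D(1)[OF that] .
  show "g \<circ> h \<in> Delta x y \<Theta>" if gh: "g \<in> Delta x y \<Theta>" "h \<in> Delta x y \<Theta>" for g h
  proof -
    have "evenperm (restrict_id (g \<circ> h) (N x))"
      unfolding comp[OF D(3)[OF gh(2)]] using D(4) gh perm D(1,2) by (simp add: evenperm_comp)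
    moreover have "(g \<circ> h) (\<Theta> a v) = \<Theta> ((g \<circ> h) a) v" if "a \<in> N x" "v \<in> half_tree x y" for a v
      using D(5)[OF gh(2) that] D(5)[OF gh(1) _ that(2), of "h a"] D(3)[OF gh(2)] that(1) by auto
    ultimately show ?thesis using H_comp[OF D(1)[OF gh(1)] D(1)[OF gh(2)]] D(2)[OF gh(1)] D(2)[OF gh(2)]
      unfolding Delta_def by auto
  qed
  show "inv' h \<in> Delta x y \<Theta>" if h: "h \<in> Delta x y \<Theta>" for h
  proof -
    have iH: "inv' h \<in> H" "inv' h x = x" using H_inv D[OF h] bij_inv_eqI[OF H_bij] by auto
    have "restrict_id h (N x) \<circ> restrict_id (inv' h) (N x) = id"
      using comp[OF H_fix_N[OF iH], of h] D(1)[OF h] by (auto simp: fun_eq_iff restrict_id_def)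
    hence "evenperm (restrict_id h (N x) \<circ> restrict_id (inv' h) (N x))" by simp
    hence "evenperm (restrict_id (inv' h) (N x))"
      using perm[OF D(1,2)[OF h]] perm[OF iH] D(4)[OF h] by (simp add: evenperm_comp)
    moreover have "inv' h (\<Theta> a v) = \<Theta> (inv' h a) v" if "a \<in> N x" "v \<in> half_tree x y" for a v
    proof (rule bij_inv_eqI[OF H_bij[OF D(1)[OF h]]])
      have "inv' h a \<in> N x" using H_fix_N[OF iH] that(1) by blast
      thus "h (\<Theta> (inv' h a) v) = \<Theta> a v" using D(5)[OF h _ that(2)] D(1)[OF h] by simp
    qed
    ultimately show ?thesis using iH unfolding Delta_def by blast
  qed
qed

text \<open>Conjugates of one element \<open>t\<close> acting as \<open>(y q c)\<close> give elements acting as \<open>(y q e)\<close>, all of which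
  agree with \<open>t\<close> on the branch of \<open>y\<close>.\<close>

lemma ex_Theta:
  assumes xy: "adj x y"
  obtains \<Theta> where "\<And>a. a \<in> N x \<Longrightarrow> \<Theta> a \<in> H \<and> \<Theta> a x = x \<and> \<Theta> a y = a" "\<Theta> y = id"
    "rich (Delta x y \<Theta>) (N x)"
proof -
  have x: "x \<in> V" and yN: "y \<in> N x" using xy adj_V by (auto simp: N_def)
  have card: "card (N x) \<ge> 6" and fin: "finite (N x)" using N_finite_card[OF x] by auto
  obtain q where q: "q \<in> N x" "q \<noteq> y" using obtain_not_in[of "[y]" "N x"] card by auto
  obtain c where c: "c \<in> N x" "c \<noteq> y" "c \<noteq> q" using obtain_not_in[of "[y, q]" "N x"] card by auto
  obtain t where t: "t \<in> H" "t x = x" and tN: "\<And>u. u \<in> N x \<Longrightarrow> t u = cyc3 y q c u"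
    and t3: "\<And>v. v \<in> V \<Longrightarrow> t (t (t v)) = v" and t1: "\<And>e v. e \<in> N x - {y, q, c} \<Longrightarrow> v \<in> half_tree x e \<Longrightarrow> t v = v"
    using ex_rot3[OF x yN q(1) c(1) q(2)[symmetric] c(3)[symmetric] c(2)[symmetric]] by blast
  define P where "P f s \<longleftrightarrow> s \<in> H \<and> s x = x \<and> (\<forall>u\<in>N x. s u = cyc3 y q f u) \<and> (\<forall>v\<in>V. s (s (s v)) = v) \<and>
      (\<forall>e\<in>N x - {y, q, f}. \<forall>v\<in>half_tree x e. s v = v) \<and> (\<forall>v\<in>half_tree x y. s v = t v)" for f s
  have "\<exists>s. P f s" if f: "f \<in> N x - {y, q}" for f
  proof (cases "f = c")
    case True
    thus ?thesis using t tN t3 t1 by (intro exI[of _ t]) (auto simp: P_def)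
  next
    case False
    \<comment> \<open>\<open>e0\<close> completes the move from \<open>c\<close> to \<open>f\<close>
      to a 3-cycle, so the conjugating element can be taken trivial on the branches of
      \<open>y\<close> and \<open>q\<close>; conjugation then leaves \<open>t\<close> unchanged from
      the first to the second.\<close>
    obtain e0 where e0: "e0 \<in> N x" "e0 \<notin> {y, q, c, f}"
      using obtain_not_in[of "[y, q, c, f]" "N x"] card by auto
    obtain k where k: "k \<in> H" "k x = x" and kN: "\<And>u. u \<in> N x \<Longrightarrow> k u = cyc3 c f e0 u"
      and k1: "\<And>e v. e \<in> N x - {c, f, e0} \<Longrightarrow> v \<in> half_tree x e \<Longrightarrow> k v = v"
    proof -
      have "f \<in> N x" "c \<noteq> f" "f \<noteq> e0" "c \<noteq> e0" using f e0 False by auto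
      from ex_rot3[OF x c(1) this(1) e0(1) this(2,3,4)] obtain k where k: "k \<in> H" "k x = x"
        "\<And>u. u \<in> N x \<Longrightarrow> k u = cyc3 c f e0 u"
        "\<And>e v. e \<in> N x - {c, f, e0} \<Longrightarrow> v \<in> half_tree x e \<Longrightarrow> k v = v" by metis
      show thesis by (rule that[OF k])
    qed
    have ik: "inv' k u = v" if "k v = u" for u v using bij_inv_eqI[OF H_bij[OF k(1)] that] .
    have ne: "c \<noteq> f" "f \<noteq> e0" "c \<noteq> e0" "f \<in> N x" "f \<noteq> y" "f \<noteq> q" "e0 \<noteq> y" "e0 \<noteq> q" using f e0 False by auto
    have kc: "k y = y" "k q = q" "k c = f"
      unfolding kN[OF yN] kN[OF q(1)] kN[OF c(1)] cyc3_apply[OF ne(1,2,3)] using c(2,3) ne by simp_all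
    define s where "s = k \<circ> t \<circ> inv' k"
    have bt: "k \<circ> cyc3 y q c \<circ> inv' k = cyc3 y q f"
      using cyc3_conj[OF H_bij[OF k(1)], of y q c] q c kc by simp
    have ikN: "inv' k u \<in> N x" if "u \<in> N x" for u
      using H_fix_N[OF H_inv[OF k(1)] ik[OF k(2)]] that by blast
    have sN: "s u = cyc3 y q f u" if "u \<in> N x" for u
      using tN[OF ikN[OF that]] fun_cong[OF bt, of u] by (simp add: s_def)
    have s1: "s v = v" if e: "e \<in> N x - {y, q, f}" and v: "v \<in> half_tree x e" for e v
    proof -
      have "inv' k e \<in> N x - {y, q, c}"
      proof -
        have "inv' k e = u \<Longrightarrow> k u = e" for u using k(1) by auto
        thus ?thesis using ikN[of e] e kc by auto
      qed
      moreover have "inv' k v \<in> half_tree x (inv' k e)"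
        using half_tree_image[OF H_aut[OF H_inv[OF k(1)]] ik[OF k(2)] x _ v] N_D(2) e by blast
      ultimately have "t (inv' k v) = inv' k v" by (rule t1)
      thus ?thesis using k(1) by (simp add: s_def)
    qed
    have sy: "s v = t v" if v: "v \<in> half_tree x y" for v
    proof -
      have "k v = v" using k1[OF _ v] yN c f e0 by auto
      hence "s v = k (t v)" using ik[of v v] by (simp add: s_def)
      moreover have "t v \<in> half_tree x (t y)" using half_tree_image[OF H_aut[OF t(1)] t(2) x _ v] N_D(2)[OF yN] by blast
      moreover have "t y = q" using tN[OF yN] q c by (auto simp: cyc3_apply)
      ultimately show ?thesis using k1[of q "t v"] q c f e0 by auto
    qed
    have "s (s (s v)) = v" if "v \<in> V" for v
      using t3[of "inv' k v"] that k(1) H_inv[OF k(1)] by (simp add: s_def)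
    moreover have "s \<in> H" "s x = x" unfolding s_def using H_comp H_inv k t ik[OF k(2)] by auto
    ultimately show ?thesis using sN s1 sy unfolding P_def by blast
  qed
  then obtain \<tau> where P: "\<And>f. f \<in> N x - {y, q} \<Longrightarrow> P f (\<tau> f)" by metis
  have \<tau>: "\<And>f. f \<in> N x - {y, q} \<Longrightarrow> \<tau> f \<in> H \<and> \<tau> f x = x"
    and \<tau>N: "\<And>f u. f \<in> N x - {y, q} \<Longrightarrow> u \<in> N x \<Longrightarrow> \<tau> f u = cyc3 y q f u"
    and \<tau>3: "\<And>f v. f \<in> N x - {y, q} \<Longrightarrow> v \<in> V \<Longrightarrow> \<tau> f (\<tau> f (\<tau> f v)) = v"
    and \<tau>1: "\<And>f e v. f \<in> N x - {y, q} \<Longrightarrow> e \<in> N x - {y, q, f} \<Longrightarrow> v \<in> half_tree x e \<Longrightarrow> \<tau> f v = v"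
    and \<tau>y: "\<And>f v. f \<in> N x - {y, q} \<Longrightarrow> v \<in> half_tree x y \<Longrightarrow> \<tau> f v = t v"
    using P unfolding P_def by simp_all
  \<comment> \<open>Each \<open>\<tau> a\<close> carries the branch of \<open>y\<close> to that of
    \<open>q\<close> and then to that of \<open>a\<close>. The first step is \<open>t\<close> for
    every \<open>a\<close>, so \<open>\<Theta> q\<close> is unambiguous, and order three makes the
    step back from \<open>a\<close> to \<open>y\<close> agree with
    \<open>\<Theta> y = id\<close>.\<close>
  define \<Theta> where "\<Theta> a = (if a = y then id else if a = q then t else \<tau> a \<circ> \<tau> a)" for a
  have \<Theta>: "\<Theta> a \<in> H \<and> \<Theta> a x = x \<and> \<Theta> a y = a" if a: "a \<in> N x" for a
  proof -
    have "\<tau> a (\<tau> a y) = a" if "a \<noteq> y" "a \<noteq> q"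
      using \<tau>N[of a] yN q a that by (auto simp: cyc3_apply)
    moreover have "t y = q" using tN[OF yN] q c by (auto simp: cyc3_apply)
    moreover have "\<tau> a \<circ> \<tau> a \<in> H" "\<tau> a x = x" if "a \<noteq> y" "a \<noteq> q" using \<tau>[of a] H_comp a that by auto
    ultimately show ?thesis using H_id t by (auto simp: \<Theta>_def)
  qed
  have inD: "\<tau> f \<in> Delta x y \<Theta>" if f: "f \<in> N x - {y, q}" for f
  proof -
    have "restrict_id (\<tau> f) (N x) = cyc3 y q f"
      using \<tau>N[OF f] f yN q by (auto simp: fun_eq_iff restrict_id_def cyc3_apply)
    hence "evenperm (restrict_id (\<tau> f) (N x))" using q f by (auto intro!: evenperm_cyc3)
    moreover have "\<tau> f (\<Theta> a v) = \<Theta> (\<tau> f a) v" if a: "a \<in> N x" and v: "v \<in> half_tree x y" for a v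
    proof -
      consider "a = y" | "a = q" | "a = f" | "a \<in> N x - {y, q, f}" using a by blast
      thus ?thesis
      proof cases
        case 1
        thus ?thesis using \<tau>y[OF f v] \<tau>N[OF f yN] q f by (auto simp: \<Theta>_def cyc3_apply)
      next
        case 2
        thus ?thesis using \<tau>y[OF f v] \<tau>N[OF f q(1)] q f by (auto simp: \<Theta>_def cyc3_apply)
      next
        case 3
        thus ?thesis using \<tau>3[OF f half_tree_V[OF v]] \<tau>N[OF f] q f by (auto simp: \<Theta>_def cyc3_apply)
      next
        case 4
        have "\<Theta> a v \<in> half_tree x (\<Theta> a y)"
          using half_tree_image[OF H_aut _ x N_D(2)[OF yN] v] \<Theta>[OF a] by blast
        hence "\<tau> f (\<Theta> a v) = \<Theta> a v" using \<tau>1[OF f 4] \<Theta>[OF a] by simp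
        moreover have "\<tau> f a = a" using \<tau>N[OF f a] 4 q f by (auto simp: cyc3_apply)
        ultimately show ?thesis by simp
      qed
    qed
    ultimately show ?thesis using \<tau>[OF f] unfolding Delta_def by blast
  qed
  have NX: "h ` N x = N x" if "h \<in> Delta x y \<Theta>" for h using that H_fix_N by (simp add: Delta_def)
  have "\<pi> \<in> induced (Delta x y \<Theta>) (N x)" if p: "\<pi> permutes N x" "evenperm \<pi>" for \<pi>
  proof (rule even_permutes_generated[OF perm_group_induced[OF Delta_group[OF x] NX] fin yN q(1) q(2)[symmetric] _ p])
    show "cyc3 y q f \<in> induced (Delta x y \<Theta>) (N x)" if "f \<in> N x - {y, q}" for f
      using cyc3_permutes[OF yN q(1), of f] that \<tau>N inD unfolding induced_def by blast
  qed
  hence "rich (Delta x y \<Theta>) (N x)" unfolding rich_def induced_def by blast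
  moreover have "\<Theta> y = id" by (simp add: \<Theta>_def)
  ultimately show thesis using that \<Theta> by blast
qed

end

section \<open>A colouring adapted to an edge\<close>

text \<open>Recursion along \<open>p\<close> for functions that are local to a proof. Stage
  \<open>n\<close> of the approximation is final at all points of measure at most
  \<open>n\<close>.\<close>

lemma ex_measure_recursion:
  fixes m :: "'b \<Rightarrow> nat"
  assumes "\<And>v. m v \<noteq> 0 \<Longrightarrow> m (p v) < m v"
  shows "\<exists>i. \<forall>v. i v = (if m v = 0 then b v else s v (i (p v)))"
proof -
  define c where "c = rec_nat b (\<lambda>n f v. if m v = 0 then b v else s v (f (p v)))"
  have c0: "c 0 = b" and cS: "c (Suc n) v = (if m v = 0 then b v else s v (c n (p v)))" for n v
    by (simp_all add: c_def)
  have eq: "c n v = c k v" if "m v \<le> n" "m v \<le> k" for n k v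
    using that
  proof (induction n arbitrary: v k)
    case 0
    thus ?case using c0 cS by (cases k) auto
  next
    case (Suc n)
    show ?case
    proof (cases "m v = 0")
      case True
      thus ?thesis using c0 cS by (cases k) auto
    next
      case False
      then obtain k' where k': "k = Suc k'" using Suc.prems by (cases k) auto
      have "m (p v) \<le> n" "m (p v) \<le> k'" using assms[OF False] Suc.prems k' by auto
      hence "c n (p v) = c k' (p v)" by (rule Suc.IH)
      thus ?thesis using False by (simp add: cS k')
    qed
  qed
  have "c (m v) v = (if m v = 0 then b v else s v (c (m (p v)) (p v)))" for v
  proof (cases "m v")
    case 0
    thus ?thesis using c0 by simp
  next
    case (Suc n)
    have "c n (p v) = c (m (p v)) (p v)" using assms[of v] Suc by (intro eq) auto
    thus ?thesis using Suc by (simp add: cS)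
  qed
  thus ?thesis by (intro exI[of _ "\<lambda>v. c (m v) v"]) blast
qed

lemma ex_even_moving:
  assumes "finite X" "card X \<ge> 3" "a \<in> X" "b \<in> X"
  shows "\<exists>\<pi>. \<pi> permutes X \<and> evenperm \<pi> \<and> \<pi> a = b \<and> (a = b \<longrightarrow> \<pi> = id)"
proof (cases "a = b")
  case True
  thus ?thesis by (intro exI[of _ id]) (auto simp: permutes_id)
next
  case False
  obtain e where e: "e \<in> X" "e \<notin> {a, b}" using obtain_not_in[of "[a, b]" X] assms by auto
  thus ?thesis using assms False
    by (intro exI[of _ "cyc3 a b e"]) (auto simp: cyc3_permutes evenperm_cyc3 cyc3_apply)
qed

context bt_group
begin

definition theta_ok :: "'a \<Rightarrow> 'a \<Rightarrow> ('a \<Rightarrow> 'a \<Rightarrow> 'a) \<Rightarrow> bool" where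
  "theta_ok x y \<Theta> \<longleftrightarrow> (\<forall>a\<in>N x. \<Theta> a \<in> H \<and> \<Theta> a x = x \<and> \<Theta> a y = a) \<and> \<Theta> y = id \<and>
     rich (Delta x y \<Theta>) (N x)"

text \<open>\<open>\<Theta> a\<close> copies the colours from the branch of \<open>y\<close> to that
  of \<open>a\<close>. On the type of \<open>y\<close> they pass through \<open>\<tau> a\<close>,
  because \<open>a\<close> and \<open>y\<close> are neighbours of \<open>x\<close> and need
  different colours when distinct; \<open>\<tau> a\<close> is even so that the copying is even at
  every vertex.\<close>

definition colour_ok :: "'a \<Rightarrow> 'a \<Rightarrow> ('a \<Rightarrow> 'a \<Rightarrow> 'a) \<Rightarrow> ('a \<Rightarrow> nat) \<Rightarrow> bool" where
  "colour_ok x y \<Theta> i \<longleftrightarrow> (\<exists>\<tau>. \<forall>a\<in>N x. \<tau> a permutes {1..card (N x)} \<and> evenperm (\<tau> a) \<and>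
     (\<forall>w\<in>half_tree x y. i (\<Theta> a w) = (if ty w = ty y then \<tau> a (i w) else i w)))"

text \<open>Evenness of \<open>sigma\<close> without an inverse of the colouring: it composes easily
  and makes sense before \<open>i\<close> is known to be bijective on neighbourhoods, a property
  that is itself transported along such maps.\<close>

definition even_at :: "('a \<Rightarrow> nat) \<Rightarrow> ('a \<Rightarrow> 'a) \<Rightarrow> 'a \<Rightarrow> bool" where
  "even_at i h v \<longleftrightarrow> (\<exists>\<sigma>. \<sigma> permutes {1..card (N v)} \<and> evenperm \<sigma> \<and> (\<forall>u\<in>N v. i (h u) = \<sigma> (i u)))"

lemma card_N_aut: "aut h \<Longrightarrow> card (N (h v)) = card (N v)"
  using aut_N[of h v] card_image[OF inj_on_subset[OF bij_is_inj[OF aut_bij]], of h "N v"] by simp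

lemma permutes_interval_permutation: "\<sigma> permutes {1..n::nat} \<Longrightarrow> permutation \<sigma>"
  using permutation_permutes by blast

section \<open>Evenness at a vertex\<close>

lemma even_at_comp:
  assumes "aut h" "even_at i h v" "even_at i g (h v)" shows "even_at i (g \<circ> h) v"
proof -
  obtain \<sigma> where s: "\<sigma> permutes {1..card (N v)}" "evenperm \<sigma>" "\<forall>u\<in>N v. i (h u) = \<sigma> (i u)"
    using assms(2) by (auto simp: even_at_def)
  obtain \<rho> where r: "\<rho> permutes {1..card (N v)}" "evenperm \<rho>" "\<forall>u\<in>N (h v). i (g u) = \<rho> (i u)"
    using assms(3) card_N_aut[OF assms(1)] by (auto simp: even_at_def)
  have "i ((g \<circ> h) u) = (\<rho> \<circ> \<sigma>) (i u)" if "u \<in> N v" for u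
  proof -
    have "h u \<in> N (h v)" using that aut_N[OF assms(1), of v] by blast
    thus ?thesis using s(3) r(3) that by simp
  qed
  moreover have "\<rho> \<circ> \<sigma> permutes {1..card (N v)}" using permutes_compose[OF s(1) r(1)] .
  moreover have "evenperm (\<rho> \<circ> \<sigma>)"
    using s(2) r(2) evenperm_comp[OF permutes_interval_permutation[OF r(1)] permutes_interval_permutation[OF s(1)]] by simp
  ultimately show ?thesis unfolding even_at_def by blast
qed

lemma even_at_inv:
  assumes "aut h" "even_at i h v" shows "even_at i (inv' h) (h v)"
proof -
  obtain \<sigma> where s: "\<sigma> permutes {1..card (N v)}" "evenperm \<sigma>" "\<forall>u\<in>N v. i (h u) = \<sigma> (i u)"
    using assms(2) by (auto simp: even_at_def)
  have "i (inv' h u) = inv' \<sigma> (i u)" if "u \<in> N (h v)" for u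
  proof -
    obtain w where "w \<in> N v" "u = h w" using \<open>u \<in> N (h v)\<close> aut_N[OF assms(1), of v] by blast
    thus ?thesis using s(3) assms(1) permutes_inverses(2)[OF s(1)] by simp
  qed
  moreover have "evenperm (inv' \<sigma>)" using s(2) evenperm_inv[OF permutes_interval_permutation[OF s(1)]] by simp
  ultimately show ?thesis
    using permutes_inv[OF s(1)] card_N_aut[OF assms(1)] unfolding even_at_def by auto
qed

lemma even_at_bij:
  assumes "aut h" "even_at i h v" "bij_betw i (N v) {1..card (N v)}"
  shows "bij_betw i (N (h v)) {1..card (N (h v))}"
proof -
  obtain \<sigma> where s: "\<sigma> permutes {1..card (N v)}" "\<forall>u\<in>N v. i (h u) = \<sigma> (i u)"
    using assms(2) by (auto simp: even_at_def)
  have ih: "bij_betw (inv' h) (N (h v)) (N v)"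
    using aut_N[OF aut_inv[OF assms(1)], of "h v"] assms(1) aut_bij[OF aut_inv[OF assms(1)]]
    by (intro bij_betw_imageI) (auto intro: inj_on_subset simp: bij_def)
  have "bij_betw (\<sigma> \<circ> i \<circ> inv' h) (N (h v)) {1..card (N v)}"
    using bij_betw_trans[OF ih bij_betw_trans[OF assms(3) permutes_imp_bij[OF s(1)]]] by (simp add: o_assoc)
  moreover have "(\<sigma> \<circ> i \<circ> inv' h) u = i u" if "u \<in> N (h v)" for u
  proof -
    obtain w where "w \<in> N v" "u = h w" using \<open>u \<in> N (h v)\<close> aut_N[OF assms(1), of v] by blast
    thus ?thesis using s(2) assms(1) by simp
  qed
  ultimately show ?thesis using bij_betw_cong[of "N (h v)" "\<sigma> \<circ> i \<circ> inv' h" i] card_N_aut[OF assms(1)] by simp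
qed

text \<open>At a fixed vertex the colouring conjugates the action on neighbours to the action on
  colours, so parity does not depend on the colouring.\<close>

lemma even_at_iff_even:
  assumes "v \<in> V" "bij_betw i (N v) {1..card (N v)}" "aut f" "f v = v"
  shows "even_at i f v \<longleftrightarrow> evenperm (restrict_id f (N v))"
proof -
  let ?f = "restrict_id f (N v)"
  let ?m = "map_permutation (N v) i ?f"
  have inj: "inj_on i (N v)" using assms(2) by (rule bij_betw_imp_inj_on)
  have "f ` N v = N v" using aut_N[OF assms(3), of v] assms(4) by simp
  hence p: "?f permutes N v" using aut_bij[OF assms(3)]
    by (intro permutes_restrict_id bij_betw_imageI) (auto intro: inj_on_subset simp: bij_def)
  have mp: "?m permutes {1..card (N v)}" using map_permutation_permutes[OF assms(2) p] .
  have ap: "?m (i u) = i (f u)" if "u \<in> N v" for u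
    using map_permutation_apply[OF inj that, of ?f] that by simp
  have ev: "evenperm ?m = evenperm ?f"
    using evenperm_map_permutation[OF inj p] N_finite_card(1)[OF assms(1)] by blast
  show ?thesis
  proof
    assume "even_at i f v"
    then obtain \<sigma> where s: "\<sigma> permutes {1..card (N v)}" "evenperm \<sigma>" "\<forall>u\<in>N v. i (f u) = \<sigma> (i u)"
      by (auto simp: even_at_def)
    have "\<sigma> c = ?m c" for c
    proof (cases "c \<in> {1..card (N v)}")
      case True
      then obtain u where "u \<in> N v" "c = i u" using bij_betw_imp_surj_on[OF assms(2)] by blast
      thus ?thesis using s(3) ap by simp
    next
      case False
      thus ?thesis using permutes_not_in[OF s(1)] permutes_not_in[OF mp] by simp
    qed
    hence "\<sigma> = ?m" by blast
    thus "evenperm ?f" using s(2) ev by simp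
  next
    assume "evenperm ?f"
    thus "even_at i f v" unfolding even_at_def using mp ev ap by (intro exI[of _ ?m]) simp
  qed
qed

lemma half_tree_neighbour:
  assumes "adj x y" "w \<in> half_tree x y" "u \<in> N w" "u \<noteq> x" shows "u \<in> half_tree x y"
proof -
  have x: "x \<in> V" "y \<in> N x" using assms(1) adj_V by (auto simp: N_def)
  have wu: "adj w u" "adj u w" using assms(3) adj_sym by (auto simp: N_def)
  consider "u \<in> C x w" | "w \<in> C x u" using adj_dist[OF x(1) wu(1)] wu by (auto simp: in_C_iff)
  thus ?thesis
  proof cases
    case 1
    thus ?thesis using half_tree_child[OF x assms(2)] by blast
  next
    case 2
    obtain e where e: "e \<in> N x" "u \<in> half_tree x e" using half_tree_ex[OF x(1) _ assms(4)] wu adj_V by blast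
    have "w \<in> half_tree x e" using half_tree_child[OF x(1) e 2] .
    thus ?thesis using half_tree_unique[OF x(1) e(1) x(2) _ assms(2)] e(2) by blast
  qed
qed

text \<open>The neighbours of \<open>w\<close> share one type, so either all keep their colours or
  all pass through \<open>\<tau> a\<close>. The neighbour \<open>x\<close> of \<open>y\<close> lies
  outside the half tree but is fixed and keeps its colour.\<close>

lemma theta_even_at:
  assumes xy: "adj x y" and th: "theta_ok x y \<Theta>" and col: "colour_ok x y \<Theta> i"
    and a: "a \<in> N x" and w: "w \<in> half_tree x y"
  shows "even_at i (\<Theta> a) w"
proof -
  obtain \<tau> where \<tau>: "\<tau> a permutes {1..card (N x)}" "evenperm (\<tau> a)"
    "\<And>w. w \<in> half_tree x y \<Longrightarrow> i (\<Theta> a w) = (if ty w = ty y then \<tau> a (i w) else i w)"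
    using col a unfolding colour_ok_def by blast
  have ty: "ty x \<noteq> ty y" using adj_ty[OF xy] .
  have \<Theta>x: "\<Theta> a x = x" using th a by (simp add: theta_ok_def)
  have eq: "i (\<Theta> a u) = (if ty u = ty y then \<tau> a (i u) else i u)" if u: "u \<in> N w" for u
    using \<tau>(3) half_tree_neighbour[OF xy w u] \<Theta>x ty by (cases "u = x") auto
  have tyu: "ty u \<noteq> ty w" if "u \<in> N w" for u using adj_ty[of w u] that by (auto simp: N_def)
  show ?thesis
  proof (cases "ty w = ty y")
    case True
    hence "\<forall>u\<in>N w. i (\<Theta> a u) = id (i u)" using eq tyu by auto
    thus ?thesis unfolding even_at_def using permutes_id evenperm_id by blast
  next
    case False
    hence "card (N w) = card (N x)" using N_finite_card(2)[OF half_tree_V[OF w]] N_finite_card(2)[of x] adj_V[OF xy] ty by auto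
    moreover have "\<forall>u\<in>N w. i (\<Theta> a u) = \<tau> a (i u)" using eq tyu False by metis
    ultimately show ?thesis unfolding even_at_def using \<tau>(1,2) by auto
  qed
qed

text \<open>Around a vertex of the branch of \<open>a\<close>, \<open>h\<close> coincides with
  \<open>\<Theta> (h a) \<circ> inv' (\<Theta> a)\<close>, a product of maps even there. At
  \<open>x\<close> evenness is part of the definition of \<open>Delta\<close>.\<close>

lemma Delta_even_at:
  assumes xy: "adj x y" and th: "theta_ok x y \<Theta>" and col: "colour_ok x y \<Theta> i"
    and bij: "bij_betw i (N x) {1..card (N x)}" and h: "h \<in> Delta x y \<Theta>" and v: "v \<in> V"
  shows "even_at i h v"
proof -
  have x: "x \<in> V" and yN: "y \<in> N x" using xy adj_V by (auto simp: N_def)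
  have hH: "h \<in> H" "h x = x" "evenperm (restrict_id h (N x))"
    and h\<Theta>: "\<And>a v. a \<in> N x \<Longrightarrow> v \<in> half_tree x y \<Longrightarrow> h (\<Theta> a v) = \<Theta> (h a) v"
    using h by (auto simp: Delta_def)
  have \<Theta>: "\<And>a. a \<in> N x \<Longrightarrow> \<Theta> a \<in> H \<and> \<Theta> a x = x \<and> \<Theta> a y = a" using th by (simp add: theta_ok_def)
  show ?thesis
  proof (cases "v = x")
    case True
    thus ?thesis using even_at_iff_even[OF x bij H_aut[OF hH(1)] hH(2)] hH(3) by simp
  next
    case False
    obtain a where a: "a \<in> N x" "v \<in> half_tree x a" using half_tree_ex[OF x v False] .
    have ha: "h a \<in> N x" using H_fix_N[OF hH(1,2)] a(1) by blast
    have \<Theta>a: "\<Theta> a \<in> H" "\<Theta> a x = x" "\<Theta> a y = a" using \<Theta>[OF a(1)] by auto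
    define w where "w = inv' (\<Theta> a) v"
    have vw: "v = \<Theta> a w" using \<Theta>a(1) by (simp add: w_def)
    have "w \<in> half_tree x (inv' (\<Theta> a) a)" unfolding w_def
      using half_tree_image[OF H_aut[OF H_inv[OF \<Theta>a(1)]] bij_inv_eqI[OF H_bij[OF \<Theta>a(1)] \<Theta>a(2)] x _ a(2)] N_D(2)[OF a(1)] .
    hence w: "w \<in> half_tree x y" using bij_inv_eqI[OF H_bij[OF \<Theta>a(1)] \<Theta>a(3)] by simp
    have "even_at i (\<Theta> (h a) \<circ> inv' (\<Theta> a)) v"
    proof (rule even_at_comp)
      show "even_at i (inv' (\<Theta> a)) v"
        unfolding vw using even_at_inv[OF H_aut[OF \<Theta>a(1)] theta_even_at[OF xy th col a(1) w]] .
      show "even_at i (\<Theta> (h a)) (inv' (\<Theta> a) v)"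
        using theta_even_at[OF xy th col ha w] by (simp add: w_def)
      show "aut (inv' (\<Theta> a))" using H_aut[OF H_inv[OF \<Theta>a(1)]] .
    qed
    moreover have "(\<Theta> (h a) \<circ> inv' (\<Theta> a)) u = h u" if u: "u \<in> N v" for u
    proof -
      define u' where "u' = inv' (\<Theta> a) u"
      have u'N: "u' \<in> N w" unfolding u'_def w_def
        using aut_N[OF H_aut[OF H_inv[OF \<Theta>a(1)]], of v] u by blast
      have uu: "u = \<Theta> a u'" using \<Theta>a(1) by (simp add: u'_def)
      show ?thesis
      proof (cases "u' = x")
        case True
        hence "u = x" using uu \<Theta>a(2) by simp
        moreover have "inv' (\<Theta> a) u = x" using True by (simp add: u'_def)
        ultimately show ?thesis using \<Theta>[OF ha] hH(2) by simp
      next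
        case False
        hence "u' \<in> half_tree x y" using half_tree_neighbour[OF xy w u'N] by blast
        hence "h (\<Theta> a u') = \<Theta> (h a) u'" using h\<Theta>[OF a(1)] by blast
        thus ?thesis unfolding comp_apply u'_def[symmetric] uu[symmetric] by simp
      qed
    qed
    ultimately show ?thesis unfolding even_at_def by simp
  qed
qed

lemma ex_local_colours:
  assumes "adj x y"
  shows "\<exists>\<beta> \<tau>. bij_betw \<beta> (N x) {1..card (N x)} \<and>
    (\<forall>a\<in>N x. \<tau> a permutes {1..card (N x)} \<and> evenperm (\<tau> a) \<and> \<tau> a (\<beta> y) = \<beta> a) \<and> \<tau> y = id"
proof -
  have x: "x \<in> V" "y \<in> N x" using assms adj_V by (auto simp: N_def)
  obtain \<beta> where \<beta>: "bij_betw \<beta> (N x) {1..card (N x)}"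
    using N_finite_card(1)[OF x(1)] finite_same_card_bij[of "N x" "{1..card (N x)}"] by auto
  \<comment> \<open>The last clause makes \<open>\<tau> y\<close> the identity, to match
    \<open>\<Theta> y = id\<close>.\<close>
  have "\<exists>\<pi>. \<pi> permutes {1..card (N x)} \<and> evenperm \<pi> \<and> \<pi> (\<beta> y) = \<beta> a \<and> (\<beta> y = \<beta> a \<longrightarrow> \<pi> = id)" if "a \<in> N x" for a
    using N_finite_card(3)[OF x(1)] bij_betwE[OF \<beta>] that x(2) by (intro ex_even_moving) auto
  then obtain \<tau> where "\<forall>a\<in>N x. \<tau> a permutes {1..card (N x)} \<and> evenperm (\<tau> a) \<and> \<tau> a (\<beta> y) = \<beta> a \<and> (\<beta> y = \<beta> a \<longrightarrow> \<tau> a = id)"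
    by metis
  thus ?thesis using \<beta> x(2) by blast
qed

text \<open>Distances to \<open>x\<close> are kept, and on the branch of \<open>y\<close> the end
  \<open>y\<close> is one step nearer: this is the descent behind the recursion for the
  colours.\<close>

lemma theta_pullback:
  assumes xy: "adj x y" and th: "theta_ok x y \<Theta>" and a: "a \<in> N x" "v \<in> half_tree x a"
  shows "inv' (\<Theta> a) v \<in> half_tree x y" "d y (inv' (\<Theta> a) v) < d x v" "\<Theta> a (inv' (\<Theta> a) v) = v"
proof -
  have x: "x \<in> V" "y \<in> V" using xy adj_V by auto
  have \<Theta>a: "\<Theta> a \<in> H" "\<Theta> a x = x" "\<Theta> a y = a" using th a(1) by (auto simp: theta_ok_def)
  have i: "inv' (\<Theta> a) x = x" "inv' (\<Theta> a) a = y" using bij_inv_eqI[OF H_bij[OF \<Theta>a(1)] \<Theta>a(2)] bij_inv_eqI[OF H_bij[OF \<Theta>a(1)] \<Theta>a(3)] by auto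
  show m: "inv' (\<Theta> a) v \<in> half_tree x y"
    using half_tree_image[OF H_aut[OF H_inv[OF \<Theta>a(1)]] i(1) x(1) _ a(2)] N_D(2)[OF a(1)] i(2) by simp
  have "d x (inv' (\<Theta> a) v) = d x v" using H_d[OF H_inv[OF \<Theta>a(1)] x(1) half_tree_V[OF a(2)]] i(1) by simp
  thus "d y (inv' (\<Theta> a) v) < d x v" using m by (simp add: half_tree_def)
  show "\<Theta> a (inv' (\<Theta> a) v) = v" using \<Theta>a(1) by simp
qed

text \<open>Removing the edge \<open>{x, y}\<close> leaves two half trees. The colours on the half tree of \<open>x\<close> are
  transported by \<open>\<Theta>\<close> from the half tree of \<open>y\<close>, where the distance to the edge is smaller, and vice versa by \<open>\<Phi>\<close>.\<close>

lemma ex_colouring: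
  assumes xy: "adj x y" and th: "theta_ok x y \<Theta>" "theta_ok y x \<Phi>"
  obtains i where "\<And>v. v \<in> V \<Longrightarrow> bij_betw i (N v) {1..card (N v)}" "colour_ok x y \<Theta> i" "colour_ok y x \<Phi> i"
proof -
  have yx: "adj y x" using xy adj_sym by blast
  have x: "x \<in> V" "y \<in> V" "y \<in> N x" "x \<in> N y" using xy yx adj_V by (auto simp: N_def)
  have \<Theta>: "\<Theta> a \<in> H" "\<Theta> a x = x" "\<Theta> a y = a" if "a \<in> N x" for a using th(1) that by (auto simp: theta_ok_def)
  have \<Phi>: "\<Phi> b \<in> H" "\<Phi> b y = y" "\<Phi> b x = b" if "b \<in> N y" for b using th(2) that by (auto simp: theta_ok_def)
  have id: "\<Theta> y = id" "\<Phi> x = id" using th by (auto simp: theta_ok_def)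
  obtain \<beta>x \<tau>x where bx: "bij_betw \<beta>x (N x) {1..card (N x)}"
    and tx: "\<And>a. a \<in> N x \<Longrightarrow> \<tau>x a permutes {1..card (N x)} \<and> evenperm (\<tau>x a) \<and> \<tau>x a (\<beta>x y) = \<beta>x a" "\<tau>x y = id"
    using ex_local_colours[OF xy] by blast
  obtain \<beta>y \<tau>y where by': "bij_betw \<beta>y (N y) {1..card (N y)}"
    and ty': "\<And>b. b \<in> N y \<Longrightarrow> \<tau>y b permutes {1..card (N y)} \<and> evenperm (\<tau>y b) \<and> \<tau>y b (\<beta>y x) = \<beta>y b" "\<tau>y x = id"
    using ex_local_colours[OF yx] by blast
  define br where "br z v = (SOME e. e \<in> N z \<and> v \<in> half_tree z e)" for z v
  have br: "br z v = e" if "z \<in> V" "e \<in> N z" "v \<in> half_tree z e" for z v e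
    unfolding br_def by (rule some_equality) (use that half_tree_unique in auto)
  \<comment> \<open>\<open>half_tree y x\<close> is the side of \<open>x\<close>, so this is the
    distance to the end of the edge on the same side. Outside the tree the value 0 stops the
    recursion.\<close>
  define m where "m v = (if v \<notin> V then 0 else if v \<in> half_tree y x then d x v else d y v)" for v
  define p where "p v = (if v \<in> half_tree y x then inv' (\<Theta> (br x v)) v else inv' (\<Phi> (br y v)) v)" for v
  define s where "s v c = (if v \<in> half_tree y x then (if ty v = ty y then \<tau>x (br x v) c else c)
      else (if ty v = ty x then \<tau>y (br y v) c else c))" for v c
  have caseX: "\<exists>a\<in>N x. v \<in> half_tree x a \<and> br x v = a \<and> a \<noteq> y" if v: "v \<in> V" "v \<in> half_tree y x" "v \<noteq> x" for v
  proof -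
    obtain a where a: "a \<in> N x" "v \<in> half_tree x a" using half_tree_ex[OF x(1) v(1,3)] .
    have "a \<noteq> y" using a(2) v(1,2) half_tree_complement[OF xy v(1)] by blast
    thus ?thesis using a br[OF x(1) a] by blast
  qed
  have caseY: "\<exists>b\<in>N y. v \<in> half_tree y b \<and> br y v = b \<and> b \<noteq> x" if v: "v \<in> V" "v \<notin> half_tree y x" "v \<noteq> y" for v
  proof -
    obtain b where b: "b \<in> N y" "v \<in> half_tree y b" using half_tree_ex[OF x(2) v(1,3)] .
    thus ?thesis using v(2) br[OF x(2) b] by blast
  qed
  have m_Y: "m v = d y v" if "v \<in> half_tree x y" for v
    using that half_tree_V[OF that] half_tree_complement[OF xy, of v] by (simp add: m_def)
  have m_X: "m v = d x v" if "v \<in> half_tree y x" for v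
    using that half_tree_V[OF that] by (simp add: m_def)
  have pX: "p v \<in> half_tree x y" "m (p v) < m v" "\<exists>a\<in>N x. v = \<Theta> a (p v)" if v: "v \<in> V" "v \<in> half_tree y x" "v \<noteq> x" for v
  proof -
    obtain a where a: "a \<in> N x" "v \<in> half_tree x a" "br x v = a" using caseX[OF v] by blast
    have pv: "p v = inv' (\<Theta> a) v" using v(2) a(3) by (simp add: p_def)
    note t = theta_pullback[OF xy th(1) a(1,2)]
    show "p v \<in> half_tree x y" using t(1) pv by simp
    show "m (p v) < m v" using t(2) m_Y[OF t(1)] m_X[OF v(2)] pv by simp
    show "\<exists>a\<in>N x. v = \<Theta> a (p v)" using t(3) pv a(1) by metis
  qed
  have pY: "p v \<in> half_tree y x" "m (p v) < m v" "\<exists>b\<in>N y. v = \<Phi> b (p v)" if v: "v \<in> V" "v \<notin> half_tree y x" "v \<noteq> y" for v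
  proof -
    obtain b where b: "b \<in> N y" "v \<in> half_tree y b" "br y v = b" using caseY[OF v] by blast
    have pv: "p v = inv' (\<Phi> b) v" using v(2) b(3) by (simp add: p_def)
    note t = theta_pullback[OF yx th(2) b(1,2)]
    show "p v \<in> half_tree y x" using t(1) pv by simp
    show "m (p v) < m v" using t(2) m_X[OF t(1)] v pv by (simp add: m_def)
    show "\<exists>b\<in>N y. v = \<Phi> b (p v)" using t(3) pv b(1) by metis
  qed
  have m0: "v = x \<or> v = y" if "m v = 0" "v \<in> V" for v
    using that d_zero_iff[OF x(1)] d_zero_iff[OF x(2)] by (auto simp: m_def split: if_splits)
  have mxy: "m x = 0" "m y = 0" using m_X[OF half_tree_self[OF x(2,4)]] m_Y[OF half_tree_self[OF x(1,3)]] x by auto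
  have mV: "v \<in> V" if "m v \<noteq> 0" for v using that by (auto simp: m_def split: if_splits)
  have dec: "m (p v) < m v" if "m v \<noteq> 0" for v
    using pX(2)[OF mV[OF that]] pY(2)[OF mV[OF that]] mxy that by metis
  \<comment> \<open>The initial values cross over: \<open>y\<close> is coloured as a neighbour of
    \<open>x\<close>, and \<open>x\<close> as a neighbour of \<open>y\<close>.\<close>
  obtain i where i: "\<And>v. i v = (if m v = 0 then (if v = y then \<beta>x y else \<beta>y x) else s v (i (p v)))"
    using ex_measure_recursion[of m p "\<lambda>v. if v = y then \<beta>x y else \<beta>y x" s] dec by blast
  have ixy: "i y = \<beta>x y" "i x = \<beta>y x" using i[of y] i[of x] mxy adj_neq[OF xy] by auto
  have E1: "i (\<Theta> a w) = (if ty w = ty y then \<tau>x a (i w) else i w)" if a: "a \<in> N x" and w: "w \<in> half_tree x y" for a w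
  proof (cases "a = y")
    case True
    thus ?thesis using id tx(2) by simp
  next
    case False
    define v where "v = \<Theta> a w"
    have v: "v \<in> half_tree x a" unfolding v_def
      using half_tree_image[OF H_aut[OF \<Theta>(1)[OF a]] \<Theta>(2)[OF a] x(1,2) w] \<Theta>(3)[OF a] by simp
    have vy: "v \<in> half_tree y x"
      using half_tree_complement[OF xy half_tree_V[OF v]] half_tree_unique[OF x(1) a x(3) v] False by blast
    have "v \<noteq> x" using half_tree_not_centre[OF x(1) v] .
    hence "m v \<noteq> 0" using m_X[OF vy] d_zero_iff[OF x(1) half_tree_V[OF v]] by auto
    moreover have "p v = w" using vy br[OF x(1) a v] bij_inv_eqI[OF H_bij[OF \<Theta>(1)[OF a]], of w v]
      by (simp add: p_def v_def)
    moreover have "ty v = ty w" unfolding v_def using H_ty[OF \<Theta>(1)[OF a] half_tree_V[OF w]] .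
    ultimately have "i v = (if ty w = ty y then \<tau>x a (i w) else i w)"
      using i[of v] vy br[OF x(1) a v] by (simp add: s_def)
    thus ?thesis by (simp add: v_def)
  qed
  have E2: "i (\<Phi> b w) = (if ty w = ty x then \<tau>y b (i w) else i w)" if b: "b \<in> N y" and w: "w \<in> half_tree y x" for b w
  proof (cases "b = x")
    case True
    thus ?thesis using id ty'(2) by simp
  next
    case False
    define v where "v = \<Phi> b w"
    have v: "v \<in> half_tree y b" unfolding v_def
      using half_tree_image[OF H_aut[OF \<Phi>(1)[OF b]] \<Phi>(2)[OF b] x(2,1) w] \<Phi>(3)[OF b] by simp
    have vy: "v \<notin> half_tree y x" using half_tree_unique[OF x(2) b x(4) v] False by blast
    have "v \<noteq> y" using half_tree_not_centre[OF x(2) v] .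
    hence "m v \<noteq> 0" using vy d_zero_iff[OF x(2) half_tree_V[OF v]] half_tree_V[OF v] by (auto simp: m_def)
    moreover have "p v = w" using vy br[OF x(2) b v] bij_inv_eqI[OF H_bij[OF \<Phi>(1)[OF b]], of w v]
      by (simp add: p_def v_def)
    moreover have "ty v = ty w" unfolding v_def using H_ty[OF \<Phi>(1)[OF b] half_tree_V[OF w]] .
    ultimately have "i v = (if ty w = ty x then \<tau>y b (i w) else i w)"
      using i[of v] vy br[OF x(2) b v] by (simp add: s_def)
    thus ?thesis by (simp add: v_def)
  qed
  have col: "colour_ok x y \<Theta> i" "colour_ok y x \<Phi> i"
    unfolding colour_ok_def using tx(1) ty'(1) E1 E2 by blast+
  have "i a = \<beta>x a" if "a \<in> N x" for a
    using E1[OF that half_tree_self[OF x(1,3)]] \<Theta>(3)[OF that] ixy tx(1)[OF that] by simp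
  hence ix: "bij_betw i (N x) {1..card (N x)}" using bx bij_betw_cong by blast
  have "i b = \<beta>y b" if "b \<in> N y" for b
    using E2[OF that half_tree_self[OF x(2,4)]] \<Phi>(3)[OF that] ixy ty'(1)[OF that] by simp
  hence iy: "bij_betw i (N y) {1..card (N y)}" using by' bij_betw_cong by blast
  \<comment> \<open>Away from the edge, the neighbourhood of \<open>v\<close> is the image of that
    of \<open>p v\<close> under a map even at \<open>p v\<close>, so bijectivity follows the
    recursion.\<close>
  have "bij_betw i (N v) {1..card (N v)}" if "v \<in> V" for v
    using that
  proof (induction "m v" arbitrary: v rule: less_induct)
    case less
    consider "v = x" | "v = y" | "v \<in> half_tree y x" "v \<noteq> x" | "v \<notin> half_tree y x" "v \<noteq> y" by blast
    thus ?case
    proof cases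
      case 3
      obtain a where a: "a \<in> N x" "v = \<Theta> a (p v)" using pX(3)[OF less.prems 3] by blast
      have w: "p v \<in> half_tree x y" using pX(1)[OF less.prems 3] .
      have "bij_betw i (N (p v)) {1..card (N (p v))}"
        by (rule less.hyps[OF pX(2)[OF less.prems 3] half_tree_V[OF w]])
      thus ?thesis using even_at_bij[OF H_aut[OF \<Theta>(1)[OF a(1)]] theta_even_at[OF xy th(1) col(1) a(1) w]] a(2) by simp
    next
      case 4
      obtain b where b: "b \<in> N y" "v = \<Phi> b (p v)" using pY(3)[OF less.prems 4] by blast
      have w: "p v \<in> half_tree y x" using pY(1)[OF less.prems 4] .
      have "bij_betw i (N (p v)) {1..card (N (p v))}"
        by (rule less.hyps[OF pY(2)[OF less.prems 4] half_tree_V[OF w]])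
      thus ?thesis using even_at_bij[OF H_aut[OF \<Phi>(1)[OF b(1)]] theta_even_at[OF yx th(2) col(2) b(1) w]] b(2) by simp
    qed (use ix iy in auto)
  qed
  thus thesis using that col by blast
qed

end

section \<open>Density\<close>

locale coloured_group = bt_group T d0 d1 H for T :: "'a bigraph" and d0 d1 H +
  fixes x y :: 'a and \<Theta> \<Phi> :: "'a \<Rightarrow> 'a \<Rightarrow> 'a" and i :: "'a \<Rightarrow> nat"
  assumes xy: "adj x y" and theta: "theta_ok x y \<Theta>" "theta_ok y x \<Phi>"
    and colour: "colour_ok x y \<Theta> i" "colour_ok y x \<Phi> i"
    and bij: "\<And>v. v \<in> V \<Longrightarrow> bij_betw i (N v) {1..card (N v)}"
begin

lemma yx: "adj y x" and xV: "x \<in> V" and yV: "y \<in> V" and yN: "y \<in> N x" and xN: "x \<in> N y"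
  using xy adj_sym adj_V by (auto simp: N_def)

definition M :: "('a \<Rightarrow> 'a) set" where "M = {h \<in> H. \<forall>v\<in>V. even_at i h v}"

lemma M_H: "h \<in> M \<Longrightarrow> h \<in> H"
  by (simp add: M_def)

lemma M_group: "perm_group M"
proof (rule perm_groupI)
  show "id \<in> M" using H_id by (auto simp: M_def even_at_def intro!: exI[of _ id] permutes_id)
  show "bij g" if "g \<in> M" for g using H_bij M_H[OF that] .
  show "g \<circ> h \<in> M" if "g \<in> M" "h \<in> M" for g h
    using that even_at_comp[OF H_aut, of h] H_comp by (auto simp: M_def)
  show "inv' g \<in> M" if g: "g \<in> M" for g
  proof -
    have gH: "g \<in> H" using M_H[OF g] .
    have "even_at i (inv' g) v" if "v \<in> V" for v
      using even_at_inv[OF H_aut[OF gH], of i "inv' g v"] g that gH H_inv[OF gH] by (simp add: M_def)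
    thus ?thesis using H_inv[OF gH] by (simp add: M_def)
  qed
qed

lemma Delta_M: "Delta x y \<Theta> \<subseteq> M" "Delta y x \<Phi> \<subseteq> M"
  using Delta_even_at[OF xy theta(1) colour(1) bij[OF xV]] Delta_even_at[OF yx theta(2) colour(2) bij[OF yV]]
  by (auto simp: M_def Delta_def)

lemma Delta_transitive:
  assumes "rich (Delta z z' \<Psi>) (N z)" "z \<in> V" "a \<in> N z" "b \<in> N z"
  obtains h where "h \<in> Delta z z' \<Psi>" "h z = z" "h a = b"
proof -
  obtain \<pi> where \<pi>: "\<pi> permutes N z" "evenperm \<pi>" "\<pi> a = b"
    using ex_even_moving[of "N z" a b] N_finite_card(1,3)[OF assms(2)] assms(3,4) by auto
  obtain h where h: "h \<in> Delta z z' \<Psi>" "\<And>u. u \<in> N z \<Longrightarrow> h u = \<pi> u" using richD[OF assms(1) \<pi>(1,2)] by blast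
  thus thesis using that[OF h(1)] \<pi>(3) assms(3) by (simp add: Delta_def)
qed

lemma rich_Delta: "rich (Delta x y \<Theta>) (N x)" "rich (Delta y x \<Phi>) (N y)"
  using theta by (auto simp: theta_ok_def)

text \<open>Rotate about \<open>x\<close> to reach the side of \<open>y\<close>, then about
  \<open>y\<close> to reach the side of \<open>x\<close>: unless the vertex meets the edge on the
  way, each round brings it nearer to \<open>x\<close>.\<close>

lemma move_to_edge:
  assumes "v \<in> V" shows "\<exists>g\<in>M. g v = x \<or> g v = y"
  using assms
proof (induction "d x v" arbitrary: v rule: less_induct)
  case less
  show ?case
  proof (cases "v = x")
    case True
    thus ?thesis using perm_groupD(1)[OF M_group] by (intro bexI[of _ id]) auto
  next
    case False
    obtain a where a: "a \<in> N x" "v \<in> half_tree x a" using half_tree_ex[OF xV less.prems False] .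
    obtain h where h: "h \<in> Delta x y \<Theta>" "h x = x" "h a = y"
      using Delta_transitive[OF rich_Delta(1) xV a(1) yN] .
    have hH: "h \<in> M" "h \<in> H" using h(1) Delta_M M_H by auto
    have hv: "h v \<in> half_tree x y" using half_tree_image[OF H_aut[OF hH(2)] h(2) xV _ a(2)] N_D(2)[OF a(1)] h(3) by simp
    have dh: "d x (h v) = d x v" using H_d[OF hH(2) xV less.prems] h(2) by simp
    show ?thesis
    proof (cases "h v = y")
      case True
      thus ?thesis using hH(1) by blast
    next
      case False
      obtain b where b: "b \<in> N y" "h v \<in> half_tree y b" using half_tree_ex[OF yV half_tree_V[OF hv] False] .
      obtain k where k: "k \<in> Delta y x \<Phi>" "k y = y" "k b = x"
        using Delta_transitive[OF rich_Delta(2) yV b(1) xN] .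
      have kH: "k \<in> M" "k \<in> H" using k(1) Delta_M M_H by auto
      have kv: "k (h v) \<in> half_tree y x" using half_tree_image[OF H_aut[OF kH(2)] k(2) yV _ b(2)] N_D(2)[OF b(1)] k(3) by simp
      have "d y (k (h v)) = d y (h v)" using H_d[OF kH(2) yV half_tree_V[OF hv]] k(2) by simp
      hence "d x (k (h v)) < d x v" using kv hv dh by (simp add: half_tree_def)
      then obtain g where g: "g \<in> M" "g (k (h v)) = x \<or> g (k (h v)) = y"
        using less.hyps[of "k (h v)"] half_tree_V[OF kv] by blast
      have "g \<circ> k \<circ> h \<in> M" using g(1) kH(1) hH(1) perm_groupD(4)[OF M_group] by blast
      thus ?thesis using g(2) by (intro bexI[of _ "g \<circ> k \<circ> h"]) auto
    qed
  qed
qed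

text \<open>This is where the normalization \<open>\<Psi> z' = id\<close> pays off: the
  identification of that branch with itself is trivial.\<close>

lemma Delta_fixes_branch:
  assumes "theta_ok z z' \<Psi>" "adj z z'" "h \<in> Delta z z' \<Psi>" "h z' = z'" "v \<in> half_tree z z'"
  shows "h v = v"
proof -
  have "z' \<in> N z" using assms(2) by (simp add: N_def)
  hence "h (\<Psi> z' v) = \<Psi> (h z') v" using assms(3,5) by (simp add: Delta_def)
  thus ?thesis using assms(1,4) by (simp add: theta_ok_def)
qed

lemma rich_branch_edge:
  assumes "theta_ok z z' \<Psi>" "adj z z'" "Delta z z' \<Psi> \<subseteq> M"
  shows "rich (pfix (insert z (half_tree z z')) M) (C z' z)"
  unfolding rich_def
proof (intro allI impI)
  fix \<pi> assume \<pi>: "\<pi> permutes C z' z \<and> evenperm \<pi>"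
  have c: "C z' z = N z - {z'}" using C_adj_self assms(2) adj_sym by blast
  have p: "\<pi> permutes N z" using permutes_subset[of \<pi> "C z' z" "N z"] \<pi> c by auto
  have pz: "\<pi> z' = z'" using permutes_not_in[of \<pi> "C z' z" z'] \<pi> c by auto
  obtain h where h: "h \<in> Delta z z' \<Psi>" "\<And>u. u \<in> N z \<Longrightarrow> h u = \<pi> u"
    using richD[of "Delta z z' \<Psi>" "N z" \<pi>] assms(1) p \<pi> by (auto simp: theta_ok_def)
  have "h z' = z'" using h(2) pz assms(2) by (simp add: N_def)
  hence "h \<in> pfix (insert z (half_tree z z')) M"
    using Delta_fixes_branch[OF assms(1,2) h(1)] h(1) assms(3) by (auto simp: pfix_def Delta_def)
  thus "\<exists>h\<in>pfix (insert z (half_tree z z')) M. \<forall>u\<in>C z' z. h u = \<pi> u"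
    using h(2) c by auto
qed

text \<open>\<open>M\<close> carries every edge to the edge of \<open>x\<close> and
  \<open>y\<close>: bring one end there by \<open>move_to_edge\<close>, then rotate the other into
  place. Conjugation transports \<open>rich_branch_edge\<close>.\<close>

lemma rich_branch:
  assumes "adj w v" shows "rich (pfix (insert v (half_tree v w)) M) (C w v)"
proof -
  have V: "v \<in> V" "w \<in> V" using assms adj_V by auto
  have "\<exists>f\<in>M. f v = x \<and> f w = y \<or> f v = y \<and> f w = x"
  proof -
    obtain g where g: "g \<in> M" "g v = x \<or> g v = y" using move_to_edge[OF V(1)] by blast
    have gw: "g w \<in> N (g v)" using aut_adj[OF H_aut[OF M_H[OF g(1)]], of v w] assms adj_sym by (simp add: N_def)
    from g(2) show ?thesis
    proof
      assume e: "g v = x"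
      obtain h where "h \<in> Delta x y \<Theta>" "h x = x" "h (g w) = y"
        using Delta_transitive[OF rich_Delta(1) xV _ yN, of "g w"] gw e by auto
      thus ?thesis using e perm_groupD(4)[OF M_group, of h g] g(1) Delta_M by (intro bexI[of _ "h \<circ> g"]) auto
    next
      assume e: "g v = y"
      obtain h where "h \<in> Delta y x \<Phi>" "h y = y" "h (g w) = x"
        using Delta_transitive[OF rich_Delta(2) yV _ xN, of "g w"] gw e by auto
      thus ?thesis using e perm_groupD(4)[OF M_group, of h g] g(1) Delta_M by (intro bexI[of _ "h \<circ> g"]) auto
    qed
  qed
  then obtain f where f: "f \<in> M" "f v = x \<and> f w = y \<or> f v = y \<and> f w = x" by blast
  have fa: "aut f" and fH: "f \<in> H" using H_aut M_H[OF f(1)] by auto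
  have r: "rich (pfix (insert (f v) (half_tree (f v) (f w))) M) (C (f w) (f v))"
    using f(2) rich_branch_edge[OF theta(1) xy Delta_M(1)] rich_branch_edge[OF theta(2) yx Delta_M(2)] by auto
  show ?thesis
    unfolding rich_def
  proof (intro allI impI)
    fix \<pi> assume \<pi>: "\<pi> permutes C w v \<and> evenperm \<pi>"
    have im: "f ` C w v = C (f w) (f v)" using aut_C[OF fa V(2,1)] .
    have inj: "inj_on f (C w v)" using aut_bij[OF fa] by (auto intro: inj_on_subset simp: bij_def)
    define \<pi>' where "\<pi>' = map_permutation (C w v) f \<pi>"
    have "\<pi>' permutes C (f w) (f v)" unfolding \<pi>'_def
      using map_permutation_permutes[OF bij_betw_imageI[OF inj im]] \<pi> by blast
    moreover have "evenperm \<pi>'" unfolding \<pi>'_def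
      using evenperm_map_permutation[OF inj] \<pi> C_finite_card(1)[OF V(2,1)] by blast
    ultimately obtain k where k: "k \<in> pfix (insert (f v) (half_tree (f v) (f w))) M"
      "\<And>u. u \<in> C (f w) (f v) \<Longrightarrow> k u = \<pi>' u" using richD[OF r] by blast
    have kM: "k \<in> M" "k (f v) = f v" "\<And>u. u \<in> half_tree (f v) (f w) \<Longrightarrow> k u = u"
      using k(1) by (auto simp: pfix_def)
    define l where "l = inv' f \<circ> k \<circ> f"
    have lM: "l \<in> M" unfolding l_def
      using perm_groupD(4)[OF M_group perm_groupD(4)[OF M_group perm_groupD(3)[OF M_group f(1)] kM(1)] f(1)] .
    have "l v = v" using kM(2) fH by (simp add: l_def)
    moreover have "l u = u" if u: "u \<in> half_tree v w" for u
    proof -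
      have "f u \<in> half_tree (f v) (f w)"
        using u aut_d[OF fa V(1), of u] aut_d[OF fa V(2), of u] fa by (simp add: half_tree_def)
      thus ?thesis using kM(3) fH by (simp add: l_def)
    qed
    moreover have "l u = \<pi> u" if u: "u \<in> C w v" for u
    proof -
      have "k (f u) = f (\<pi> u)"
        using k(2)[of "f u"] im u map_permutation_apply[OF inj u, of \<pi>] by (auto simp: \<pi>'_def)
      thus ?thesis using fH by (simp add: l_def)
    qed
    ultimately show "\<exists>h\<in>pfix (insert v (half_tree v w)) M. \<forall>u\<in>C w v. h u = \<pi> u"
      using lM by (intro bexI[of _ l] pfixI) auto
  qed
qed

text \<open>Seen from \<open>x\<close>, a vertex beyond \<open>v\<close> is reached through
  \<open>v\<close>; within radius \<open>r + 1\<close> this leaves only \<open>v\<close> and its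
  children.\<close>

lemma far_branch:
  assumes "v \<in> S x r" "adj w v" "d x v = Suc (d x w)" "u \<in> V" "d x u \<le> Suc r" "u \<noteq> v" "u \<notin> C x v"
  shows "u \<in> half_tree v w"
proof (rule ccontr)
  assume "u \<notin> half_tree v w"
  have V: "v \<in> V" "w \<in> V" "d x v = r" using assms(1,2) adj_V by (auto simp: S_def)
  have vw: "adj v w" using assms(2) adj_sym by blast
  have "d w u = Suc (d v u)" using \<open>u \<notin> half_tree v w\<close> half_tree_complement[OF vw assms(4)] by (auto simp: half_tree_def)
  moreover have "d v x = Suc (d w x)" using assms(3) d_sym[OF xV V(1)] d_sym[OF xV V(2)] by simp
  ultimately have e: "d x u = d x v + d v u" using d_through_edge[OF vw xV _ assms(4)] by simp
  moreover have "d v u \<noteq> 0" using d_zero_iff[OF V(1) assms(4)] assms(6) by simp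
  ultimately have "d v u = 1" using assms(5) V(3) by simp
  hence "u \<in> C x v" using d_1[OF V(1) assms(4)] e by (simp add: in_C_iff)
  thus False using assms(7) by blast
qed

text \<open>The elements from \<open>rich_branch\<close> fix the whole half tree towards
  \<open>x\<close>, hence by \<open>far_branch\<close> everything relevant in the ball of radius
  \<open>r + 1\<close>. For \<open>r = 0\<close> the rotations in \<open>Delta x y \<Theta>\<close>
  do it.\<close>

lemma rich_sphere:
  assumes v: "v \<in> S x r" and \<pi>: "\<pi> permutes C x v" "evenperm \<pi>"
  shows "\<exists>k\<in>pfix (B x r) M. (\<forall>u\<in>C x v. k u = \<pi> u) \<and> (\<forall>j\<in>S x r - {v}. \<forall>u\<in>C x j. k u = u)"
proof -
  have vV: "v \<in> V" "d x v = r" using v by (auto simp: S_def)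
  show ?thesis
  proof (cases r)
    case 0
    hence vx: "v = x" using d_zero_iff[OF xV vV(1)] vV by simp
    have c: "C x x = N x" using C_self[OF xV] .
    obtain h where h: "h \<in> Delta x y \<Theta>" "\<And>u. u \<in> N x \<Longrightarrow> h u = \<pi> u"
      using richD[OF rich_Delta(1), of \<pi>] \<pi> vx c by auto
    have Bx: "B x 0 = {x}" "S x 0 = {x}" using d_zero_iff[OF xV] xV by (auto simp: B_def S_def)
    have "h \<in> pfix (B x 0) M" using h(1) Delta_M Bx by (auto simp: pfix_def Delta_def)
    thus ?thesis using h(2) vx c 0 Bx by auto
  next
    case (Suc n)
    obtain w where w: "adj v w" "d x w = n" using ex_parent[OF xV vV(1)] vV(2) Suc by metis
    have wv: "adj w v" using w(1) adj_sym by blast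
    have dw: "d x v = Suc (d x w)" using w vV Suc by simp
    have c: "C x v = C w v" using C_parent[OF xV w(1) dw] C_adj_self[OF wv] by simp
    obtain k where k: "k \<in> pfix (insert v (half_tree v w)) M" "\<And>u. u \<in> C x v \<Longrightarrow> k u = \<pi> u"
      using richD[OF rich_branch[OF wv]] \<pi> unfolding c by blast
    have kM: "k \<in> M" "k v = v" "\<And>u. u \<in> half_tree v w \<Longrightarrow> k u = u" using k(1) by (auto simp: pfix_def)
    have kfix: "k u = u" if "u \<in> V" "d x u \<le> Suc r" "u \<notin> C x v" for u
      using far_branch[OF v wv dw that(1,2) _ that(3)] kM(2,3) by (cases "u = v") auto
    have "k \<in> pfix (B x r) M"
      using kM(1) kfix vV by (intro pfixI) (auto simp: B_def in_C_iff)
    moreover have "k u = u" if "j \<in> S x r - {v}" "u \<in> C x j" for j u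
    proof (rule kfix)
      show "u \<in> V" using C_V that(2) by blast
      show "d x u \<le> Suc r" using that by (simp add: in_C_iff S_def)
      show "u \<notin> C x v" using C_disjoint[OF xV that(2), of v] that(1) by blast
    qed
    ultimately show ?thesis using k(2) by blast
  qed
qed

text \<open>If an element of \<open>M\<close> agrees with \<open>g\<close> on a ball, the quotient
  fixes the ball and permutes the children of each boundary vertex evenly. \<open>M\<close> realizes
  these permutations simultaneously, so the agreement extends by one radius; closedness of
  \<open>H\<close> does the rest.\<close>

lemma even_at_automorphism_in_H:
  assumes g: "aut g" "\<And>v. v \<in> V \<Longrightarrow> ty (g v) = ty v" "\<And>v. v \<in> V \<Longrightarrow> even_at i g v"
  shows "g \<in> H"
proof -
  have approx: "\<exists>h\<in>M. \<forall>v\<in>B x n. h v = g v" for n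
  proof (induction n)
    case 0
    have gxV: "g x \<in> V" using g(1) xV by simp
    obtain k where k: "k \<in> M" "k (g x) = x \<or> k (g x) = y" using move_to_edge[OF gxV] by blast
    \<comment> \<open>\<open>g\<close> and \<open>k\<close> preserve types, so \<open>g x\<close>
      cannot have been moved to \<open>y\<close>.\<close>
    have "ty (k (g x)) = ty x" using H_ty[OF M_H[OF k(1)] gxV] g(2)[OF xV] by simp
    hence "k (g x) = x" using k(2) adj_ty[OF xy] by auto
    hence "inv' k x = g x" using bij_inv_eqI[OF H_bij[OF M_H[OF k(1)]]] by blast
    moreover have "B x 0 = {x}" using d_zero_iff[OF xV] xV by (auto simp: B_def)
    ultimately show ?case using perm_groupD(3)[OF M_group k(1)] by auto
  next
    case (Suc n)
    then obtain h where h: "h \<in> M" "\<And>v. v \<in> B x n \<Longrightarrow> h v = g v" by blast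
    have hH: "h \<in> H" using M_H[OF h(1)] .
    have ih: "inv' h \<in> M" using perm_groupD(3)[OF M_group h(1)] .
    define f where "f = inv' h \<circ> g"
    have f: "aut f" unfolding f_def using aut_comp[OF H_aut[OF H_inv[OF hH]] g(1)] .
    have fg: "even_at i f v" if "v \<in> V" for v unfolding f_def
    proof (rule even_at_comp[OF g(1) g(3)[OF that]])
      show "even_at i (inv' h) (g v)" using ih g(1) that by (simp add: M_def)
    qed
    have fB: "f v = v" if "v \<in> B x n" for v using h(2)[OF that] bij_inv_eqI[OF H_bij[OF hH], of v "g v"] by (simp add: f_def)
    have SB: "v \<in> V" "v \<in> B x n" if "v \<in> S x n" for v using that by (auto simp: S_def B_def)
    have fx: "f x = x" using fB xV by (simp add: B_def)
    have fC: "f ` C x v = C x v" if "v \<in> S x n" for v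
      using fix_C[OF f xV SB(1)[OF that] fx fB[OF SB(2)[OF that]]] .
    have even: "restrict_id f (C x v) permutes C x v \<and> evenperm (restrict_id f (C x v))" if v: "v \<in> S x n" for v
    proof -
      have vV: "v \<in> V" "f v = v" using SB[OF v] fB by auto
      \<comment> \<open>Parity is known on all of \<open>N v\<close>; the neighbour towards
        \<open>x\<close> lies in the ball and is fixed, so leaving it out changes nothing.\<close>
      have "restrict_id f (C x v) = restrict_id f (N v)"
      proof (cases "v = x")
        case True
        thus ?thesis using C_self[OF xV] by simp
      next
        case False
        then obtain k where "d x v = Suc k" using d_zero_iff[OF xV vV(1)] by (cases "d x v") auto
        then obtain w where w: "adj v w" "d x v = Suc (d x w)" using ex_parent[OF xV vV(1)] by metis
        have "f w = w" using fB w v adj_V(2)[OF w(1)] by (simp add: S_def B_def)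
        thus ?thesis using C_parent[OF xV w] by (auto simp: fun_eq_iff restrict_id_def)
      qed
      moreover have "evenperm (restrict_id f (N v))"
        using even_at_iff_even[OF vV(1) bij[OF vV(1)] f vV(2)] fg[OF vV(1)] by blast
      moreover have "restrict_id f (C x v) permutes C x v"
        using fC[OF v] aut_bij[OF f]
        by (intro permutes_restrict_id bij_betw_imageI) (auto intro: inj_on_subset simp: bij_def)
      ultimately show ?thesis by simp
    qed
    have "\<exists>k\<in>pfix (B x n) M. \<forall>v\<in>S x n. \<forall>u\<in>C x v. k u = restrict_id f (C x v) u"
    proof (rule rich_family[OF perm_group_pfix[OF M_group] S_finite[OF xV] _ rich_sphere even])
      show "k ` C x v = C x v" if "k \<in> pfix (B x n) M" "v \<in> S x n" for k v
        using that SB[OF that(2)] M_H xV by (intro H_fix_C) (auto simp: pfix_def B_def)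
    qed
    then obtain k where k: "k \<in> M" "\<And>v. v \<in> B x n \<Longrightarrow> k v = v" "\<And>v u. v \<in> S x n \<Longrightarrow> u \<in> C x v \<Longrightarrow> k u = f u"
      by (auto simp: pfix_def)
    have kf: "k v = f v" if "v \<in> B x (Suc n)" for v
    proof (cases "v \<in> B x n")
      case True
      thus ?thesis using k(2) fB by simp
    next
      case False
      then obtain u where "u \<in> S x n" "v \<in> C x u"
        using ball_boundary[OF xV \<open>v \<in> B x (Suc n)\<close>] by blast
      thus ?thesis using k(3) by blast
    qed
    have "(h \<circ> k) v = g v" if "v \<in> B x (Suc n)" for v
      using kf[OF that] hH by (simp add: f_def)
    thus ?case using perm_groupD(4)[OF M_group h(1) k(1)] by blast
  qed
  show ?thesis
  proof (rule H_closed[OF g(1)])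
    fix F assume F: "finite F" "F \<subseteq> V"
    obtain h where h: "h \<in> M" "\<And>v. v \<in> B x (Max (d x ` F)) \<Longrightarrow> h v = g v" using approx by blast
    have "F \<subseteq> B x (Max (d x ` F))" using F by (auto simp: B_def)
    thus "\<exists>h\<in>H. \<forall>v\<in>F. h v = g v" using h M_H by blast
  qed
qed

end

section \<open>The theorem\<close>

context bitree
begin

lemma aut_group_inv:
  assumes "aut g" shows "m_inv (aut_group T) g = inv' g"
  unfolding m_inv_def
proof (rule the_equality)
  have p: "g permutes V" using assms by (simp add: aut_iff)
  show "inv' g \<in> carrier (aut_group T) \<and> g \<otimes>\<^bsub>aut_group T\<^esub> inv' g = \<one>\<^bsub>aut_group T\<^esub> \<and>
      inv' g \<otimes>\<^bsub>aut_group T\<^esub> g = \<one>\<^bsub>aut_group T\<^esub>"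
    using aut_inv[OF assms] permutes_inv_o[OF p] by (simp add: aut_def aut_group_def)
  show "y = inv' g" if "y \<in> carrier (aut_group T) \<and> g \<otimes>\<^bsub>aut_group T\<^esub> y = \<one>\<^bsub>aut_group T\<^esub> \<and>
      y \<otimes>\<^bsub>aut_group T\<^esub> g = \<one>\<^bsub>aut_group T\<^esub>" for y
    using that inv_unique_comp[of g y] by (simp add: aut_group_def)
qed

lemma perm_group_subgroup:
  assumes "subgroup H (aut_group T)" shows "perm_group H"
proof (rule perm_groupI)
  interpret subgroup H "aut_group T" by fact
  have aut: "aut h" if "h \<in> H" for h using mem_carrier[OF that] by (simp add: aut_def)
  show "id \<in> H" using one_closed by (simp add: aut_group_def)
  show "bij h" if "h \<in> H" for h using aut_bij[OF aut[OF that]] .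
  show "inv' h \<in> H" if "h \<in> H" for h
    using m_inv_closed[OF that] aut_group_inv[OF aut[OF that]] by simp
  show "g \<circ> h \<in> H" if "g \<in> H" "h \<in> H" for g h
    using m_closed[OF that] by (simp add: aut_group_def)
qed

text \<open>A basic neighbourhood in the product topology restricts finitely many coordinates only.
  An element of \<open>H\<close> agreeing with \<open>g\<close> on those would lie in the open
  complement of \<open>H\<close>.\<close>

lemma closed_approx:
  assumes cl: "closedin (aut_topology T) H" and g: "aut g"
    and ap: "\<And>F. finite F \<Longrightarrow> F \<subseteq> V \<Longrightarrow> \<exists>h\<in>H. \<forall>v\<in>F. h v = g v"
  shows "g \<in> H"
proof (rule ccontr)
  assume "g \<notin> H"
  have top: "topspace (aut_topology T) = carrier (aut_group T)"
    unfolding aut_topology_def topspace_pullback_topology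
    using aut_V by (auto simp: aut_def)
  have "openin (aut_topology T) (carrier (aut_group T) - H)" and sub: "H \<subseteq> carrier (aut_group T)"
    using cl top by (auto simp: closedin_def)
  then obtain U where U: "openin (product_topology (\<lambda>_. discrete_topology V) V) U"
    and e: "carrier (aut_group T) - H = (\<lambda>g. restrict g V) -` U \<inter> carrier (aut_group T)"
    unfolding aut_topology_def openin_pullback_topology by blast
  have "restrict g V \<in> U" using \<open>g \<notin> H\<close> g e by (auto simp: aut_def)
  then obtain W where W: "finite {v \<in> V. W v \<noteq> V}" "restrict g V \<in> Pi\<^sub>E V W" "Pi\<^sub>E V W \<subseteq> U"
    using U unfolding openin_product_topology_alt by fastforce
  obtain h where h: "h \<in> H" "\<forall>v\<in>{v \<in> V. W v \<noteq> V}. h v = g v" using ap[OF W(1)] by auto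
  have hc: "h \<in> carrier (aut_group T)" using h(1) sub by blast
  have "h v \<in> W v" if v: "v \<in> V" for v
  proof (cases "W v = V")
    case True
    thus ?thesis using v hc by (simp add: aut_def[symmetric])
  next
    case False
    hence "h v = g v" using h(2) v by blast
    thus ?thesis using W(2) v by (auto simp: PiE_iff)
  qed
  hence "restrict h V \<in> U" using W(3) by (auto simp: PiE_iff)
  thus False using e hc h(1) by blast
qed

text \<open>The local action permutes edges and is known up to a numbering \<open>b\<close>.
  Composing \<open>b\<close> with \<open>u \<mapsto> {x, u}\<close> numbers the neighbours, and
  parity is unchanged under the transfer.\<close>

lemma local_action_realizes:
  assumes "perm_isomorphic (edges_at T x) (local_action T H x) {1..n} F" "carrier (alt_group n) \<subseteq> F"
    and Haut: "\<And>h. h \<in> H \<Longrightarrow> aut h" and x: "x \<in> V" and \<pi>: "\<pi> permutes N x" "evenperm \<pi>"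
  shows "\<exists>h\<in>H. h x = x \<and> (\<forall>u\<in>N x. h u = \<pi> u)"
proof -
  obtain b where b: "bij_betw b (edges_at T x) {1..n}"
    and F: "map_permutation (edges_at T x) b ` local_action T H x = F"
    using assms(1) by (auto simp: perm_isomorphic_def)
  define c where "c = b \<circ> (\<lambda>u. {x, u})"
  have c: "bij_betw c (N x) {1..n}" unfolding c_def using bij_betw_trans[OF edges_at_N b] .
  have inj: "inj_on c (N x)" using c by (rule bij_betw_imp_inj_on)
  define \<sigma> where "\<sigma> = map_permutation (N x) c \<pi>"
  have "\<sigma> permutes {1..n}" "evenperm \<sigma>" unfolding \<sigma>_def
    using map_permutation_permutes[OF c \<pi>(1)] evenperm_map_permutation[OF inj \<pi>(1) N_finite_card(1)[OF x]] \<pi>(2) by auto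
  hence "\<sigma> \<in> F" using assms(2) alt_group_carrier by blast
  then obtain h where h: "h \<in> H" "h x = x"
    and s: "\<sigma> = map_permutation (edges_at T x) b (restrict_id ((`) h) (edges_at T x))"
    using F by (auto simp: local_action_def)
  have "h u = \<pi> u" if u: "u \<in> N x" for u
  proof -
    have E: "{x, u} \<in> edges_at T x" using bij_betwE[OF edges_at_N[of x]] u by simp
    have hu: "h u \<in> N x" using aut_N[OF Haut[OF h(1)], of x] h(2) u by auto
    have "\<sigma> (c u) = c (\<pi> u)" unfolding \<sigma>_def using map_permutation_apply[OF inj u] .
    moreover have "\<sigma> (c u) = c (h u)"
      unfolding s using map_permutation_apply[OF bij_betw_imp_inj_on[OF b] E, of "restrict_id ((`) h) (edges_at T x)"] E h(2)
      by (simp add: c_def)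
    moreover have "\<pi> u \<in> N x" using \<pi>(1) u permutes_in_image by metis
    ultimately show ?thesis using inj_onD[OF inj _ hu, of "\<pi> u"] by simp
  qed
  thus ?thesis using h by blast
qed

lemma vertex_sphere_1:
  assumes "v \<in> V" shows "vertex_sphere T v 1 = N v"
proof -
  have "u \<in> V \<and> d v u = 1 \<longleftrightarrow> adj v u" for u
    using d_1[OF assms, of u] d_adj[of v u] adj_V(2)[of v u] by blast
  thus ?thesis by (simp add: vertex_sphere_def N_def)
qed

end

lemma (in bt_group) ex_coloured_group: "\<exists>x y \<Theta> \<Phi> i. coloured_group T d0 d1 H x y \<Theta> \<Phi> i"
proof -
  obtain x where x: "x \<in> V" using tree by (auto simp: semiregular_tree_def)
  obtain y where "y \<in> N x" using obtain_not_in[of "[]" "N x"] N_finite_card(3)[OF x] by auto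
  hence xy: "adj x y" "adj y x" using adj_sym by (auto simp: N_def)
  obtain \<Theta> where \<Theta>: "theta_ok x y \<Theta>" using ex_Theta[OF xy(1)] unfolding theta_ok_def by metis
  obtain \<Phi> where \<Phi>: "theta_ok y x \<Phi>" using ex_Theta[OF xy(2)] unfolding theta_ok_def by metis
  obtain i where "\<And>v. v \<in> V \<Longrightarrow> bij_betw i (N v) {1..card (N v)}" "colour_ok x y \<Theta> i" "colour_ok y x \<Phi> i"
    using ex_colouring[OF xy(1) \<Theta> \<Phi>] by metis
  thus ?thesis using xy \<Theta> \<Phi> bt_group_axioms
    by (intro exI[of _ x] exI[of _ y] exI[of _ \<Theta>] exI[of _ \<Phi>] exI[of _ i])
      (auto simp: coloured_group_def coloured_group_axioms_def)
qed

section \<open>Legality of the colouring and its even automorphisms\<close>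

context coloured_group
begin

lemma legal: "legal_coloring d0 d1 T i"
proof -
  have b: "bij_betw i (N v) {1..if ty v then d0 else d1}" if "v \<in> V" for v
    using bij[OF that] N_finite_card(2)[OF that] by simp
  have c: "i u \<in> {1..if ty u then d1 else d0}" if "u \<in> V" for u
  proof -
    obtain v where "v \<in> N u" using obtain_not_in[of "[]" "N u"] N_finite_card(3)[OF \<open>u \<in> V\<close>] by auto
    hence v: "v \<in> V" "u \<in> N v" "ty v \<noteq> ty u" using adj_V adj_sym adj_ty[of u v] by (auto simp: N_def)
    thus ?thesis using bij_betwE[OF b[OF v(1)]] by auto
  qed
  have V: "v \<in> V" "ty v" if "v \<in> part0 T" for v using that by (auto simp: verts_def ty_def)
  have V': "v \<in> V" "\<not> ty v" if "v \<in> part1 T" for v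
    using that part1_iff[of v] by (auto simp: verts_def)
  show ?thesis
    unfolding legal_coloring_def
    using b[OF V(1)] b[OF V'(1)] c[OF V(1)] c[OF V'(1)] V(2) V'(2)
    by (auto simp: vertex_sphere_1[OF V(1)] vertex_sphere_1[OF V'(1)] image_subset_iff simp del: One_nat_def atLeastAtMost_iff)
qed

lemma sigma_even_at:
  assumes g: "aut g" and v: "v \<in> V" "evenperm (sigma T i g v)" and ty: "ty (g v) = ty v"
  shows "even_at i g v"
proof -
  have im: "i ` N v = {1..card (N v)}" using bij_betw_imp_surj_on[OF bij[OF v(1)]] .
  have s: "sigma T i g v = restrict_id (i \<circ> g \<circ> inv_into (N v) i) {1..card (N v)}"
    unfolding sigma_def vertex_sphere_1[OF v(1)] im ..
  have "bij_betw g (N v) (N (g v))"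
    using aut_N[OF g, of v] aut_bij[OF g] by (intro bij_betw_imageI) (auto intro: inj_on_subset simp: bij_def)
  moreover have "bij_betw i (N (g v)) {1..card (N v)}" using bij[of "g v"] g v(1) card_N_aut[OF g] by simp
  ultimately have "bij_betw (i \<circ> (g \<circ> inv_into (N v) i)) {1..card (N v)} {1..card (N v)}"
    using bij_betw_trans[OF bij_betw_trans[OF bij_betw_inv_into[OF bij[OF v(1)]]]] by blast
  hence "sigma T i g v permutes {1..card (N v)}" unfolding s by (intro permutes_restrict_id) (simp add: o_assoc)
  moreover have "i (g u) = sigma T i g v (i u)" if "u \<in> N v" for u
  proof -
    have "i u \<in> {1..card (N v)}" using im that by blast
    thus ?thesis unfolding s using inv_into_f_f[OF bij_betw_imp_inj_on[OF bij[OF v(1)]] that] by simp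
  qed
  ultimately show ?thesis using v(2) unfolding even_at_def by blast
qed

lemma alt_plus_subset: "alt_plus T i \<subseteq> H"
proof
  fix g assume g: "g \<in> alt_plus T i"
  hence a: "aut g" "g ` part0 T = part0 T" "g ` part1 T = part1 T" by (auto simp: alt_plus_def aut_plus_def aut_def)
  have ty: "ty (g v) = ty v" if "v \<in> V" for v
    using that a(2,3) part1_iff[of "g v"] a(1) by (auto simp: verts_def ty_def)
  show "g \<in> H"
    by (rule even_at_automorphism_in_H[OF a(1) ty sigma_even_at[OF a(1)]]) (use g ty in \<open>auto simp: alt_plus_def\<close>)
qed

end

theorem theorem7:
  fixes T :: "'a bigraph" and H :: "('a \<Rightarrow> 'a) set"
    and d0 d1 :: nat and F0 F1 :: "(nat \<Rightarrow> nat) set"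
  assumes "d0 \<ge> 6" and "d1 \<ge> 6"
    and "semiregular_tree d0 d1 T"
    and "H \<in> closed_two_transitive_groups T"
    and "subgroup F0 (sym_group d0)" and "carrier (alt_group d0) \<subseteq> F0"
    and "subgroup F1 (sym_group d1)" and "carrier (alt_group d1) \<subseteq> F1"
    and "\<forall>x \<in> part0 T. perm_isomorphic (edges_at T x) (local_action T H x) {1..d0} F0"
    and "\<forall>y \<in> part1 T. perm_isomorphic (edges_at T y) (local_action T H y) {1..d1} F1"
  shows "\<exists>i. legal_coloring d0 d1 T i \<and> alt_plus T i \<subseteq> H"
proof -
  interpret bitree T d0 d1 using assms(1-3) by unfold_locales
  have H: "subgroup H (aut_group T)" "closedin (aut_topology T) H" "H \<subseteq> aut_plus T"
    "two_transitive H act_end (ends T)"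
    using assms(4) by (auto simp: closed_two_transitive_groups_def)
  have plus: "aut h" "h ` part0 T = part0 T" "h ` part1 T = part1 T" if "h \<in> H" for h
    using subsetD[OF H(3) that] by (simp_all add: aut_plus_def aut_def)
  have loc: "\<exists>h\<in>H. h x = x \<and> (\<forall>u\<in>N x. h u = \<pi> u)"
    if x: "x \<in> V" and \<pi>: "\<pi> permutes N x" "evenperm \<pi>" for x \<pi>
  proof (cases "x \<in> part0 T")
    case True
    show ?thesis
      using local_action_realizes[OF bspec[OF assms(9) True] assms(6) plus(1) x \<pi>] .
  next
    case False
    hence "x \<in> part1 T" using x by (simp add: verts_def)
    thus ?thesis
      using local_action_realizes[OF bspec[OF assms(10)] assms(8) plus(1) x \<pi>] by blast
  qed
  interpret bt_group T d0 d1 H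
  proof unfold_locales
    show "ty (h v) = ty v" if "h \<in> H" "v \<in> V" for h v
      using that(2) plus(2,3)[OF that(1)] part1_iff[of "h v"] plus(1)[OF that(1)]
      by (auto simp: verts_def ty_def)
    show "g \<in> H" if "aut g" "\<And>F. finite F \<Longrightarrow> F \<subseteq> V \<Longrightarrow> \<exists>h\<in>H. \<forall>v\<in>F. h v = g v" for g
      by (rule closed_approx[OF H(2) that])
  qed (rule plus(1) perm_group_subgroup[OF H(1)] loc H(4); assumption)+
  obtain x y \<Theta> \<Phi> i where "coloured_group T d0 d1 H x y \<Theta> \<Phi> i" using ex_coloured_group by blast
  then interpret coloured_group T d0 d1 H x y \<Theta> \<Phi> i .
  show ?thesis using legal alt_plus_subset by blast
qed

end
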